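(* There exists a deterministic algorithm that, given two forests $F$ and $G$ with $n$ nodes in total, each node labeled with a letter of an alphabet $\Sigma$, and oracle access to a normalized weight function $w:(\Sigma\cup\{\varepsilon\})^2\to\mathbb{R}_{\ge 0}$, determines $k:=\mathsf{ted}^w(F,G)$ in $\mathcal{O}(nk^2\log n)$ time.
   Context: Forests are rooted ordered forests with node labels from $\Sigma$, identified with their Euler tours: balanced strings of labeled parentheses $(_a,)_a$ ($a\in\Sigma$), each node labeled $a$ contributing an opening $(_a$ and a matching closing $)_a$. For a position $i$ of $F$, $\mathrm{mate}_F(i)$ is the position of the parenthesis matched with $F[i]$. A weight function $w:(\Sigma\cup\{\varepsilon\})^2\to\mathbb{R}_{\ge0}$ is normalized if $w(a,a)=0$ and $w(a,b)\ge1$ for all distinct $a,b\in\Sigma\cup\{\varepsilon\}$ (no triangle inequality is assumed). Define $\tilde w(p,q)=\tfrac12 w(\lambda(p),\lambda(q))$ for $p,q$ parentheses or $\varepsilon$, where $\lambda((_a)=\lambda()_a)=a$, $\lambda(\varepsilon)=\varepsilon$. An alignment of string $X$ onto string $Y$ is a path from $(0,0)$ to $(|X|,|Y|)$ in the grid graph on $[0..|X|]\times[0..|Y|]$ with edges $(x,y)\to(x+1,y)$ (deletion of $X[x]$, cost $\tilde w(X[x],\varepsilon)$), $(x,y)\to(x,y+1)$ (insertion of $Y[y]$, cost $\tilde w(\varepsilon,Y[y])$), $(x,y)\to(x+1,y+1)$ (aligning $X[x]$ with $Y[y]$, cost $\tilde w(X[x],Y[y])$); its cost is the sum of its edge costs.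 A forest alignment of $F$ onto $G$ is an alignment such that whenever it aligns $F[f]$ with $G[g]$ it also aligns $F[\mathrm{mate}_F(f)]$ with $G[\mathrm{mate}_G(g)]$. The tree edit distance $\mathsf{ted}^w(F,G)$ is the minimum cost of a forest alignment of $F$ onto $G$.
   Formalization: The running time is proved as O(1 + n + nk² log n), which equals O(nk² log n) when n ≥ 2 and k ≥ 1; for k = 0 or n = 1 the literal bound would be zero time, which no algorithm can meet. *)

theory Defs
  imports Complex_Main
begin

section \<open>Forests and parenthesis strings\<close>

datatype (labels: 'a) tree = Node 'a "'a tree list"

type_synonym 'a forest = "'a tree list"

definition forest_labels :: "'a forest \<Rightarrow> 'a set" where
  "forest_labels F = (\<Union>T\<in>set F. labels T)"

fun tree_nodes :: "'a tree \<Rightarrow> nat" where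
  "tree_nodes (Node a Ts) = Suc (\<Sum>T\<leftarrow>Ts. tree_nodes T)"

definition forest_nodes :: "'a forest \<Rightarrow> nat" where
  "forest_nodes F = (\<Sum>T\<leftarrow>F. tree_nodes T)"

datatype 'a paren = is_open: Open (lab: 'a) | Close (lab: 'a)

fun euler_tree :: "'a tree \<Rightarrow> 'a paren list" where
  "euler_tree (Node a Ts) = Open a # concat (map euler_tree Ts) @ [Close a]"

definition euler :: "'a forest \<Rightarrow> 'a paren list" where
  "euler F = concat (map euler_tree F)"

inductive balanced :: "'a paren list \<Rightarrow> bool" where
  empty: "balanced []"
| node: "balanced X \<Longrightarrow> balanced Y \<Longrightarrow> balanced (Open a # X @ Close a # Y)"

text \<open>
  Positions are counted from 0. The parentheses at positions \<open>i < j\<close> match iff they form a pair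
  with equal labels and the substring strictly between them is balanced.
\<close>

definition matched :: "'a paren list \<Rightarrow> nat \<Rightarrow> nat \<Rightarrow> bool" where
  "matched X i j \<longleftrightarrow> i < j \<and> j < length X \<and>
     (\<exists>a. X ! i = Open a \<and> X ! j = Close a) \<and> balanced (take (j - Suc i) (drop (Suc i) X))"

definition mate :: "'a paren list \<Rightarrow> nat \<Rightarrow> nat" where
  "mate X i = (THE j. matched X i j \<or> matched X j i)"

section \<open>Weights, alignments and tree edit distance\<close>

text \<open>The empty word \<open>\<epsilon>\<close> is \<^const>\<open>None\<close>; a letter \<open>a\<close> is \<open>Some a\<close>.\<close>

type_synonym 'a weight = "'a option \<Rightarrow> 'a option \<Rightarrow> real"

definition normalized :: "'a set \<Rightarrow> 'a weight \<Rightarrow> bool" where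
  "normalized \<Sigma> w \<longleftrightarrow>
     (let E = insert None (Some ` \<Sigma>) in
        (\<forall>a\<in>E. \<forall>b\<in>E. 0 \<le> w a b) \<and>
        (\<forall>a\<in>E. w a a = 0) \<and>
        (\<forall>a\<in>E. \<forall>b\<in>E. a \<noteq> b \<longrightarrow> 1 \<le> w a b))"

definition paren_weight :: "'a weight \<Rightarrow> 'a paren option \<Rightarrow> 'a paren option \<Rightarrow> real" where
  "paren_weight w p q = w (map_option lab p) (map_option lab q) / 2"

type_synonym vertex = "nat \<times> nat"

fun grid_edge :: "vertex \<Rightarrow> vertex \<Rightarrow> bool" where
  "grid_edge (x, y) v \<longleftrightarrow> v = (Suc x, y) \<or> v = (x, Suc y) \<or> v = (Suc x, Suc y)"

fun edge_cost :: "'a weight \<Rightarrow> 'a paren list \<Rightarrow> 'a paren list \<Rightarrow> vertex \<times> vertex \<Rightarrow> real" where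
  "edge_cost w X Y ((x, y), (x', y')) =
     paren_weight w (if x' = Suc x then Some (X ! x) else None)
                    (if y' = Suc y then Some (Y ! y) else None)"

text \<open>An alignment is the list of vertices visited by the path.\<close>

definition alignment :: "'a paren list \<Rightarrow> 'a paren list \<Rightarrow> vertex list \<Rightarrow> bool" where
  "alignment X Y P \<longleftrightarrow>
     P \<noteq> [] \<and> hd P = (0, 0) \<and> last P = (length X, length Y) \<and>
     set P \<subseteq> {0..length X} \<times> {0..length Y} \<and> successively grid_edge P"

definition path_edges :: "vertex list \<Rightarrow> (vertex \<times> vertex) list" where
  "path_edges P = zip P (tl P)"

definition alignment_cost :: "'a weight \<Rightarrow> 'a paren list \<Rightarrow> 'a paren list \<Rightarrow> vertex list \<Rightarrow> real" where
  "alignment_cost w X Y P = (\<Sum>e\<leftarrow>path_edges P. edge_cost w X Y e)"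

definition aligns :: "vertex list \<Rightarrow> nat \<Rightarrow> nat \<Rightarrow> bool" where
  "aligns P f g \<longleftrightarrow> ((f, g), (Suc f, Suc g)) \<in> set (path_edges P)"

definition forest_alignment :: "'a forest \<Rightarrow> 'a forest \<Rightarrow> vertex list \<Rightarrow> bool" where
  "forest_alignment F G P \<longleftrightarrow> alignment (euler F) (euler G) P \<and>
     (\<forall>f g. aligns P f g \<longrightarrow> aligns P (mate (euler F) f) (mate (euler G) g))"

definition ted :: "'a weight \<Rightarrow> 'a forest \<Rightarrow> 'a forest \<Rightarrow> real" where
  "ted w F G = Min (alignment_cost w (euler F) (euler G) ` {P. forest_alignment F G P})"

section \<open>The notions above are well defined\<close>

lemma finite_forest_alignments: "finite {P. forest_alignment F G P}"
proof -
  let ?V = "{0..length (euler F)} \<times> {0..length (euler G)}"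
  let ?lt = "\<lambda>u v :: vertex. fst u + snd u < fst v + snd v"
  have "distinct P" if "successively grid_edge P" for P
  proof -
    have "?lt u v" if "grid_edge u v" for u v
      using that by (cases u) auto
    then have "successively ?lt P"
      using that by (auto intro: successively_mono)
    then have "sorted_wrt ?lt P"
      by (subst (asm) successively_conv_sorted_wrt) (auto simp: transp_def)
    then show "distinct P"
      by (induction P) auto
  qed
  then have "{P. forest_alignment F G P} \<subseteq> {P. set P \<subseteq> ?V \<and> distinct P}"
    unfolding forest_alignment_def alignment_def by blast
  moreover have "finite ?V" by blast
  then have "finite {P. set P \<subseteq> ?V \<and> distinct P}"
    by (rule finite_subset_distinct)
  ultimately show ?thesis
    by (rule finite_subset)
qed

lemma forest_alignment_exists: "\<exists>P. forest_alignment F G P"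
proof -
  let ?m = "length (euler F)" and ?n = "length (euler G)"
  let ?v = "\<lambda>i. (min i ?m, i - ?m)"
  let ?P = "map ?v [0..<Suc (?m + ?n)]"
  have nth: "?P ! i = ?v i" if "i \<le> ?m + ?n" for i
    using that by (simp del: upt_Suc)
  have edge: "grid_edge (?v i) (?v (Suc i))" for i
    by (cases "i < ?m") (simp_all add: min_def Suc_diff_le)
  have "successively grid_edge ?P"
    unfolding successively_conv_nth
  proof (intro allI impI)
    fix i assume "Suc i < length ?P"
    then have "Suc i \<le> ?m + ?n" by (simp del: upt_Suc)
    then show "grid_edge (?P ! i) (?P ! Suc i)"
      using edge[of i] nth[of i] nth[of "Suc i"] by (simp del: upt_Suc)
  qed
  moreover have "hd ?P = (0, 0)"
    by (simp add: hd_map del: upt_Suc)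
  moreover have "last ?P = (?m, ?n)" "?P \<noteq> []"
    by (simp_all add: last_map)
  moreover have "set ?P \<subseteq> {0..?m} \<times> {0..?n}"
    by auto
  ultimately have "alignment (euler F) (euler G) ?P"
    unfolding alignment_def by blast
  moreover have "\<not> aligns ?P f g" for f g
  proof
    assume "aligns ?P f g"
    then obtain i where i: "i < length (tl ?P)" "?P ! i = (f, g)" "tl ?P ! i = (Suc f, Suc g)"
      unfolding aligns_def path_edges_def in_set_zip by auto
    have "i < ?m + ?n" using i(1) by (simp del: upt_Suc)
    moreover have "?P ! Suc i = (Suc f, Suc g)" using i(1,3) by (simp add: nth_tl del: upt_Suc)
    ultimately have "?v i = (f, g)" "?v (Suc i) = (Suc f, Suc g)"
      using i(2) nth[of i] nth[of "Suc i"] by (simp_all del: upt_Suc)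
    then show False by (cases "i < ?m") simp_all
  qed
  ultimately show ?thesis
    unfolding forest_alignment_def by blast
qed

lemma balanced_append: "balanced X \<Longrightarrow> balanced Y \<Longrightarrow> balanced (X @ Y)"
  by (induction X rule: balanced.induct) (auto intro: balanced.intros)

lemma balanced_concat: "(\<And>X. X \<in> set Xs \<Longrightarrow> balanced X) \<Longrightarrow> balanced (concat Xs)"
  by (induction Xs) (auto intro: balanced.empty balanced_append)

lemma balanced_euler: "balanced (euler F)"
proof -
  have "balanced (euler_tree T)" for T :: "'a tree"
  proof (induction T)
    case (Node a Ts)
    then have "balanced (concat (map euler_tree Ts))"
      by (intro balanced_concat) auto
    from balanced.node[OF this balanced.empty] show ?case by simp
  qed
  then show ?thesis
    unfolding euler_def by (intro balanced_concat) auto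
qed

definition height :: "'a paren list \<Rightarrow> int" where
  "height X = (\<Sum>p\<leftarrow>X. if is_open p then 1 else - 1)"

lemma height_simps [simp]:
  "height [] = 0" "height (p # X) = (if is_open p then 1 else - 1) + height X"
  "height (X @ Y) = height X + height Y"
  by (auto simp: height_def)

lemma balanced_height: "balanced X \<Longrightarrow> height X = 0 \<and> (\<forall>n. 0 \<le> height (take n X))"
proof (induction rule: balanced.induct)
  case (node X Y a)
  have *: "0 \<le> 1 + height (take m X) + height (take (m - length X) (Close a # Y))" for m
    using node.IH by (cases "m - length X") (auto simp: add.assoc[symmetric])
  have "0 \<le> height (take n (Open a # X @ Close a # Y))" for n
    using * by (cases n) (auto simp: add.assoc)
  then show ?case using node.IH by simp
qed simp

lemma matched_unique_right:
  assumes "matched X i j" "matched X i j'"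
  shows "j = j'"
proof -
  have False if "matched X i j" "matched X i j'" "j < j'" for j j'
  proof -
    let ?Z = "drop (Suc i) X" and ?d = "j - Suc i"
    have b: "balanced (take ?d ?Z)" "balanced (take (j' - Suc i) ?Z)" and l: "i < j" "j' < length X"
      and c: "\<not> is_open (X ! j)"
      using that by (auto simp: matched_def)
    have d: "?d < length ?Z" "?Z ! ?d = X ! j"
      using l that(3) by simp_all
    have "take (Suc ?d) ?Z = take ?d ?Z @ [X ! j]"
      using take_Suc_conv_app_nth[OF d(1)] d(2) by simp
    then have "height (take (Suc ?d) ?Z) = - 1"
      using balanced_height[OF b(1)] c by simp
    moreover have "take (Suc ?d) (take (j' - Suc i) ?Z) = take (Suc ?d) ?Z"
      unfolding take_take using l that(3) by (simp add: min_def)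
    moreover have "0 \<le> height (take (Suc ?d) (take (j' - Suc i) ?Z))"
      using balanced_height[OF b(2)] by blast
    ultimately show False by simp
  qed
  then show ?thesis using assms by (metis nat_neq_iff)
qed

lemma matched_unique_left:
  assumes "matched X i j" "matched X i' j"
  shows "i = i'"
proof -
  have False if "matched X i j" "matched X i' j" "i < i'" for i i'
  proof -
    let ?Z = "take (j - Suc i) (drop (Suc i) X)" and ?d = "i' - Suc i"
    have b: "balanced ?Z" "balanced (take (j - Suc i') (drop (Suc i') X))"
      and l: "i' < j" "j < length X" and c: "is_open (X ! i')"
      using that by (auto simp: matched_def)
    have d: "?d < length ?Z" "?Z ! ?d = X ! i'"
      using l that(3) by simp_all
    have "drop (Suc ?d) ?Z = take (j - Suc i') (drop (Suc i') X)"
      using l that(3) by (simp add: drop_take)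
    then have "?Z = take ?d ?Z @ X ! i' # take (j - Suc i') (drop (Suc i') X)"
      using id_take_nth_drop[OF d(1)] unfolding d(2) by (rule subst)
    then have "height ?Z = height (take ?d ?Z @ X ! i' # take (j - Suc i') (drop (Suc i') X))"
      by (rule arg_cong)
    also have "\<dots> = height (take ?d ?Z) + 1"
      unfolding height_simps using c balanced_height[OF b(2)] by simp
    finally have "height ?Z = height (take ?d ?Z) + 1" .
    moreover have "height ?Z = 0" "0 \<le> height (take ?d ?Z)"
      using balanced_height[OF b(1)] by blast+
    ultimately show False by linarith
  qed
  then show ?thesis using assms by (metis nat_neq_iff)
qed

lemma matched_exists:
  "balanced X \<Longrightarrow> i < length X \<Longrightarrow> \<exists>j. matched X i j \<or> matched X j i"
proof (induction arbitrary: i rule: balanced.induct)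
  case (node X Y a)
  let ?Z = "Open a # X @ Close a # Y" and ?m = "Suc (Suc (length X))"
  have out: "matched ?Z 0 (Suc (length X))"
    using node.hyps by (simp add: matched_def nth_append)
  have left: "matched ?Z (Suc j) (Suc j')" if "matched X j j'" for j j'
    using that by (auto simp: matched_def nth_append)
  have right: "matched ?Z (?m + j) (?m + j')" if "matched Y j j'" for j j'
    using that by (simp add: matched_def nth_append)
  have "i = 0 \<or> i = Suc (length X) \<or> (\<exists>i'. i = Suc i' \<and> i' < length X) \<or>
        (\<exists>i'. i = ?m + i' \<and> i' < length Y)"
  proof (cases "?m \<le> i")
    case True
    then obtain i' where "i = ?m + i'" using le_Suc_ex by blast
    then show ?thesis using node.prems by simp
  next
    case False
    then show ?thesis by (cases i) auto
  qed
  then consider "i = 0" | "i = Suc (length X)" | i' where "i = Suc i'" "i' < length X"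
    | i' where "i = ?m + i'" "i' < length Y"
    by blast
  then show ?case
  proof cases
    case 3
    then show ?thesis using node.IH(1) left by blast
  next
    case 4
    then show ?thesis using node.IH(2) right by blast
  qed (use out in blast)+
qed simp

lemma ex1_mate:
  assumes "i < length (euler F)"
  shows "\<exists>!j. matched (euler F) i j \<or> matched (euler F) j i"
proof -
  have "\<not> (matched X i j \<and> matched X j' i)" for X :: "'a paren list" and j j'
    by (auto simp: matched_def)
  then show ?thesis
    using matched_exists[OF balanced_euler assms] matched_unique_left matched_unique_right by metis
qed

section \<open>Model of computation\<close>

text \<open>
  Structured programs for a word RAM that additionally handles weights as exact reals.
  Memory consists of word arrays and real arrays; a program mentions only finitely many of them.
  Words are \<open>W\<close>-bit numbers. Reals are obtained from the weight oracle or from rational constants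
  of the program text; they can only be added, subtracted, scaled by a rational constant and
  compared, and there is no conversion between reals and words. Letters are words.
\<close>

datatype binop = Add | Sub | Mul | Div | Mod | BitAnd | BitOr | BitXor | Shl | Shr

datatype word_exp =
    Const nat
  | Word nat word_exp
  | WordOp binop word_exp word_exp

datatype real_exp =
    RConst rat
  | Real nat word_exp
  | RAdd real_exp real_exp
  | RSub real_exp real_exp
  | RScale rat real_exp
  | Oracle "word_exp option" "word_exp option"

datatype test =
    Eq word_exp word_exp
  | Less word_exp word_exp
  | RLess real_exp real_exp
  | Neg test
  | Both test test

datatype com =
    Skip
  | SetWord nat word_exp word_exp
  | SetReal nat word_exp real_exp
  | Seq com com
  | Cond test com com
  | While test com

record state =
  words :: "nat \<Rightarrow> nat \<Rightarrow> nat"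
  reals :: "nat \<Rightarrow> nat \<Rightarrow> real"

fun word_op :: "nat \<Rightarrow> binop \<Rightarrow> nat \<Rightarrow> nat \<Rightarrow> nat" where
  "word_op W Add a b = take_bit W (a + b)"
| "word_op W Sub a b = take_bit W (a + (2 ^ W - b))"
| "word_op W Mul a b = take_bit W (a * b)"
| "word_op W Div a b = a div b"
| "word_op W Mod a b = a mod b"
| "word_op W BitAnd a b = Bit_Operations.and a b"
| "word_op W BitOr a b = Bit_Operations.or a b"
| "word_op W BitXor a b = Bit_Operations.xor a b"
| "word_op W Shl a b = take_bit W (push_bit b a)"
| "word_op W Shr a b = drop_bit b a"

primrec word_val :: "nat \<Rightarrow> state \<Rightarrow> word_exp \<Rightarrow> nat" where
  "word_val W s (Const c) = take_bit W c"
| "word_val W s (Word A i) = words s A (word_val W s i)"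
| "word_val W s (WordOp f x y) = word_op W f (word_val W s x) (word_val W s y)"

primrec real_val :: "nat \<Rightarrow> nat weight \<Rightarrow> state \<Rightarrow> real_exp \<Rightarrow> real" where
  "real_val W w s (RConst c) = of_rat c"
| "real_val W w s (Real A i) = reals s A (word_val W s i)"
| "real_val W w s (RAdd x y) = real_val W w s x + real_val W w s y"
| "real_val W w s (RSub x y) = real_val W w s x - real_val W w s y"
| "real_val W w s (RScale c x) = of_rat c * real_val W w s x"
| "real_val W w s (Oracle a b) = w (map_option (word_val W s) a) (map_option (word_val W s) b)"

primrec test_val :: "nat \<Rightarrow> nat weight \<Rightarrow> state \<Rightarrow> test \<Rightarrow> bool" where
  "test_val W w s (Eq x y) \<longleftrightarrow> word_val W s x = word_val W s y"
| "test_val W w s (Less x y) \<longleftrightarrow> word_val W s x < word_val W s y"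
| "test_val W w s (RLess x y) \<longleftrightarrow> real_val W w s x < real_val W w s y"
| "test_val W w s (Neg b) \<longleftrightarrow> \<not> test_val W w s b"
| "test_val W w s (Both b c) \<longleftrightarrow> test_val W w s b \<and> test_val W w s c"

definition set_word :: "nat \<Rightarrow> nat \<Rightarrow> nat \<Rightarrow> state \<Rightarrow> state" where
  "set_word A i v s = s\<lparr>words := (words s)(A := (words s A)(i := v))\<rparr>"

definition set_real :: "nat \<Rightarrow> nat \<Rightarrow> real \<Rightarrow> state \<Rightarrow> state" where
  "set_real A i v s = s\<lparr>reals := (reals s)(A := (reals s A)(i := v))\<rparr>"

text \<open>
  \<open>exec W w c s t s'\<close>: started in \<open>s\<close>, the program \<open>c\<close> terminates in \<open>s'\<close> after \<open>t\<close> steps. Every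
  assignment and every evaluation of a test is one step. The sizes of the expressions occurring in
  a program are bounded by the program text, so charging for each operation and oracle call
  separately would change \<open>t\<close> by at most a constant factor depending on the program only.
\<close>

inductive exec :: "nat \<Rightarrow> nat weight \<Rightarrow> com \<Rightarrow> state \<Rightarrow> nat \<Rightarrow> state \<Rightarrow> bool"
  for W :: nat and w :: "nat weight" where
  Skip: "exec W w Skip s 1 s"
| SetWord: "exec W w (SetWord A i x) s 1 (set_word A (word_val W s i) (word_val W s x) s)"
| SetReal: "exec W w (SetReal A i x) s 1 (set_real A (word_val W s i) (real_val W w s x) s)"
| Seq: "exec W w c s t s' \<Longrightarrow> exec W w d s' u s'' \<Longrightarrow> exec W w (Seq c d) s (t + u) s''"
| CondTrue: "test_val W w s b \<Longrightarrow> exec W w c s t s' \<Longrightarrow> exec W w (Cond b c d) s (Suc t) s'"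
| CondFalse: "\<not> test_val W w s b \<Longrightarrow> exec W w d s t s' \<Longrightarrow> exec W w (Cond b c d) s (Suc t) s'"
| WhileTrue: "test_val W w s b \<Longrightarrow> exec W w c s t s' \<Longrightarrow> exec W w (While b c) s' u s'' \<Longrightarrow>
    exec W w (While b c) s (Suc (t + u)) s''"
| WhileFalse: "\<not> test_val W w s b \<Longrightarrow> exec W w (While b c) s 1 s"

lemma exec_deterministic:
  "exec W w c s t s' \<Longrightarrow> exec W w c s u s'' \<Longrightarrow> t = u \<and> s' = s''"
proof (induction arbitrary: u s'' rule: exec.induct)
  case (Skip s)
  then show ?case by (cases rule: exec.cases) simp_all
next
  case (SetWord A i x s)
  then show ?case by (cases rule: exec.cases) simp_all
next
  case (SetReal A i x s)
  then show ?case by (cases rule: exec.cases) simp_all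
next
  case (Seq c s t s' d v r)
  from Seq.prems show ?case
    by (cases rule: exec.cases) (use Seq.IH in blast)
next
  case (CondTrue s b c t s' d)
  from CondTrue.prems show ?case
    by (cases rule: exec.cases) (use CondTrue.hyps CondTrue.IH in blast)+
next
  case (CondFalse s b d t s' c)
  from CondFalse.prems show ?case
    by (cases rule: exec.cases) (use CondFalse.hyps CondFalse.IH in blast)+
next
  case (WhileTrue s b c t s' v r)
  from WhileTrue.prems show ?case
    by (cases rule: exec.cases) (use WhileTrue.hyps WhileTrue.IH in blast)+
next
  case (WhileFalse s b c)
  from WhileFalse.prems show ?case
    by (cases rule: exec.cases) (use WhileFalse.hyps in simp_all)
qed

text \<open>
  Input: the lengths of the two Euler tours are in \<open>words 0\<close>; the tour of \<open>F\<close> is in \<open>words 1\<close>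
  (1 for opening, 0 for closing parentheses) and \<open>words 2\<close> (labels), that of \<open>G\<close> is in \<open>words 3\<close>
  and \<open>words 4\<close>. All other cells are 0. Output: cell 0 of \<open>reals 0\<close>.
\<close>

definition array_of :: "nat list \<Rightarrow> nat \<Rightarrow> nat" where
  "array_of xs i = (if i < length xs then xs ! i else 0)"

definition input_state :: "nat forest \<Rightarrow> nat forest \<Rightarrow> state" where
  "input_state F G =
     (let X = euler F; Y = euler G;
          arrays = [[length X, length Y],
                    map (of_bool \<circ> is_open) X, map lab X,
                    map (of_bool \<circ> is_open) Y, map lab Y]
      in \<lparr>words = (\<lambda>A. if A < length arrays then array_of (arrays ! A) else (\<lambda>_. 0)),
          reals = (\<lambda>_ _. 0)\<rparr>)"

definition result :: "state \<Rightarrow> real" where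
  "result s = reals s 0 0"

end

theory Submission
  imports Defs
begin

text \<open>
  The algorithm is Klein's dynamic program restricted to a band. A subproblem pairs an interval of the
  Euler tour of \<open>F\<close> with one of \<open>G\<close>; an optimal alignment of cost at most \<open>K\<close> visits only vertices
  \<open>(x, y)\<close> with \<open>\<bar>x - y\<bar> \<le> 2 * K\<close>, so every interval of \<open>F\<close> has \<open>O(K\<^sup>2)\<close> relevant partners.
  An interval of \<open>F\<close> is shrunk at the end where the smaller tree sits. Matching that tree leads to its inner
  interval, which starts a new chain of intervals unless it occurs in the present one. As the
  tree is at most half as large as the interval, a position lies in \<open>O(log n)\<close> chains and there are
  \<open>O(n log n)\<close> intervals. Every table entry is the cost of an actual alignment or at least the cost of deleting
  \<open>F\<close> and inserting \<open>G\<close>, hence never too small; it is at most the cost of every alignment inside the band. Doubling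
  \<open>K\<close> until the computed value is at most \<open>K\<close>, or the band contains everything, costs
  a geometric sum dominated by its last term. Equal forests are detected beforehand in linear time; otherwise the
  distance is at least \<open>1 / 2\<close>, which lets \<open>n * k\<^sup>2 * ln n\<close> absorb the preprocessing.
\<close>

text \<open>Costs are charged per parenthesis, half a node cost at each, so an interval may cut
  through trees: a parenthesis whose mate lies outside can only be deleted or inserted. Shrinking by
  one position is thus always a legal step. Besides it, the recurrence asks for the inner interval
  of the peeled tree and for the interval behind that tree. The latter starts no chain: while the
  chain crosses the smaller tree it keeps shrinking at the same end, as every subtree met there is
  smaller still. Only an interval that is a single tree escapes this argument and has a separate
  candidate.

  The order of evaluation shapes the list. Tables are filled from the last interval to the first, so
  an inner interval must be listed after each interval that uses it. Chain starts are tried by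
  increasing position, and peeling a node erases its recorded index, which forces a later listing.

  The factor 2 in the band comes from edges that leave a diagonal: each costs at least 1/2.
  Requiring both corners of a subproblem to lie in the band gives the quadratic number of partners.
  Values are shown attainable over the whole grid but minimal only inside the band; the two bounds
  meet once the budget reaches the distance.\<close>

section \<open>Matching of parentheses as a non-crossing involution\<close>

lemma mate_eqI:
  assumes "matched X i j"
  shows "mate X i = j" "mate X j = i"
proof -
  have n: "\<not> (matched X a b \<and> matched X c a)" for a b c
    by (auto simp: matched_def)
  show "mate X i = j"
    unfolding mate_def
    by (rule the_equality) (use assms n matched_unique_right in blast)+
  show "mate X j = i"
    unfolding mate_def
    by (rule the_equality) (use assms n matched_unique_left in blast)+
qed

lemma matched_mate:
  assumes "balanced X" "i < length X"
  shows "matched X i (mate X i) \<or> matched X (mate X i) i"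
  using matched_exists[OF assms] mate_eqI by metis

text \<open>The string strictly between \<open>i\<close> and \<open>j\<close> is balanced, so
  \<open>k\<close> has a partner inside it; that match lifts to \<open>X\<close>, and mates are
  unique.\<close>

lemma matched_inside:
  assumes m: "matched X i j" and k: "i < k" "k < j"
  shows "i < mate X k \<and> mate X k < j"
proof -
  let ?Z = "take (j - Suc i) (drop (Suc i) X)"
  have b: "balanced ?Z" and l: "i < j" "j < length X"
    using m by (auto simp: matched_def)
  have lift: "matched X (Suc i + a) (Suc i + b)" if "matched ?Z a b" for a b
  proof -
    have ab: "a < b" "b < j - Suc i"
      using that l by (auto simp: matched_def)
    have "take (b - Suc a) (drop (Suc a) ?Z) = take (b - Suc a) (drop (Suc i + Suc a) X)"
      using ab by (simp add: drop_take add.commute min_def)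
    then show ?thesis
      using that ab l by (auto simp: matched_def)
  qed
  have kz: "k - Suc i < length ?Z" using k l by simp
  have kk: "Suc i + (k - Suc i) = k" using k by simp
  obtain c where c: "matched ?Z (k - Suc i) c \<or> matched ?Z c (k - Suc i)"
    using matched_exists[OF b kz] by blast
  then have "mate X k = Suc i + c"
    using lift mate_eqI kk by metis
  moreover have "c < j - Suc i"
    using c kz by (auto simp: matched_def)
  ultimately show ?thesis by simp
qed

text \<open>What remains of a matching once labels and directions are forgotten: an involution
  without fixed points whose arcs do not cross. It is used for both tours, and again to verify the
  program that computes the mates.\<close>

locale mates =
  fixes N :: nat and mt :: "nat \<Rightarrow> nat"
  assumes mt_less: "i < N \<Longrightarrow> mt i < N"
    and mt_mt: "i < N \<Longrightarrow> mt (mt i) = i"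
    and mt_neq: "i < N \<Longrightarrow> mt i \<noteq> i"
    and nest: "i < k \<Longrightarrow> k < mt i \<Longrightarrow> i < N \<Longrightarrow> i < mt k \<and> mt k < mt i"

lemma mates_mate:
  assumes X: "balanced X"
  shows "mates (length X) (mate X)"
proof
  fix i assume i: "i < length X"
  note m = matched_mate[OF X i]
  show "mate X i < length X" using m i by (auto simp: matched_def)
  show "mate X (mate X i) = i" using m mate_eqI by blast
  show "mate X i \<noteq> i" using m by (auto simp: matched_def)
  fix k assume "i < k" "k < mate X i"
  then show "i < mate X k \<and> mate X k < mate X i"
    using m matched_inside[of X i "mate X i" k] matched_def[of X "mate X i" i] by linarith
qed

lemma lab_mate:
  assumes "balanced X" "i < length X"
  shows "lab (X ! mate X i) = lab (X ! i)"
  using matched_mate[OF assms] by (auto simp: matched_def)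

lemma is_open_iff_mate:
  assumes "balanced X" "i < length X"
  shows "is_open (X ! i) \<longleftrightarrow> i < mate X i"
  using matched_mate[OF assms] by (auto simp: matched_def)

section \<open>Closed paths\<close>

lemma path_edges_simps [simp]:
  "path_edges [] = []" "path_edges [u] = []"
  "path_edges (u # v # Q) = (u, v) # path_edges (v # Q)"
  by (simp_all add: path_edges_def)

lemma path_edges_append:
  "P \<noteq> [] \<Longrightarrow> Q \<noteq> [] \<Longrightarrow>
   path_edges (P @ Q) = path_edges P @ (last P, hd Q) # path_edges Q"
proof (induction P)
  case (Cons u P)
  then show ?case by (cases P; cases Q) auto
qed simp

lemma path_edges_Cons:
  "Q \<noteq> [] \<Longrightarrow> path_edges (u # Q) = (u, hd Q) # path_edges Q"
  by (cases Q) auto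

lemma path_mono:
  assumes "successively grid_edge Q" "z \<in> set Q"
  shows "fst (hd Q) \<le> fst z \<and> snd (hd Q) \<le> snd z \<and> fst z \<le> fst (last Q) \<and> snd z \<le> snd (last Q)"
  using assms
proof (induction Q arbitrary: z)
  case (Cons u Q)
  show ?case
  proof (cases Q)
    case Nil
    then show ?thesis using Cons.prems by simp
  next
    case (Cons v Q')
    then have e: "grid_edge u v" "successively grid_edge Q"
      using Cons.prems by auto
    have uv: "fst u \<le> fst v" "snd u \<le> snd v"
      using e(1) by (cases u; auto)+
    have Q: "fst v \<le> fst z \<and> snd v \<le> snd z \<and> fst z \<le> fst (last Q) \<and> snd z \<le> snd (last Q)"
      if "z \<in> set Q" for z
      using Cons.IH[OF e(2) that] Cons by simp
    have "v \<in> set Q" "last (u # Q) = last Q" using Cons by auto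
    then show ?thesis
      using uv Q[of z] Q[of v] Cons.prems(2) by (auto intro: order.trans)
  qed
qed simp

lemma aligns_bounds:
  assumes "successively grid_edge Q" "aligns Q f g"
  shows "fst (hd Q) \<le> f \<and> snd (hd Q) \<le> g \<and> f < fst (last Q) \<and> g < snd (last Q)"
proof -
  have "(f, g) \<in> set Q" "(Suc f, Suc g) \<in> set Q"
    using assms(2) unfolding aligns_def path_edges_def
    by (auto dest: set_zip_leftD, metis list.sel(2) list.set_sel(2) set_zip_rightD)
  from path_mono[OF assms(1) this(1)] path_mono[OF assms(1) this(2)] show ?thesis by auto
qed

lemma aligns_append:
  assumes "P \<noteq> []" "Q \<noteq> []"
  shows "aligns (P @ Q) f g \<longleftrightarrow>
    aligns P f g \<or> aligns Q f g \<or> last P = (f, g) \<and> hd Q = (Suc f, Suc g)"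
  unfolding aligns_def path_edges_append[OF assms] by auto

lemma aligns_split:
  assumes "aligns Q f g"
  obtains P R where "Q = P @ R" "P \<noteq> []" "R \<noteq> []" "last P = (f, g)" "hd R = (Suc f, Suc g)"
proof -
  from assms obtain i where i: "i < length (tl Q)" "Q ! i = (f, g)" "tl Q ! i = (Suc f, Suc g)"
    unfolding aligns_def path_edges_def in_set_zip by auto
  have "Q = take (Suc i) Q @ drop (Suc i) Q" by simp
  moreover have "last (take (Suc i) Q) = (f, g)"
    using i by (subst take_Suc_conv_app_nth) auto
  moreover have "hd (drop (Suc i) Q) = (Suc f, Suc g)"
    using i by (simp add: hd_drop_conv_nth nth_tl)
  ultimately show thesis
    using i(1) by (intro that) auto
qed

text \<open>The end points are free, so the notion applies to any rectangle of the grid. A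
  parenthesis whose mate lies outside the rectangle cannot be aligned in it, which is what gives
  meaning to intervals that cut trees.\<close>

definition closed_path :: "'a paren list \<Rightarrow> 'a paren list \<Rightarrow> vertex list \<Rightarrow> bool" where
  "closed_path X Y Q \<longleftrightarrow> Q \<noteq> [] \<and> successively grid_edge Q \<and>
     (\<forall>f g. aligns Q f g \<longrightarrow> aligns Q (mate X f) (mate Y g))"

text \<open>The region \<open>B\<close> is the whole grid when a value is shown to be attained, and
  a band when it is shown to be small enough.\<close>

definition seg :: "'a weight \<Rightarrow> 'a paren list \<Rightarrow> 'a paren list \<Rightarrow> (vertex \<Rightarrow> bool) \<Rightarrow>
    vertex \<Rightarrow> vertex \<Rightarrow> real \<Rightarrow> bool" where
  "seg w X Y B u v c \<longleftrightarrow> (\<exists>Q. closed_path X Y Q \<and> hd Q = u \<and> last Q = v \<and>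
     (\<forall>z\<in>set Q. B z) \<and> alignment_cost w X Y Q = c)"

lemma cost_simps [simp]:
  "alignment_cost w X Y [u] = 0"
  "alignment_cost w X Y (u # v # Q) = edge_cost w X Y (u, v) + alignment_cost w X Y (v # Q)"
  by (simp_all add: alignment_cost_def)

lemma cost_append:
  assumes "P \<noteq> []" "Q \<noteq> []"
  shows "alignment_cost w X Y (P @ Q) =
    alignment_cost w X Y P + edge_cost w X Y (last P, hd Q) + alignment_cost w X Y Q"
  by (simp add: alignment_cost_def path_edges_append[OF assms])

lemma cost_Cons:
  "Q \<noteq> [] \<Longrightarrow> alignment_cost w X Y (u # Q) =
    edge_cost w X Y (u, hd Q) + alignment_cost w X Y Q"
  by (simp add: alignment_cost_def path_edges_Cons)

context
  fixes w :: "'a weight" and X Y :: "'a paren list"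
  assumes X: "balanced X" and Y: "balanced Y"
begin

interpretation FX: mates "length X" "mate X" by (rule mates_mate[OF X])
interpretation GY: mates "length Y" "mate Y" by (rule mates_mate[OF Y])

lemma seg_refl: "B u \<Longrightarrow> seg w X Y B u u 0"
  unfolding seg_def closed_path_def
  by (intro exI[of _ "[u]"]) (auto simp: aligns_def)

lemma aligns_Cons: "Q \<noteq> [] \<Longrightarrow>
  aligns (u # Q) f g \<longleftrightarrow> u = (f, g) \<and> hd Q = (Suc f, Suc g) \<or> aligns Q f g"
  by (auto simp: aligns_def path_edges_Cons)

text \<open>The connecting edge is not diagonal, so no aligned pair is added and closure of the two
  parts carries over.\<close>

lemma seg_join:
  assumes "seg w X Y B u v c" "seg w X Y B v' z d" "grid_edge v v'" "fst v = fst v' \<or> snd v = snd v'"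
  shows "seg w X Y B u z (c + edge_cost w X Y (v, v') + d)"
proof -
  obtain P Q where P: "closed_path X Y P" "hd P = u" "last P = v" "\<forall>x\<in>set P. B x"
      "alignment_cost w X Y P = c"
    and Q: "closed_path X Y Q" "hd Q = v'" "last Q = z" "\<forall>x\<in>set Q. B x"
      "alignment_cost w X Y Q = d"
    using assms(1,2) unfolding seg_def by blast
  have n: "P \<noteq> []" "Q \<noteq> []" using P Q by (auto simp: closed_path_def)
  have "closed_path X Y (P @ Q)"
    using P Q assms(3,4) n by (auto simp: closed_path_def aligns_append successively_append_iff)
  then show ?thesis
    unfolding seg_def using P Q n
    by (intro exI[of _ "P @ Q"]) (auto simp: cost_append)
qed

text \<open>A closed path is wrapped in the two diagonal edges of a matched pair. Mates share their
  label and each edge pays half, whence the full \<open>w\<close>.\<close>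

lemma seg_Pair:
  assumes "seg w X Y B (Suc f, Suc g) (mate X f, mate Y g) c"
    and "B (f, g)" "B (Suc (mate X f), Suc (mate Y g))" "f < length X" "g < length Y"
    and "f < mate X f" "g < mate Y g"
  shows "seg w X Y B (f, g) (Suc (mate X f), Suc (mate Y g))
    (c + w (Some (lab (X ! f))) (Some (lab (Y ! g))))"
proof -
  let ?m = "(mate X f, mate Y g)" and ?e = "(Suc (mate X f), Suc (mate Y g))"
  obtain P where P: "closed_path X Y P" "hd P = (Suc f, Suc g)" "last P = ?m" "\<forall>x\<in>set P. B x"
      "alignment_cost w X Y P = c"
    using assms(1) unfolding seg_def by blast
  have n: "P \<noteq> []" using P by (auto simp: closed_path_def)
  let ?Q = "(f, g) # P @ [?e]"
  have al: "aligns ?Q a b \<longleftrightarrow> (a, b) = (f, g) \<or> aligns P a b \<or> (a, b) = ?m" for a b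
    using n P by (auto simp: aligns_def path_edges_Cons path_edges_append)
  have "closed_path X Y ?Q"
    unfolding closed_path_def
  proof (intro conjI allI impI)
    show "successively grid_edge ?Q"
      using P n by (simp add: closed_path_def successively_append_iff successively_Cons hd_append)
    fix a b assume "aligns ?Q a b"
    then show "aligns ?Q (mate X a) (mate Y b)"
      unfolding al using P(1) FX.mt_mt GY.mt_mt assms(4,5) by (auto simp: closed_path_def)
  qed simp
  moreover have "alignment_cost w X Y ?Q = c + w (Some (lab (X ! f))) (Some (lab (Y ! g)))"
    using n P lab_mate[OF X] lab_mate[OF Y] assms(4,5)
    by (simp add: cost_Cons cost_append paren_weight_def hd_append)
  ultimately show ?thesis
    unfolding seg_def using n P assms(2,3) by (intro exI[of _ ?Q]) auto
qed

lemma seg_join_direct: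
  assumes "seg w X Y B u v c" "seg w X Y B v z d"
  shows "seg w X Y B u z (c + d)"
proof -
  obtain P Q where P: "closed_path X Y P" "hd P = u" "last P = v" "\<forall>x\<in>set P. B x"
      "alignment_cost w X Y P = c"
    and Q: "closed_path X Y Q" "hd Q = v" "last Q = z" "\<forall>x\<in>set Q. B x"
      "alignment_cost w X Y Q = d"
    using assms unfolding seg_def by blast
  then obtain Q' where Q': "Q = v # Q'" by (cases Q) (auto simp: closed_path_def)
  show ?thesis
  proof (cases "Q' = []")
    case True
    then show ?thesis using assms(1) Q Q' by simp
  next
    case False
    have n: "P \<noteq> []" using P by (auto simp: closed_path_def)
    have e: "path_edges (P @ Q') = path_edges P @ path_edges Q"
      using path_edges_append[OF n False] path_edges_Cons[OF False] Q' P(3) by simp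
    have "closed_path X Y (P @ Q')"
      using P Q Q' n False
      by (auto simp: closed_path_def aligns_def e successively_append_iff successively_Cons)
    moreover have "alignment_cost w X Y (P @ Q') = c + d"
      using e P Q by (simp add: alignment_cost_def)
    ultimately show ?thesis
      unfolding seg_def using P Q Q' n False by (intro exI[of _ "P @ Q'"]) auto
  qed
qed

text \<open>\<open>R\<close> runs from just after the pair of opening parentheses to just before the
  pair of their mates. Nesting in \<open>X\<close> alone keeps the pairs of \<open>R\<close> among
  themselves: the mate of an inner position is inner, and its first coordinate places the aligned
  mates in \<open>R\<close>. Monotonicity of the path then yields the order in
  \<open>Y\<close>.\<close>

lemma closed_path_split:
  assumes Q: "closed_path X Y Q" and fg: "aligns Q f g" "f < mate X f"
    and len: "fst (last Q) \<le> length X" "snd (last Q) \<le> length Y"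
  obtains P R S where "Q = P @ R @ S" "P \<noteq> []" "R \<noteq> []" "S \<noteq> []"
    "last P = (f, g)" "hd R = (Suc f, Suc g)" "last R = (mate X f, mate Y g)"
    "hd S = (Suc (mate X f), Suc (mate Y g))" "closed_path X Y R"
    "g < mate Y g"
    "\<And>a b. aligns P a b \<or> aligns S a b \<Longrightarrow>
       aligns P (mate X a) (mate Y b) \<or> aligns S (mate X a) (mate Y b)"
proof -
  let ?f = "mate X f" and ?g = "mate Y g"
  have sQ: "successively grid_edge Q" and cl: "\<And>a b. aligns Q a b \<Longrightarrow> aligns Q (mate X a) (mate Y b)"
    using Q by (auto simp: closed_path_def)
  have lt: "a < length X \<and> b < length Y" if "aligns Q a b" for a b
    using aligns_bounds[OF sQ that] len by auto
  obtain P T where PT: "Q = P @ T" "P \<noteq> []" "T \<noteq> []" "last P = (f, g)" "hd T = (Suc f, Suc g)"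
    using aligns_split[OF fg(1)] .
  have sP: "successively grid_edge P" and sT: "successively grid_edge T"
    using sQ PT by (auto simp: successively_append_iff)
  have "\<not> aligns P ?f ?g"
    using aligns_bounds[OF sP, of ?f ?g] PT fg(2) by auto
  then have "aligns T ?f ?g"
    using cl[OF fg(1)] fg(2) PT unfolding PT(1) aligns_append[OF PT(2,3)] by auto
  then obtain R S where RS: "T = R @ S" "R \<noteq> []" "S \<noteq> []" "last R = (?f, ?g)"
      "hd S = (Suc ?f, Suc ?g)"
    using aligns_split by blast
  have sR: "successively grid_edge R" and sS: "successively grid_edge S"
    using sT RS by (auto simp: successively_append_iff)
  have hR: "hd R = (Suc f, Suc g)" using PT RS by simp
  have g: "g < ?g"
    using path_mono[OF sR last_in_set[OF RS(2)]] hR RS(4) by auto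
  have al: "aligns Q a b \<longleftrightarrow> aligns P a b \<or> (a, b) = (f, g) \<or> aligns R a b \<or> (a, b) = (?f, ?g) \<or>
      aligns S a b" for a b
    using PT RS hR by (auto simp: aligns_append)
  have bP: "a < f" if "aligns P a b" for a b using aligns_bounds[OF sP that] PT by simp
  have bR: "f < a \<and> a < ?f" if "aligns R a b" for a b using aligns_bounds[OF sR that] RS hR by simp
  have bS: "?f < a" if "aligns S a b" for a b using aligns_bounds[OF sS that] RS by simp
  have f: "f < length X" using lt[OF fg(1)] by simp
  have "closed_path X Y R"
    unfolding closed_path_def
  proof (intro conjI allI impI)
    fix a b assume R: "aligns R a b"
    then have "f < mate X a \<and> mate X a < ?f"
      using FX.nest[of f a] bR f by blast
    then show "aligns R (mate X a) (mate Y b)"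
      using cl[of a b] R al bP bS by (metis Pair_inject nat_neq_iff order_less_asym)
  qed (use sR RS in auto)
  moreover have "aligns P (mate X a) (mate Y b) \<or> aligns S (mate X a) (mate Y b)"
    if A: "aligns P a b \<or> aligns S a b" for a b
  proof -
    have Q: "aligns Q a b" using A al by blast
    have a: "a < f \<or> ?f < a" using A bP bS by blast
    have "mate X a \<noteq> f" "mate X a \<noteq> ?f"
      using a FX.mt_mt f fg(2) lt[OF Q] by (metis nat_neq_iff order_less_asym)+
    moreover have "\<not> aligns R (mate X a) (mate Y b)"
    proof
      assume "aligns R (mate X a) (mate Y b)"
      then have "f < mate X (mate X a)" "mate X (mate X a) < ?f"
        using FX.nest[of f "mate X a"] bR f by blast+
      then show False using a FX.mt_mt lt[OF Q] by auto
    qed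
    ultimately show ?thesis
      using cl[OF Q] unfolding al by auto
  qed
  ultimately show thesis
    using that[of P R S] PT RS hR g by simp
qed

text \<open>Distinguishes the first edge. If it is diagonal, the mates lie to the right and
  \<open>closed_path_split\<close> applies; the prefix is then a single vertex, so the suffix is
  closed on its own.\<close>

lemma seg_cases_left:
  assumes "seg w X Y B (l, l') (r, r') c" "r \<le> length X" "r' \<le> length Y"
  obtains (empty) "l = r" "l' = r'" "c = 0"
  | (del) d where "l < r" "l' \<le> r'" "seg w X Y B (Suc l, l') (r, r') d"
      "c = paren_weight w (Some (X ! l)) None + d"
  | (ins) d where "l' < r'" "l \<le> r" "seg w X Y B (l, Suc l') (r, r') d"
      "c = paren_weight w None (Some (Y ! l')) + d"
  | (match) d e where "l < mate X l" "mate X l < r" "l' < mate Y l'" "mate Y l' < r'"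
      "seg w X Y B (Suc l, Suc l') (mate X l, mate Y l') d"
      "seg w X Y B (Suc (mate X l), Suc (mate Y l')) (r, r') e"
      "c = w (Some (lab (X ! l))) (Some (lab (Y ! l'))) + d + e"
proof -
  obtain Q where Q: "closed_path X Y Q" "hd Q = (l, l')" "last Q = (r, r')" "\<forall>z\<in>set Q. B z"
      "alignment_cost w X Y Q = c"
    using assms(1) unfolding seg_def by blast
  then obtain Q' where Q': "Q = (l, l') # Q'" by (cases Q) (auto simp: closed_path_def)
  have sQ: "successively grid_edge Q" and cl: "\<And>a b. aligns Q a b \<Longrightarrow> aligns Q (mate X a) (mate Y b)"
    using Q by (auto simp: closed_path_def)
  show thesis
  proof (cases "Q' = []")
    case True
    then show thesis using empty Q Q' by simp
  next
    case False
    have sQ': "successively grid_edge Q'" and e: "grid_edge (l, l') (hd Q')"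
      using sQ False unfolding Q' by (simp_all add: successively_Cons)
    have le: "fst (hd Q') \<le> r" "snd (hd Q') \<le> r'"
      using path_mono[OF sQ', of "hd Q'"] False Q(3) Q' by auto
    have al: "aligns Q a b \<longleftrightarrow> aligns Q' a b" if "hd Q' \<noteq> (Suc l, Suc l')" for a b
      using that False by (auto simp: Q' aligns_Cons)
    have sg: "seg w X Y B (hd Q') (r, r') (alignment_cost w X Y Q')" if "hd Q' \<noteq> (Suc l, Suc l')"
      unfolding seg_def using Q Q' False sQ' al[OF that]
      by (intro exI[of _ Q']) (auto simp: closed_path_def)
    have c: "c = edge_cost w X Y ((l, l'), hd Q') + alignment_cost w X Y Q'"
      unfolding Q' Q(5)[symmetric] by (rule cost_Cons[OF False])
    from e consider "hd Q' = (Suc l, l')" | "hd Q' = (l, Suc l')" | "hd Q' = (Suc l, Suc l')"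
      by auto
    then show thesis
    proof cases
      case 1
      then show thesis using del[of "alignment_cost w X Y Q'"] c sg le by simp
    next
      case 2
      then show thesis using ins[of "alignment_cost w X Y Q'"] c sg le by simp
    next
      case 3
      then have A: "aligns Q l l'" using False Q' by (auto simp: aligns_Cons)
      have l: "l < length X" "l' < length Y" using 3 le assms(2,3) by auto
      have "aligns Q (mate X l) (mate Y l')" by (rule cl[OF A])
      then have "l \<le> mate X l" using aligns_bounds[OF sQ] Q(2) by force
      then have lm: "l < mate X l" using FX.mt_neq[OF l(1)] by simp
      obtain P R S where P: "Q = P @ R @ S" "P \<noteq> []" "R \<noteq> []" "S \<noteq> []"
          "last P = (l, l')" "hd R = (Suc l, Suc l')" "last R = (mate X l, mate Y l')"
          "hd S = (Suc (mate X l), Suc (mate Y l'))" "closed_path X Y R" "l' < mate Y l'"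
          "\<And>a b. aligns P a b \<or> aligns S a b \<Longrightarrow>
             aligns P (mate X a) (mate Y b) \<or> aligns S (mate X a) (mate Y b)"
        using closed_path_split[OF Q(1) A lm] Q(3) assms(2,3) by auto
      have sP: "successively grid_edge P" and sS: "successively grid_edge S"
        using sQ P(1) by (auto simp: successively_append_iff)
      have nP: "\<not> aligns P a b" for a b
        using aligns_bounds[OF sP, of a b] P(1,2,5) Q(2) by auto
      have lS: "last S = (r, r')" using P Q(3) by simp
      have S: "closed_path X Y S"
        using P(4) P(11) nP sS by (auto simp: closed_path_def)
      \<comment> \<open>Every edge increases a coordinate, so a path that returns to its start has
        no edge.\<close>
      have cP: "alignment_cost w X Y P = 0"
      proof (cases P)
        case (Cons u P')
        moreover have "P' = []"
        proof (rule ccontr)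
          assume n: "P' \<noteq> []"
          then have "grid_edge u (hd P')" "successively grid_edge P'" "u = (l, l')" "last P' = (l, l')"
            using sP P(1,5) Q(2) Cons by (auto simp: successively_Cons)
          then show False
            using path_mono[of P' "hd P'"] n by auto
        qed
        ultimately show ?thesis by simp
      qed (use P in simp)
      have "mate X l < r" "mate Y l' < r'"
        using path_mono[OF sS hd_in_set[OF P(4)]] P(8) lS by auto
      moreover have "seg w X Y B (Suc l, Suc l') (mate X l, mate Y l') (alignment_cost w X Y R)"
        unfolding seg_def using P Q(4) by (intro exI[of _ R]) auto
      moreover have "seg w X Y B (Suc (mate X l), Suc (mate Y l')) (r, r') (alignment_cost w X Y S)"
        unfolding seg_def using P Q(4) S lS by (intro exI[of _ S]) auto
      moreover have "c = w (Some (lab (X ! l))) (Some (lab (Y ! l'))) + alignment_cost w X Y R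
          + alignment_cost w X Y S"
        using P cP lab_mate[OF X] lab_mate[OF Y] l
        by (simp add: Q(5)[symmetric] cost_append paren_weight_def)
      ultimately show thesis
        using match[OF lm _ P(10)] by blast
    qed
  qed
qed

text \<open>The mirror image, by the last edge: now the suffix after the matched tree is a single
  vertex and the prefix is closed on its own.\<close>

lemma seg_cases_right:
  assumes "seg w X Y B (l, l') (Suc r, r') c" "Suc r \<le> length X" "r' \<le> length Y"
  obtains (empty) "l = Suc r"
  | (del) d where "l \<le> r" "l' \<le> r'" "seg w X Y B (l, l') (r, r') d"
      "c = paren_weight w (Some (X ! r)) None + d"
  | (ins) d s' where "r' = Suc s'" "l' \<le> s'" "seg w X Y B (l, l') (Suc r, s') d"
      "c = paren_weight w None (Some (Y ! s')) + d"
  | (match) d e s' where "r' = Suc s'" "mate X r < r" "l \<le> mate X r" "mate Y s' < s'" "l' \<le> mate Y s'"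
      "seg w X Y B (Suc (mate X r), Suc (mate Y s')) (r, s') d"
      "seg w X Y B (l, l') (mate X r, mate Y s') e"
      "c = w (Some (lab (X ! mate X r))) (Some (lab (Y ! mate Y s'))) + d + e"
proof -
  obtain Q where Q: "closed_path X Y Q" "hd Q = (l, l')" "last Q = (Suc r, r')" "\<forall>z\<in>set Q. B z"
      "alignment_cost w X Y Q = c"
    using assms(1) unfolding seg_def by blast
  have "Q \<noteq> []" using Q by (simp add: closed_path_def)
  then obtain Q' where Q': "Q = Q' @ [(Suc r, r')]"
    using Q(3) by (metis append_butlast_last_id)
  have sQ: "successively grid_edge Q" and cl: "\<And>a b. aligns Q a b \<Longrightarrow> aligns Q (mate X a) (mate Y b)"
    using Q by (auto simp: closed_path_def)
  show thesis
  proof (cases "Q' = []")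
    case True
    then show thesis using empty Q Q' by simp
  next
    case False
    have sQ': "successively grid_edge Q'" and e: "grid_edge (last Q') (Suc r, r')"
      using sQ False unfolding Q' by (simp_all add: successively_append_iff)
    have le: "l \<le> fst (last Q')" "l' \<le> snd (last Q')"
      using path_mono[OF sQ', of "last Q'"] False Q(2) Q' by auto
    have al': "aligns Q a b \<longleftrightarrow> aligns Q' a b \<or> last Q' = (a, b) \<and> (Suc r, r') = (Suc a, Suc b)" for a b
      using False by (auto simp: Q' aligns_def path_edges_append)
    have sg: "seg w X Y B (l, l') (last Q') (alignment_cost w X Y Q')"
      if "\<And>a. last Q' \<noteq> (r, a) \<or> r' \<noteq> Suc a"
    proof -
      have "aligns Q a b \<longleftrightarrow> aligns Q' a b" for a b
        using that al' by blast
      then show ?thesis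
        unfolding seg_def using Q Q' False sQ'
        by (intro exI[of _ Q']) (auto simp: closed_path_def)
    qed
    have c: "c = edge_cost w X Y (last Q', (Suc r, r')) + alignment_cost w X Y Q'"
      unfolding Q(5)[symmetric] by (simp add: Q' cost_append[OF False])
    obtain x y where xy: "last Q' = (x, y)" by fastforce
    from e consider "last Q' = (r, r')" | s' where "r' = Suc s'" "last Q' = (Suc r, s')"
      | s' where "r' = Suc s'" "last Q' = (r, s')"
      unfolding xy by auto
    then show thesis
    proof cases
      case 1
      then show thesis using del[of "alignment_cost w X Y Q'"] c sg le by simp
    next
      case (2 s')
      then show thesis using ins[of s' "alignment_cost w X Y Q'"] c sg le by simp
    next
      case (3 s')
      let ?f = "mate X r" and ?g = "mate Y s'"
      have A: "aligns Q r s'" using al' 3 by blast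
      have r: "r < length X" "s' < length Y" using 3 assms(2,3) by auto
      have B: "aligns Q ?f ?g" by (rule cl[OF A])
      have mm: "mate X ?f = r" "mate Y ?g = s'" using r FX.mt_mt GY.mt_mt by auto
      have "?f \<le> r" using aligns_bounds[OF sQ B] Q(3) by simp
      then have lm: "?f < mate X ?f" using FX.mt_neq[OF r(1)] mm by simp
      obtain P R S where P: "Q = P @ R @ S" "P \<noteq> []" "R \<noteq> []" "S \<noteq> []"
          "last P = (?f, ?g)" "hd R = (Suc ?f, Suc ?g)" "last R = (r, s')"
          "hd S = (Suc r, Suc s')" "closed_path X Y R" "?g < s'"
          "\<And>a b. aligns P a b \<or> aligns S a b \<Longrightarrow>
             aligns P (mate X a) (mate Y b) \<or> aligns S (mate X a) (mate Y b)"
        using closed_path_split[OF Q(1) B lm] Q(3) assms(2,3) mm by auto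
      have sP: "successively grid_edge P" and sS: "successively grid_edge S"
        using sQ P(1) by (auto simp: successively_append_iff)
      have lS: "last S = (Suc r, Suc s')" using P Q(3) 3 by simp
      have nS: "\<not> aligns S a b" for a b
        using aligns_bounds[OF sS, of a b] P(8) lS by auto
      have P': "closed_path X Y P"
        using P(2) P(11) nS sP by (auto simp: closed_path_def)
      have cS: "alignment_cost w X Y S = 0"
      proof (cases S)
        case (Cons u S')
        moreover have "S' = []"
        proof (rule ccontr)
          assume n: "S' \<noteq> []"
          then have "grid_edge u (hd S')" "successively grid_edge S'" "u = (Suc r, Suc s')"
              "last S' = (Suc r, Suc s')"
            using sS P(8) lS Cons by (auto simp: successively_Cons)
          then show False
            using path_mono[of S' "hd S'"] n by auto
        qed
        ultimately show ?thesis by simp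
      qed (use P in simp)
      have h: "hd P = (l, l')" using P Q(2) by simp
      have "l \<le> ?f" "l' \<le> ?g"
        using path_mono[OF sP last_in_set[OF P(2)]] P(5) h by auto
      moreover have "seg w X Y B (Suc ?f, Suc ?g) (r, s') (alignment_cost w X Y R)"
        unfolding seg_def using P Q(4) by (intro exI[of _ R]) auto
      moreover have "seg w X Y B (l, l') (?f, ?g) (alignment_cost w X Y P)"
        unfolding seg_def using P Q(4) P' h by (intro exI[of _ P]) auto
      moreover have "c = w (Some (lab (X ! ?f))) (Some (lab (Y ! ?g))) + alignment_cost w X Y R
          + alignment_cost w X Y P"
        using P cS lab_mate[OF X, of r] lab_mate[OF Y, of s'] r
        by (simp add: Q(5)[symmetric] cost_append paren_weight_def)
      ultimately show thesis
        using match[OF 3(1) _ _ P(10)] lm mm by simp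
    qed
  qed
qed

end

section \<open>Bounded-time execution\<close>

text \<open>Execution is deterministic, so exhibiting one run expresses total correctness together
  with a time bound.\<close>

definition runs :: "nat \<Rightarrow> nat weight \<Rightarrow> com \<Rightarrow> nat \<Rightarrow> (state \<Rightarrow> bool) \<Rightarrow> state \<Rightarrow> bool" where
  "runs W w c T Q s \<longleftrightarrow> (\<exists>t s'. exec W w c s t s' \<and> t \<le> T \<and> Q s')"

lemma runs_mono: "runs W w c T Q s \<Longrightarrow> T \<le> T' \<Longrightarrow> (\<And>s'. Q s' \<Longrightarrow> Q' s') \<Longrightarrow> runs W w c T' Q' s"
  unfolding runs_def by (meson order_trans)

lemma runs_Seq:
  assumes "runs W w c T (\<lambda>s'. runs W w d U Q s') s"
  shows "runs W w (Seq c d) (T + U) Q s"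
  using assms unfolding runs_def by (meson add_mono exec.Seq)

lemma runs_Cond:
  assumes "test_val W w s b \<Longrightarrow> runs W w c T Q s" "\<not> test_val W w s b \<Longrightarrow> runs W w d T Q s"
  shows "runs W w (Cond b c d) (Suc T) Q s"
  using assms unfolding runs_def by (cases "test_val W w s b") (meson exec.intros Suc_le_mono)+

text \<open>Induction on the number of remaining rounds. The bound \<open>T i\<close> may vary with
  the round, as the geometric growth of the doubling loop requires.\<close>

lemma runs_While_count:
  assumes "I (0::nat) s"
    and "\<And>i s. i < n \<Longrightarrow> I i s \<Longrightarrow> test_val W w s b \<and> runs W w c (T i) (I (Suc i)) s"
    and "\<And>s. I n s \<Longrightarrow> \<not> test_val W w s b"
  shows "runs W w (While b c) ((\<Sum>i<n. Suc (T i)) + 1) (I n) s"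
proof -
  have "runs W w (While b c) ((\<Sum>i=n-m..<n. Suc (T i)) + 1) (I n) s" if "m \<le> n" "I (n - m) s" for m s
    using that
  proof (induction m arbitrary: s)
    case 0
    then show ?case
      using exec.WhileFalse[of W w s b c] assms(3)[of s] unfolding runs_def
      by (intro exI[of _ 1] exI[of _ s]) simp
  next
    case (Suc m)
    let ?i = "n - Suc m"
    have i: "?i < n" "Suc ?i = n - m" using Suc.prems by auto
    obtain t s1 where t: "exec W w c s t s1" "t \<le> T ?i" "I (n - m) s1" "test_val W w s b"
      using assms(2)[OF i(1) Suc.prems(2)] i unfolding runs_def by auto
    obtain u s2 where u: "exec W w (While b c) s1 u s2" "u \<le> (\<Sum>i=n-m..<n. Suc (T i)) + 1" "I n s2"
      using Suc.IH[OF _ t(3)] Suc.prems unfolding runs_def by auto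
    have "(\<Sum>i=?i..<n. Suc (T i)) = Suc (T ?i) + (\<Sum>i=n-m..<n. Suc (T i))"
      using i by (simp add: sum.atLeast_Suc_lessThan)
    then show ?case
      unfolding runs_def using exec.WhileTrue[OF t(4,1) u(1)] t u
      by (intro exI[of _ "Suc (t + u)"] exI[of _ s2]) simp
  qed
  from this[of n s] show ?thesis using assms(1) by (simp add: lessThan_atLeast0)
qed

lemma runs_While_const:
  assumes "I (0::nat) s"
    and "\<And>i s. i < n \<Longrightarrow> I i s \<Longrightarrow> test_val W w s b \<and> runs W w c T (I (Suc i)) s"
    and "\<And>s. I n s \<Longrightarrow> \<not> test_val W w s b"
  shows "runs W w (While b c) (n * Suc T + 1) (I n) s"
  using runs_While_count[of I s n W w b c "\<lambda>_. T", OF assms] by simp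

section \<open>Symbolic execution of loop-free commands\<close>

fun flat :: "com \<Rightarrow> bool" where
  "flat (Seq c d) \<longleftrightarrow> flat c \<and> flat d"
| "flat (Cond b c d) \<longleftrightarrow> flat c \<and> flat d"
| "flat (While b c) \<longleftrightarrow> False"
| "flat _ \<longleftrightarrow> True"

text \<open>An evaluator that the simplifier can unfold. Its value at \<open>While\<close> is a
  dummy; \<open>run\<close> always occurs together with \<open>flat\<close>.\<close>

fun run :: "nat \<Rightarrow> nat weight \<Rightarrow> com \<Rightarrow> state \<Rightarrow> state" where
  "run W w (SetWord A i x) s = set_word A (word_val W s i) (word_val W s x) s"
| "run W w (SetReal A i x) s = set_real A (word_val W s i) (real_val W w s x) s"
| "run W w (Seq c d) s = run W w d (run W w c s)"
| "run W w (Cond b c d) s = (if test_val W w s b then run W w c s else run W w d s)"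
| "run W w _ s = s"

fun com_size :: "com \<Rightarrow> nat" where
  "com_size (Seq c d) = com_size c + com_size d"
| "com_size (Cond b c d) = Suc (com_size c + com_size d)"
| "com_size _ = 1"

lemma exec_run: "flat c \<Longrightarrow> \<exists>t\<le>com_size c. exec W w c s t (run W w c s)"
proof (induction c arbitrary: s)
  case (Seq c d)
  then show ?case by (simp, meson exec.Seq add_mono)
next
  case (Cond b c d)
  then obtain t u where "t \<le> com_size c" "exec W w c s t (run W w c s)"
    "u \<le> com_size d" "exec W w d s u (run W w d s)"
    by (metis flat.simps(2))
  then show ?case
    by (cases "test_val W w s b")
      (auto intro: exI[of _ "Suc t"] exI[of _ "Suc u"] exec.CondTrue exec.CondFalse)
qed (auto intro: exI[of _ 1] exec.intros)

lemma runs_flat: "flat c \<Longrightarrow> Q (run W w c s) \<Longrightarrow> com_size c \<le> T \<Longrightarrow> runs W w c T Q s"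
  unfolding runs_def using exec_run[of c W w s] by (meson order_trans)

lemma reals_set_word [simp]: "reals (set_word A i v s) = reals s"
  by (simp add: set_word_def)

lemma reals_set_real: "reals (set_real A i v s) B j = (if B = A \<and> j = i then v else reals s B j)"
  by (simp add: set_real_def)

lemma words_set_real [simp]: "words (set_real A i v s) = words s"
  by (simp add: set_real_def)

lemma words_set_word_other: "B \<noteq> A \<Longrightarrow> words (set_word A i v s) B = words s B"
  by (simp add: set_word_def)

lemma reals_set_real_other: "B \<noteq> A \<Longrightarrow> reals (set_real A i v s) B = reals s B"
  by (simp add: set_real_def)

lemma words_set_word_same: "words (set_word A i v s) A = (words s A)(i := v)"
  by (simp add: set_word_def)

lemma reals_set_real_same: "reals (set_real A i v s) A = (reals s A)(i := v)"
  by (simp add: set_real_def)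

lemmas state_simps = words_set_word_other reals_set_real_other words_set_word_same reals_set_real_same

section \<open>Frame conditions\<close>

primrec modw :: "com \<Rightarrow> nat set" where
  "modw Skip = {}"
| "modw (SetWord A i x) = {A}"
| "modw (SetReal A i x) = {}"
| "modw (Seq c d) = modw c \<union> modw d"
| "modw (Cond b c d) = modw c \<union> modw d"
| "modw (While b c) = modw c"

primrec modr :: "com \<Rightarrow> nat set" where
  "modr Skip = {}"
| "modr (SetWord A i x) = {}"
| "modr (SetReal A i x) = {A}"
| "modr (Seq c d) = modr c \<union> modr d"
| "modr (Cond b c d) = modr c \<union> modr d"
| "modr (While b c) = modr c"

definition same :: "nat set \<Rightarrow> nat set \<Rightarrow> state \<Rightarrow> state \<Rightarrow> bool" where
  "same Ws Rs s s' \<longleftrightarrow>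
     (\<forall>A. A \<notin> Ws \<longrightarrow> words s' A = words s A) \<and> (\<forall>A. A \<notin> Rs \<longrightarrow> reals s' A = reals s A)"

text \<open>Spares loop invariants any mention of arrays that the program text never
  assigns.\<close>

lemma exec_same: "exec W w c s t s' \<Longrightarrow> same (modw c) (modr c) s s'"
  by (induction rule: exec.induct) (auto simp: same_def set_word_def set_real_def)

lemma runs_same:
  assumes "runs W w c T Q s"
    and "\<And>s'. Q s' \<Longrightarrow> same (modw c) (modr c) s s' \<Longrightarrow> Q' s'"
  shows "runs W w c T Q' s"
  using assms exec_same unfolding runs_def by blast

lemma sameW: "same Ws Rs s s' \<Longrightarrow> A \<notin> Ws \<Longrightarrow> words s' A = words s A"
  by (simp add: same_def)

lemma sameR: "same Ws Rs s s' \<Longrightarrow> A \<notin> Rs \<Longrightarrow> reals s' A = reals s A"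
  by (simp add: same_def)

lemma word_add: "a + b < 2 ^ W \<Longrightarrow> word_op W Add a b = a + b"
  by (simp add: take_bit_nat_eq_self)

lemma word_mul: "a * b < 2 ^ W \<Longrightarrow> word_op W Mul a b = a * b"
  by (simp add: take_bit_nat_eq_self)

lemma word_sub:
  assumes "b \<le> a" "a < 2 ^ W"
  shows "word_op W Sub a b = a - b"
proof -
  have "take_bit W (a + (2 ^ W - b)) = take_bit W ((a - b) + 2 ^ W)"
    using assms by (simp add: algebra_simps)
  also have "\<dots> = a - b"
    using assms by (simp only: take_bit_eq_mod mod_add_self2) simp
  finally show ?thesis by simp
qed

section \<open>Interval chains\<close>

context mates
begin

definition inL :: "nat \<Rightarrow> nat \<Rightarrow> bool" where
  "inL l r \<longleftrightarrow> l \<le> mt l \<and> mt l < r"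

definition inR :: "nat \<Rightarrow> nat \<Rightarrow> bool" where
  "inR l r \<longleftrightarrow> l \<le> mt (r - 1) \<and> mt (r - 1) < r"

text \<open>An end parenthesis without mate in the interval is removed first and leads to no inner
  interval. A tree is peeled only when complete trees sit at both ends. Ties go left, in particular
  for an interval that is a single tree.\<close>

definition goleft :: "nat \<Rightarrow> nat \<Rightarrow> bool" where
  "goleft l r \<longleftrightarrow> inR l r \<and> (inL l r \<longrightarrow> mt l - l \<le> r - 1 - mt (r - 1))"

definition nxt :: "nat \<Rightarrow> nat \<Rightarrow> nat \<times> nat" where
  "nxt l r = (if goleft l r then (Suc l, r) else (l, r - 1))"

definition ie :: "nat \<Rightarrow> nat" where
  "ie x = (if x = 0 then N else mt (x - 1))"

text \<open>
  Node \<open>x\<close> is opened by the parenthesis at position \<open>x - 1\<close>, its inner interval is \<open>{x..<ie x}\<close>; node 0 is a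
  virtual root.
\<close>

definition node :: "nat \<Rightarrow> bool" where
  "node x \<longleftrightarrow> x = 0 \<or> x \<le> N \<and> x \<le> mt (x - 1)"

text \<open>The number of intervals on the way from the inner interval of \<open>x\<close> to an
  empty one, both included.\<close>

definition sz :: "nat \<Rightarrow> nat" where
  "sz x = Suc (ie x - x)"

text \<open>Tells that the recurrence at the interval from \<open>l\<close> to \<open>r\<close>
  refers to the inner interval of \<open>v\<close>.\<close>

definition peel :: "nat \<Rightarrow> nat \<Rightarrow> nat \<Rightarrow> bool" where
  "peel v l r \<longleftrightarrow> (if goleft l r then inL l r \<and> v = Suc l else inR l r \<and> v = Suc (mt (r - 1)))"

text \<open>An index recorded for the peeled node so far is smaller than that of a later user, hence
  of no help to the present interval. Resetting it demands a fresh listing.\<close>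

definition clear :: "(nat \<Rightarrow> nat) \<Rightarrow> nat \<Rightarrow> nat \<Rightarrow> nat \<Rightarrow> nat" where
  "clear IN l r = (if goleft l r then (if inL l r then IN(Suc l := 0) else IN)
     else if inR l r then IN(Suc (mt (r - 1)) := 0) else IN)"

text \<open>The condition recognises the inner interval of node \<open>l\<close>; the virtual root
  is excluded by \<open>0 < l\<close>.\<close>

definition mark :: "(nat \<Rightarrow> nat) \<Rightarrow> nat \<Rightarrow> nat \<Rightarrow> nat \<Rightarrow> nat \<Rightarrow> nat" where
  "mark IN q l r = (if 0 < l \<and> mt (l - 1) = r then IN(l := Suc q) else IN)"

lemma clear_eq: "clear IN l r v = (if peel v l r then 0 else IN v)"
  by (auto simp: clear_def peel_def)

lemma mark_eq: "mark IN q l r v = (if v = l \<and> 0 < l \<and> mt (l - 1) = r then Suc q else IN v)"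
  by (auto simp: mark_def)

lemma node_ie:
  assumes "node x" "x \<le> N" shows "x \<le> ie x" "ie x \<le> N"
proof -
  have "x \<le> ie x \<and> ie x \<le> N"
  proof (cases "x = 0")
    case False
    then have "mt (x - 1) < N" using assms by (intro mt_less) auto
    then show ?thesis using False assms by (simp add: node_def ie_def)
  qed (simp add: ie_def)
  then show "x \<le> ie x" "ie x \<le> N" by auto
qed

lemma ie_nested:
  assumes "node u" "node v" "u < v" "v \<le> ie u" "v \<le> N" shows "ie v < ie u"
proof (cases "u = 0")
  case True
  then show ?thesis using assms mt_less[of "v - 1"] by (auto simp: ie_def)
next
  case False
  then have "v - 1 \<noteq> mt (u - 1)"
    using assms mt_mt[of "u - 1"] by (auto simp: node_def ie_def)
  then show ?thesis
    using False assms nest[of "u - 1" "v - 1"] by (auto simp: node_def ie_def)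
qed

lemma peel_props:
  assumes "l < r" "r \<le> N" "peel v l r"
  shows "node v" "l < v" "v \<le> N" "ie v < r" "0 < v"
    "goleft l r \<Longrightarrow> v = Suc l" "\<not> goleft l r \<Longrightarrow> Suc (ie v) = r"
proof -
  have "mt l \<noteq> l" "mt (mt (r - 1)) = r - 1" "mt (r - 1) \<noteq> r - 1" "mt (r - 1) < N"
    using assms mt_mt[of "r - 1"] mt_neq[of l] mt_neq[of "r - 1"] mt_less[of "r - 1"] by auto
  then show "node v" "l < v" "v \<le> N" "ie v < r" "0 < v"
    "goleft l r \<Longrightarrow> v = Suc l" "\<not> goleft l r \<Longrightarrow> Suc (ie v) = r"
    using assms by (auto simp: peel_def node_def ie_def inL_def inR_def split: if_splits)
qed

text \<open>\<open>l\<close>, \<open>a\<close> bound the left tree and \<open>b\<close>,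
  \<open>r - 1\<close> the right one. The two are disjoint, so the smaller occupies at most half of
  the interval; the successors account for \<open>sz\<close> counting the empty interval and for one
  more unit of slack.\<close>

lemma halves:
  fixes a b l r :: nat
  assumes "l < a" "a < b" "b < r - 1"
  shows "(a - l \<le> r - 1 - b \<longrightarrow> 2 * Suc (Suc (a - Suc l)) \<le> r - l) \<and>
    (\<not> a - l \<le> r - 1 - b \<longrightarrow> 2 * Suc (Suc (r - 1 - Suc b)) \<le> r - l)"
proof -
  obtain x where x: "a = Suc (l + x)" using assms less_iff_Suc_add by blast
  obtain y where y: "b = Suc (a + y)" using assms less_iff_Suc_add by blast
  obtain z where z: "r - 1 = Suc (b + z)" using assms less_iff_Suc_add by blast
  then have "r = Suc (Suc (b + z))" by simp
  then show ?thesis using x y by simp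
qed

text \<open>If the right tree began inside the left one, nesting would force its last position
  \<open>r - 1\<close> inside the left tree as well.\<close>

lemma opposite:
  assumes "l < r" "r \<le> N" and L: "inL l r" and R: "inR l r" and "mt l \<noteq> r - 1"
  shows "l < mt l \<and> mt l < mt (r - 1) \<and> mt (r - 1) < r - 1"
proof -
  have ne: "mt (mt (r - 1)) = r - 1" "mt (r - 1) \<noteq> r - 1" "mt l \<noteq> l"
    using assms mt_mt[of "r - 1"] mt_neq[of "r - 1"] mt_neq[of l] by auto
  have "mt l < r - 1" using assms(5) L by (auto simp: inL_def)
  have "mt (r - 1) \<noteq> l" using assms(5) L ne by (auto simp: inL_def)
  then have "l < mt (r - 1)" using R by (auto simp: inR_def)
  have "mt l < mt (r - 1)"
  proof (rule ccontr)
    assume n: "\<not> mt l < mt (r - 1)"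
    have "mt l \<noteq> mt (r - 1)"
      using mt_mt[of l] ne assms by (metis \<open>mt l < r - 1\<close> \<open>l < r\<close> L inL_def less_le_trans nat_less_le)
    then have "mt (r - 1) < mt l" using n by simp
    then have "mt (mt (r - 1)) < mt l"
      using nest[of l "mt (r - 1)"] \<open>l < mt (r - 1)\<close> assms by auto
    then show False using ne \<open>mt l < r - 1\<close> by simp
  qed
  moreover have "l < mt l" "mt (r - 1) < r - 1"
    using L R ne assms by (auto simp: inL_def inR_def)
  ultimately show ?thesis by simp
qed

text \<open>
  The disjoint tree at the other end of the interval is at least as large as the peeled one, so a peeled
  node that is not the whole interval has at most half the size of the interval.
\<close>

lemma peel_half:
  assumes "l < r" "r \<le> N" "peel v l r"
  shows "Suc l = v \<and> r = Suc (ie v) \<and> goleft l r \<or> 2 * Suc (sz v) \<le> r - l"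
proof (cases "inL l r \<and> mt l = r - 1")
  case True
  then have "mt (r - 1) = l" using mt_mt[of l] assms by auto
  then show ?thesis using True assms
    by (auto simp: peel_def goleft_def inL_def inR_def ie_def)
next
  case False
  have R: "inR l r" using assms(3) by (auto simp: peel_def goleft_def split: if_splits)
  have L: "inL l r" using assms(3) R by (auto simp: peel_def goleft_def split: if_splits)
  have "l < mt l \<and> mt l < mt (r - 1) \<and> mt (r - 1) < r - 1"
    by (rule opposite) (use assms L R False in auto)
  then have
    "mt l - l \<le> r - 1 - mt (r - 1) \<longrightarrow> 2 * Suc (Suc (mt l - Suc l)) \<le> r - l"
    "\<not> mt l - l \<le> r - 1 - mt (r - 1) \<longrightarrow> 2 * Suc (Suc (r - 1 - Suc (mt (r - 1)))) \<le> r - l"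
    using halves[of l "mt l" "mt (r - 1)" r] by auto
  then show ?thesis
    using assms R L mt_mt[of "r - 1"] unfolding peel_def goleft_def sz_def ie_def
    by (cases "mt l - l \<le> r - 1 - mt (r - 1)") simp_all
qed

text \<open>A step removes one position. If this stops the tree of \<open>v\<close> from being
  wholly inside, the removed position is one of its two parentheses, and that is a peel of
  \<open>v\<close>.\<close>

lemma touch:
  assumes "l < r" "r \<le> N" "node v" "l < v" "ie v < r" "nxt l r = (l', r')"
  shows "l' < v \<and> ie v < r' \<or> peel v l r"
proof (cases "goleft l r")
  case True
  then show ?thesis
    using assms by (cases "v = Suc l") (auto simp: nxt_def peel_def inL_def ie_def node_def)
next
  case False
  have "inR l r" if "ie v = r - 1"
    using assms that mt_mt[of "v - 1"] by (auto simp: inR_def ie_def node_def)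
  moreover have "v = Suc (mt (r - 1))" if "ie v = r - 1"
    using assms that[symmetric] mt_mt[of "v - 1"] by (auto simp: ie_def node_def)
  ultimately show ?thesis
    using assms False by (auto simp: nxt_def peel_def)
qed

text \<open>While the left end crosses the left tree, the right tree stays complete, and any subtree
  now at the left end is smaller than the left tree, hence than the right one. So the interval
  behind the left tree belongs to the same chain.\<close>

lemma goleft_continues:
  assumes "l < r" "r \<le> N" "goleft l r" "inL l r" "mt l \<noteq> r - 1" "l < x" "x \<le> mt l"
  shows "x < r \<and> nxt x r = (Suc x, r)"
proof -
  have R: "inR l r" using assms(3) by (simp add: goleft_def)
  have o: "l < mt l" "mt l < mt (r - 1)" "mt (r - 1) < r - 1"
    using opposite[OF assms(1,2,4) R assms(5)] by auto
  have "mt x - x \<le> mt l - l" if "inL x r"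
  proof (cases "x = mt l")
    case True
    then show ?thesis using that o mt_mt[of l] assms by (auto simp: inL_def)
  next
    case False
    then show ?thesis using nest[of l x] assms by auto
  qed
  then show ?thesis
    using assms R o by (auto simp: nxt_def goleft_def inR_def inL_def)
qed

text \<open>Symmetric to \<open>goleft_continues\<close>; the comparison of the two trees is strict
  here because ties go left.\<close>

lemma goright_continues:
  assumes "l < r" "r \<le> N" "\<not> goleft l r" "inR l r" "mt (r - 1) < y" "y < r"
  shows "l < y \<and> nxt l y = (l, y - 1)"
proof -
  have L: "inL l r" and lt: "r - 1 - mt (r - 1) < mt l - l" using assms by (auto simp: goleft_def)
  have "mt l \<noteq> r - 1" using L lt assms mt_mt[of l] by (auto simp: inL_def)
  then have o: "l < mt l" "mt l < mt (r - 1)" "mt (r - 1) < r - 1"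
    using opposite[OF assms(1,2) L assms(4)] by auto
  have m: "mt (mt (r - 1)) = r - 1" using mt_mt[of "r - 1"] assms by simp
  have "y - 1 - mt (y - 1) < mt l - l" if "inR l y"
  proof (cases "y - 1 = mt (r - 1)")
    case True
    then show ?thesis using that m o assms by (auto simp: inR_def)
  next
    case False
    then have "mt (r - 1) < y - 1" "y - 1 < r - 1" "mt (r - 1) < N" using assms o by linarith+
    then have "mt (r - 1) < mt (y - 1)"
      using nest[of "mt (r - 1)" "y - 1"] m by simp
    then show ?thesis using lt assms by linarith
  qed
  moreover have "inL l y" using o assms by (auto simp: inL_def)
  ultimately show ?thesis
    using assms o by (auto simp: nxt_def goleft_def)
qed

text \<open>Once a single tree has lost its opening parenthesis, the closing one has no mate in the
  interval. The chain drops it next and arrives at the inner interval.\<close>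

lemma nxt_pending:
  assumes "node v" "0 < v" "v \<le> N"
  shows "nxt v (Suc (ie v)) = (v, ie v)"
proof -
  have "\<not> inR v (Suc (ie v))"
    using assms mt_mt[of "v - 1"] by (auto simp: inR_def ie_def)
  then show ?thesis by (simp add: nxt_def goleft_def)
qed

section \<open>Invariants of the interval list\<close>

definition listed :: "nat \<Rightarrow> (nat \<Rightarrow> nat) \<Rightarrow> (nat \<Rightarrow> nat) \<Rightarrow> (nat \<Rightarrow> nat) \<Rightarrow> nat \<Rightarrow> nat \<Rightarrow> bool" where
  "listed T Lf Rt IN i v \<longleftrightarrow> (\<exists>j. IN v = Suc j \<and> i < j \<and> j < T \<and> Lf j = v \<and> Rt j = ie v)"

lemma listed_mono:
  assumes "listed T Lf Rt IN i v" "T \<le> T'" "IN' v = IN v"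
    "\<And>j. j < T \<Longrightarrow> Lf' j = Lf j" "\<And>j. j < T \<Longrightarrow> Rt' j = Rt j"
  shows "listed T' Lf' Rt' IN' i v"
proof -
  obtain j where "IN v = Suc j" "i < j" "j < T" "Lf j = v" "Rt j = ie v"
    using assms(1) unfolding listed_def by blast
  then show ?thesis
    unfolding listed_def using assms(2-5) by (intro exI[of _ j]) auto
qed

lemma listedI: "IN v = Suc j \<Longrightarrow> i < j \<Longrightarrow> j < T \<Longrightarrow> Lf j = v \<Longrightarrow> Rt j = ie v \<Longrightarrow>
    listed T Lf Rt IN i v"
  unfolding listed_def by blast

definition step_ok :: "(nat \<Rightarrow> nat) \<Rightarrow> (nat \<Rightarrow> nat) \<Rightarrow> nat \<Rightarrow> bool" where
  "step_ok Lf Rt i \<longleftrightarrow> Lf i < Rt i \<longrightarrow> nxt (Lf i) (Rt i) = (Lf (Suc i), Rt (Suc i))"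

text \<open>All chains in one list. An empty interval ends a chain, so the successor condition binds
  only nonempty ones; \<open>listed\<close> makes every inner interval come after its user.\<close>

definition family :: "nat \<Rightarrow> (nat \<Rightarrow> nat) \<Rightarrow> (nat \<Rightarrow> nat) \<Rightarrow> (nat \<Rightarrow> nat) \<Rightarrow> bool" where
  "family T Lf Rt IN \<longleftrightarrow> 0 < T \<and> Lf 0 = 0 \<and> Rt 0 = N \<and>
     (\<forall>i<T. Lf i \<le> Rt i \<and> Rt i \<le> N \<and> step_ok Lf Rt i \<and> (Lf i < Rt i \<longrightarrow> Suc i < T) \<and>
       (\<forall>v. Lf i < Rt i \<longrightarrow> peel v (Lf i) (Rt i) \<longrightarrow> listed T Lf Rt IN i v))"

text \<open>\<open>TP\<close> is the set of nodes at which a chain has been started. Sizes at least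
  halve from a start to a later start nested in it, which is the source of the logarithm.\<close>

definition tops :: "nat \<Rightarrow> nat \<Rightarrow> nat set \<Rightarrow> bool" where
  "tops x T TP \<longleftrightarrow> finite TP \<and> (\<forall>u\<in>TP. u < x \<and> u \<le> N \<and> node u) \<and> T = (\<Sum>u\<in>TP. sz u) \<and>
     (\<forall>u\<in>TP. \<forall>v\<in>TP. u < v \<longrightarrow> v \<le> ie u \<longrightarrow> 2 * sz v \<le> sz u)"

definition halved :: "nat set \<Rightarrow> nat \<Rightarrow> bool" where
  "halved TP v \<longleftrightarrow> (\<forall>u\<in>TP. v \<le> ie u \<longrightarrow> 2 * sz v \<le> sz u)"

text \<open>An inner interval in demand is listed after its user, or its node has index 0 and is yet
  to be visited. A node with index 0 is small enough to become a start without violating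
  \<open>tops\<close>.\<close>

definition out_inv :: "nat \<Rightarrow> nat \<Rightarrow> nat set \<Rightarrow> (nat \<Rightarrow> nat) \<Rightarrow> (nat \<Rightarrow> nat) \<Rightarrow> (nat \<Rightarrow> nat) \<Rightarrow> bool" where
  "out_inv x T TP Lf Rt IN \<longleftrightarrow> tops x T TP \<and> (0 < x \<longrightarrow> 0 < T \<and> Lf 0 = 0 \<and> Rt 0 = N) \<and>
     (\<forall>i<T. Lf i \<le> Rt i \<and> Rt i \<le> N \<and> step_ok Lf Rt i \<and> (Lf i < Rt i \<longrightarrow> Suc i < T) \<and>
       (\<forall>v. Lf i < Rt i \<longrightarrow> peel v (Lf i) (Rt i) \<longrightarrow> IN v = 0 \<and> x \<le> v \<or> listed T Lf Rt IN i v)) \<and>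
     (\<forall>v\<ge>x. node v \<longrightarrow> v \<le> N \<longrightarrow> IN v = 0 \<longrightarrow> halved TP v) \<and> (x = 0 \<longrightarrow> (\<forall>v. IN v = 0))"

text \<open>The last conjunct lists the fates of a node under \<open>x\<close> with index 0: still
  strictly inside the current interval, at most half as large as \<open>x\<close>, or pending.
  Pending means that the current interval is its tree without the opening parenthesis, so that the
  next step lists its inner interval.\<close>

definition chain_inv :: "nat \<Rightarrow> nat \<Rightarrow> nat set \<Rightarrow> nat \<Rightarrow> (nat \<Rightarrow> nat) \<Rightarrow> (nat \<Rightarrow> nat) \<Rightarrow> (nat \<Rightarrow> nat) \<Rightarrow> bool" where
  "chain_inv x T TP q Lf Rt IN \<longleftrightarrow> node x \<and> x \<le> N \<and> tops x T TP \<and> halved TP x \<and> T \<le> q \<and>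
     Lf 0 = 0 \<and> Rt 0 = N \<and>
     x \<le> Lf q \<and> Lf q \<le> Rt q \<and> Rt q \<le> ie x \<and> q + (Rt q - Lf q) = T + (ie x - x) \<and>
     (\<forall>i<q. Lf i \<le> Rt i \<and> Rt i \<le> N \<and> step_ok Lf Rt i \<and>
       (\<forall>v. Lf i < Rt i \<longrightarrow> peel v (Lf i) (Rt i) \<longrightarrow> IN v = 0 \<and> x < v \<or> listed (Suc q) Lf Rt IN i v)) \<and>
     (\<forall>v>x. node v \<longrightarrow> v \<le> N \<longrightarrow> IN v = 0 \<longrightarrow>
        (if v \<le> ie x then Lf q < v \<and> ie v < Rt q \<or> 2 * sz v \<le> sz x \<or> Lf q = v \<and> Rt q = Suc (ie v)
         else halved TP v))"

lemma out_invD: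
  assumes "out_inv x T TP Lf Rt IN"
  shows "tops x T TP" "0 < x \<Longrightarrow> 0 < T \<and> Lf 0 = 0 \<and> Rt 0 = N"
    "i < T \<Longrightarrow> Lf i \<le> Rt i" "i < T \<Longrightarrow> Rt i \<le> N" "i < T \<Longrightarrow> step_ok Lf Rt i"
    "i < T \<Longrightarrow> Lf i < Rt i \<Longrightarrow> Suc i < T"
    "i < T \<Longrightarrow> Lf i < Rt i \<Longrightarrow> peel v (Lf i) (Rt i) \<Longrightarrow> IN v = 0 \<and> x \<le> v \<or> listed T Lf Rt IN i v"
    "x \<le> v \<Longrightarrow> node v \<Longrightarrow> v \<le> N \<Longrightarrow> IN v = 0 \<Longrightarrow> halved TP v" "x = 0 \<Longrightarrow> IN v = 0"
  using assms unfolding out_inv_def by metis+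

lemma chain_invD:
  assumes "chain_inv x T TP q Lf Rt IN"
  shows "node x" "x \<le> N" "tops x T TP" "halved TP x" "T \<le> q" "Lf 0 = 0" "Rt 0 = N"
    "x \<le> Lf q" "Lf q \<le> Rt q" "Rt q \<le> ie x" "q + (Rt q - Lf q) = T + (ie x - x)"
    "i < q \<Longrightarrow> Lf i \<le> Rt i" "i < q \<Longrightarrow> Rt i \<le> N" "i < q \<Longrightarrow> step_ok Lf Rt i"
    "i < q \<Longrightarrow> Lf i < Rt i \<Longrightarrow> peel v (Lf i) (Rt i) \<Longrightarrow>
       IN v = 0 \<and> x < v \<or> listed (Suc q) Lf Rt IN i v"
    "x < v \<Longrightarrow> node v \<Longrightarrow> v \<le> N \<Longrightarrow> IN v = 0 \<Longrightarrow> v \<le> ie x \<Longrightarrow>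
       Lf q < v \<and> ie v < Rt q \<or> 2 * sz v \<le> sz x \<or> Lf q = v \<and> Rt q = Suc (ie v)"
    "x < v \<Longrightarrow> node v \<Longrightarrow> v \<le> N \<Longrightarrow> IN v = 0 \<Longrightarrow> \<not> v \<le> ie x \<Longrightarrow> halved TP v"
  using assms unfolding chain_inv_def by metis+

lemma out_inv_init: "out_inv 0 0 {} Lf Rt (\<lambda>_. 0)"
  by (auto simp: out_inv_def tops_def halved_def)

lemma out_inv_skip:
  assumes I: "out_inv x T TP Lf Rt IN" and x: "\<not> node x \<or> IN x \<noteq> 0" "x \<le> N"
  shows "out_inv (Suc x) T TP Lf Rt IN"
proof -
  have x0: "x \<noteq> 0" using out_invD(9)[OF I, of x] x by (cases "x = 0") (auto simp: node_def)
  have up: "Suc x \<le> v" if "i < T" "Lf i < Rt i" "peel v (Lf i) (Rt i)" "IN v = 0" "x \<le> v" for i v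
  proof -
    have "node v" using that peel_props(1) out_invD(4)[OF I] by blast
    then show ?thesis using that x by (cases "v = x") auto
  qed
  have row: "IN v = 0 \<and> Suc x \<le> v \<or> listed T Lf Rt IN i v"
    if "i < T" "Lf i < Rt i" "peel v (Lf i) (Rt i)" for i v
    using up[OF that] out_invD(7)[OF I that] by (elim disjE conjE) simp_all
  show ?thesis
    unfolding out_inv_def
  proof (intro conjI allI impI)
    show "tops (Suc x) T TP" using out_invD(1)[OF I] by (auto simp: tops_def)
  qed (use x0 row out_invD[OF I] in simp_all)
qed

lemma chain_inv_start:
  assumes I: "out_inv x T TP Lf Rt IN" and x: "node x" "IN x = 0" "x \<le> N"
  shows "chain_inv x T TP T (Lf(T := x)) (Rt(T := ie x)) (mark IN T x (ie x))"
proof -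
  let ?L = "Lf(T := x)" and ?R = "Rt(T := ie x)" and ?I = "mark IN T x (ie x)"
  have so: "step_ok ?L ?R i" if "i < T" for i
    using out_invD(5,6)[OF I that] that by (auto simp: step_ok_def)
  have li: "?I v = 0 \<and> x < v \<or> listed (Suc T) ?L ?R ?I i v"
    if i: "i < T" "Lf i < Rt i" "peel v (Lf i) (Rt i)" for i v
  proof (cases "v = x")
    case True
    have "0 < v" using i out_invD(4)[OF I] peel_props(5) by blast
    then have "listed (Suc T) ?L ?R ?I i v"
      using True i(1) by (intro listedI[where j = T]) (simp_all add: mark_eq ie_def)
    then show ?thesis ..
  next
    case False
    have eq: "?I v = IN v" using False by (simp add: mark_eq)
    have "IN v = 0 \<and> x \<le> v \<or> listed T Lf Rt IN i v" by (rule out_invD(7)[OF I i])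
    then show ?thesis
    proof
      assume "listed T Lf Rt IN i v"
      then have "listed (Suc T) ?L ?R ?I i v"
        by (rule listed_mono) (use eq in simp_all)
      then show ?thesis ..
    qed (use eq False in simp)
  qed
  have z: "?L 0 = 0 \<and> ?R 0 = N"
  proof (cases "x = 0")
    case True
    then have "T = 0" using out_invD(1)[OF I] by (auto simp: tops_def)
    then show ?thesis using True by (simp add: ie_def)
  next
    case False
    then show ?thesis using out_invD(2)[OF I] by auto
  qed
  show ?thesis
    unfolding chain_inv_def
  proof (intro conjI allI impI)
    fix i assume i: "i < T"
    then show "?L i \<le> ?R i" "?R i \<le> N" using out_invD(3,4)[OF I] by auto
    show "step_ok ?L ?R i" by (rule so[OF i])
    fix v assume "?L i < ?R i" "peel v (?L i) (?R i)"
    then show "?I v = 0 \<and> x < v \<or> listed (Suc T) ?L ?R ?I i v" using li i by simp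
  next
    fix v assume v: "x < v" "node v" "v \<le> N" "?I v = 0"
    then show "if v \<le> ie x then ?L T < v \<and> ie v < ?R T \<or> 2 * sz v \<le> sz x \<or> ?L T = v \<and> ?R T = Suc (ie v)
        else halved TP v"
      using ie_nested[OF x(1) v(2)] out_invD(8)[OF I _ v(2,3)] by (auto simp: mark_eq)
  qed (use x z node_ie[OF x(1,3)] out_invD(1)[OF I] out_invD(8)[OF I _ x(1,3,2)] in auto)
qed

text \<open>Resetting the index of the peeled node does no harm: by \<open>peel_half\<close> the
  node is small or becomes pending, and a pending node is marked by this step. By
  \<open>touch\<close> any other strictly inner node remains strictly inside.\<close>

lemma chain_inv_step:
  assumes I: "chain_inv x T TP q Lf Rt IN" and lt: "Lf q < Rt q" and n: "nxt (Lf q) (Rt q) = (l, r)"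
  shows "chain_inv x T TP (Suc q) (Lf(Suc q := l)) (Rt(Suc q := r))
    (mark (clear IN (Lf q) (Rt q)) (Suc q) l r)"
proof -
  let ?L = "Lf(Suc q := l)" and ?R = "Rt(Suc q := r)"
  let ?J = "clear IN (Lf q) (Rt q)" let ?I = "mark ?J (Suc q) l r"
  note x = chain_invD(1,2)[OF I]
  have b: "x \<le> Lf q" "Rt q \<le> ie x" "Rt q \<le> N"
    using chain_invD(8,10)[OF I] node_ie[OF x] by auto
  have lr: "l = Suc (Lf q) \<and> r = Rt q \<or> l = Lf q \<and> Suc r = Rt q"
    using n lt by (auto simp: nxt_def split: if_splits)
  have so: "step_ok ?L ?R i" if "i < Suc q" for i
    using chain_invD(14)[OF I, of i] that n by (cases "i = q") (auto simp: step_ok_def)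
  have pv: "x < v" if "peel v (Lf q) (Rt q)" for v
    using peel_props(2)[OF lt b(3) that] b by simp
  have li: "?I v = 0 \<and> x < v \<or> listed (Suc (Suc q)) ?L ?R ?I i v"
    if i: "i < Suc q" "Lf i < Rt i" "peel v (Lf i) (Rt i)" for i v
  proof -
    have "IN v = 0 \<and> x < v \<or> listed (Suc q) Lf Rt IN i v \<or> peel v (Lf q) (Rt q)"
      using chain_invD(15)[OF I _ i(2,3)] i by (cases "i = q") auto
    \<comment> \<open>The new interval is the inner interval of \<open>v\<close>; or
      \<open>v\<close> has index 0; or \<open>v\<close> keeps an index valid before.\<close>
    then consider "v = l" "0 < l" "mt (l - 1) = r" | "?I v = 0" "x < v"
      | "?I v = IN v" "listed (Suc q) Lf Rt IN i v"
    proof -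
      have m: "?I v = (if v = l \<and> 0 < l \<and> mt (l - 1) = r then Suc (Suc q)
          else if peel v (Lf q) (Rt q) then 0 else IN v)"
        unfolding mark_eq clear_eq ..
      consider "v = l \<and> 0 < l \<and> mt (l - 1) = r"
        | "\<not> (v = l \<and> 0 < l \<and> mt (l - 1) = r)" "peel v (Lf q) (Rt q)"
        | "\<not> (v = l \<and> 0 < l \<and> mt (l - 1) = r)" "\<not> peel v (Lf q) (Rt q)"
        by blast
      then show thesis
        by cases (use that m pv[of v] \<open>_ \<or> _ \<or> _\<close> in auto)
    qed
    then show ?thesis
    proof cases
      case 1
      then have "listed (Suc (Suc q)) ?L ?R ?I i v"
        using i(1) by (intro listedI[where j = "Suc q"]) (simp_all add: mark_eq ie_def)
      then show ?thesis ..
    next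
      case 3
      then have "listed (Suc (Suc q)) ?L ?R ?I i v"
        by (intro listed_mono[OF 3(2)]) simp_all
      then show ?thesis ..
    qed simp
  qed
  have pe: "l < v \<and> ie v < r \<or> 2 * sz v \<le> sz x \<or> l = v \<and> r = Suc (ie v)"
    if "peel v (Lf q) (Rt q)" for v
    using peel_half[OF lt b(3) that] n b by (auto simp: nxt_def sz_def)
  show ?thesis
    unfolding chain_inv_def
  proof (intro conjI allI impI)
    fix i assume i: "i < Suc q"
    then show "?L i \<le> ?R i" "?R i \<le> N"
      using chain_invD(12,13)[OF I, of i] b lt by (auto simp: less_Suc_eq)
    show "step_ok ?L ?R i" by (rule so[OF i])
    fix v assume "?L i < ?R i" "peel v (?L i) (?R i)"
    then show "?I v = 0 \<and> x < v \<or> listed (Suc (Suc q)) ?L ?R ?I i v" using li i by simp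
  next
    fix v assume v: "x < v" "node v" "v \<le> N" "?I v = 0"
    show "if v \<le> ie x then ?L (Suc q) < v \<and> ie v < ?R (Suc q) \<or> 2 * sz v \<le> sz x \<or>
        ?L (Suc q) = v \<and> ?R (Suc q) = Suc (ie v) else halved TP v"
    proof (cases "peel v (Lf q) (Rt q)")
      case True
      then have "v \<le> ie x" using peel_props[OF lt b(3) True] node_ie[OF v(2,3)] b by auto
      then show ?thesis using pe[OF True] by simp
    next
      case False
      then have 0: "IN v = 0" using v(4) by (auto simp: mark_eq clear_eq split: if_splits)
      have "Lf q < v \<and> ie v < Rt q \<or> 2 * sz v \<le> sz x" if "v \<le> ie x"
      proof -
        \<comment> \<open>A node pending before this step receives the index of the new interval,
          contrary to its index 0.\<close>
        have "\<not> (Lf q = v \<and> Rt q = Suc (ie v))"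
        proof
          assume *: "Lf q = v \<and> Rt q = Suc (ie v)"
          then have "l = v" "r = ie v" using n nxt_pending[OF v(2) _ v(3)] v(1) by auto
          then have "?I v \<noteq> 0" using v(1) by (simp add: mark_eq ie_def)
          then show False using v(4) by simp
        qed
        then show ?thesis using chain_invD(16)[OF I v(1-3) 0 that] by blast
      qed
      moreover have "halved TP v" if "\<not> v \<le> ie x"
        by (rule chain_invD(17)[OF I v(1-3) 0 that])
      ultimately show ?thesis
        using touch[OF lt b(3) v(2) _ _ n] False by auto
    qed
  qed (use x lr lt chain_invD(3-11)[OF I] in auto)
qed

text \<open>Nothing is strictly inside or pending at an empty interval, so unlisted nodes under
  \<open>x\<close> have at most half its size. Starts enclosing \<open>x\<close> are larger than
  \<open>x\<close>, so the bound passes on to them.\<close>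

lemma chain_inv_end:
  assumes I: "chain_inv x T TP q Lf Rt IN" and eq: "Lf q = Rt q"
  shows "out_inv (Suc x) (Suc q) (insert x TP) Lf Rt IN"
proof -
  have x: "node x" "x \<le> N" "x \<le> ie x" "ie x \<le> N"
    using chain_invD(1,2)[OF I] node_ie by auto
  note h = chain_invD(4)[OF I] and t = chain_invD(3)[OF I]
  have q: "Suc q = T + sz x" using chain_invD(11)[OF I] eq by (auto simp: sz_def)
  have xn: "x \<notin> TP" using t by (auto simp: tops_def)
  have "tops (Suc x) (Suc q) (insert x TP)"
    unfolding tops_def
  proof (intro conjI)
    show "\<forall>u\<in>insert x TP. \<forall>v\<in>insert x TP. u < v \<longrightarrow> v \<le> ie u \<longrightarrow> 2 * sz v \<le> sz u"
      using t h by (auto simp: tops_def halved_def)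
  qed (use t q x xn in \<open>auto simp: tops_def\<close>)
  moreover have "halved (insert x TP) v" if v: "Suc x \<le> v" "node v" "v \<le> N" "IN v = 0" for v
  proof (cases "v \<le> ie x")
    case True
    have "2 * sz v \<le> sz x"
      using chain_invD(16)[OF I _ v(2-4) True] v(1) eq node_ie[OF v(2,3)] by auto
    moreover have "sz x \<le> sz u" if "u \<in> TP" "v \<le> ie u" for u
      using h that v(1) unfolding halved_def by fastforce
    ultimately show ?thesis by (fastforce simp: halved_def)
  next
    case False
    then show ?thesis using chain_invD(17)[OF I _ v(2-4) False] v(1) by (auto simp: halved_def)
  qed
  moreover have "step_ok Lf Rt i" if "i < Suc q" for i
    using chain_invD(14)[OF I, of i] that eq by (cases "i = q") (auto simp: step_ok_def)
  moreover have "Lf i \<le> Rt i \<and> Rt i \<le> N" if "i < Suc q" for i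
    using chain_invD(9,10)[OF I] chain_invD(12,13)[OF I, of i] that x by (cases "i = q") auto
  moreover have "Suc i < Suc q" if "i < Suc q" "Lf i < Rt i" for i
    using that eq by (cases "i = q") auto
  moreover have "IN v = 0 \<and> Suc x \<le> v \<or> listed (Suc q) Lf Rt IN i v"
    if "i < Suc q" "Lf i < Rt i" "peel v (Lf i) (Rt i)" for i v
    using chain_invD(15)[OF I _ that(2,3)] that eq by (cases "i = q") auto
  ultimately show ?thesis
    using chain_invD(6,7)[OF I] unfolding out_inv_def by (intro conjI allI impI) auto
qed

text \<open>A peeled node is at most \<open>N\<close>; with all of these visited, no demand can
  still be open.\<close>

lemma out_inv_family:
  assumes "out_inv (Suc N) T TP Lf Rt IN"
  shows "family T Lf Rt IN"
proof -
  have "v \<le> N" if "i < T" "Lf i < Rt i" "peel v (Lf i) (Rt i)" for i v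
    using that peel_props(3) out_invD(4)[OF assms] by blast
  then have "listed T Lf Rt IN i v" if "i < T" "Lf i < Rt i" "peel v (Lf i) (Rt i)" for i v
    using out_invD(7)[OF assms that] that by fastforce
  then show ?thesis
    using out_invD[OF assms] unfolding family_def by (intro conjI allI impI) auto
qed

lemma familyD:
  assumes "family T Lf Rt IN"
  shows "0 < T" "Lf 0 = 0" "Rt 0 = N" "i < T \<Longrightarrow> Lf i \<le> Rt i" "i < T \<Longrightarrow> Rt i \<le> N"
    "i < T \<Longrightarrow> Lf i < Rt i \<Longrightarrow> nxt (Lf i) (Rt i) = (Lf (Suc i), Rt (Suc i))"
    "i < T \<Longrightarrow> Lf i < Rt i \<Longrightarrow> Suc i < T"
    "i < T \<Longrightarrow> Lf i < Rt i \<Longrightarrow> peel v (Lf i) (Rt i) \<Longrightarrow> listed T Lf Rt IN i v"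
  using assms unfolding family_def step_ok_def by metis+

text \<open>Locates the interval behind a peeled left tree by index arithmetic, so that the
  recurrence reaches it without a search.\<close>

lemma family_left_rest:
  assumes F: "family T Lf Rt IN" and i: "i < T" "Lf i < Rt i"
    and g: "goleft (Lf i) (Rt i)" "inL (Lf i) (Rt i)" "mt (Lf i) \<noteq> Rt i - 1"
    and k: "k \<le> Suc (mt (Lf i)) - Lf i"
  shows "i + k < T \<and> Lf (i + k) = Lf i + k \<and> Rt (i + k) = Rt i"
  using k
proof (induction k)
  case (Suc k)
  have "Lf i + k < Rt i \<and> nxt (Lf i + k) (Rt i) = (Suc (Lf i + k), Rt i)"
  proof (cases "k = 0")
    case True
    then show ?thesis using i g by (simp add: nxt_def)
  next
    case False
    then show ?thesis
      using goleft_continues[OF i(2) familyD(5)[OF F i(1)] g, of "Lf i + k"] Suc.prems by simp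
  qed
  then show ?case
    using familyD(6,7)[OF F, of "i + k"] Suc by auto
qed (use i in simp)

lemma family_right_rest:
  assumes F: "family T Lf Rt IN" and i: "i < T" "Lf i < Rt i"
    and g: "\<not> goleft (Lf i) (Rt i)" "inR (Lf i) (Rt i)"
    and k: "k \<le> Rt i - mt (Rt i - 1)"
  shows "i + k < T \<and> Lf (i + k) = Lf i \<and> Rt (i + k) = Rt i - k"
  using k
proof (induction k)
  case (Suc k)
  have "Lf i < Rt i - k \<and> nxt (Lf i) (Rt i - k) = (Lf i, Rt i - k - 1)"
  proof (cases "k = 0")
    case True
    then show ?thesis using i g by (simp add: nxt_def)
  next
    case False
    then show ?thesis
      using goright_continues[OF i(2) familyD(5)[OF F i(1)] g, of "Rt i - k"] Suc.prems i by simp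
  qed
  then show ?case
    using familyD(6,7)[OF F, of "i + k"] Suc by auto
qed (use i in simp)

section \<open>The number of listed intervals\<close>

lemma halving_chain:
  fixes s :: "nat \<Rightarrow> nat"
  assumes "finite A" "A \<noteq> {}" "\<And>u. u \<in> A \<Longrightarrow> 0 < s u"
    and "\<And>u v. u \<in> A \<Longrightarrow> v \<in> A \<Longrightarrow> u < v \<Longrightarrow> 2 * s v \<le> s u"
  shows "2 ^ (card A - 1) \<le> s (Min A)"
  using assms
proof (induction A rule: finite_psubset_induct)
  case (psubset A)
  let ?m = "Min A" and ?B = "A - {Min A}"
  have m: "?m \<in> A" using psubset by simp
  show ?case
  proof (cases "?B = {}")
    case True
    then have "A = {?m}" using m by auto
    then have "card A = 1" by (metis card_1_singleton_iff One_nat_def)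
    then show ?thesis using psubset.prems(2)[OF m] by simp
  next
    case False
    have B: "Min ?B \<in> ?B" using False psubset.hyps by (intro Min_in) auto
    then have "?m < Min ?B" using psubset.hyps
      by (metis Diff_iff Min_le insertI1 le_neq_implies_less)
    then have "2 * s (Min ?B) \<le> s ?m" using psubset.prems(3) B m by blast
    moreover have "2 ^ (card ?B - 1) \<le> s (Min ?B)"
    proof (rule psubset.IH)
      show "?B \<subset> A" using m by blast
      show "0 < s u" if "u \<in> ?B" for u using psubset.prems(2) that by blast
      show "2 * s v \<le> s u" if "u \<in> ?B" "v \<in> ?B" "u < v" for u v
        using psubset.prems(3) that by blast
    qed (rule False)
    moreover have "card A = Suc (card ?B)" using card_Suc_Diff1[OF psubset.hyps m] by simp
    moreover have "card ?B \<noteq> 0" using False psubset.hyps by simp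
    moreover obtain k where "card ?B = Suc k" using calculation(4) by (cases "card ?B") auto
    ultimately have "card A - 1 = Suc k" "2 ^ k \<le> s (Min ?B)" "2 * s (Min ?B) \<le> s ?m"
      by simp_all
    then show ?thesis by simp
  qed
qed

text \<open>Counts pairs of a start \<open>u\<close> and a position \<open>y\<close> with
  \<open>u \<le> y \<le> ie u\<close> in two ways. There are \<open>sz u\<close> of them per start.
  The starts around a fixed \<open>y\<close> are nested, halve in size and begin with at most
  \<open>N + 1\<close>, so there are at most \<open>m\<close> of them per position.\<close>

lemma tops_log:
  assumes t: "tops x T TP" and m: "N + 1 < 2 ^ m"
  shows "T \<le> (N + 1) * m"
proof -
  let ?A = "\<lambda>y. {u \<in> TP. u \<le> y \<and> y \<le> ie u}"
  have fin: "finite TP" using t by (auto simp: tops_def)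
  have nd: "node u \<and> u \<le> N \<and> u \<le> ie u \<and> ie u \<le> N" if "u \<in> TP" for u
    using t that node_ie by (auto simp: tops_def)
  have A: "card (?A y) \<le> m" for y
  proof (cases "?A y = {}")
    case False
    have "2 ^ (card (?A y) - 1) \<le> sz (Min (?A y))"
    proof (rule halving_chain)
      fix u v assume "u \<in> ?A y" "v \<in> ?A y" "u < v"
      then show "2 * sz v \<le> sz u" using t by (auto simp: tops_def)
    qed (use fin False in \<open>auto simp: sz_def\<close>)
    moreover have "Min (?A y) \<in> ?A y" using False fin by (intro Min_in) auto
    then have "Min (?A y) \<in> TP" by blast
    then have "sz (Min (?A y)) \<le> N + 1" using nd by (simp add: sz_def le_diff_conv trans_le_add1)
    ultimately have "(2::nat) ^ (card (?A y) - 1) < 2 ^ m" using m by linarith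
    then have "card (?A y) - 1 < m" by (rule power_less_imp_less_exp[rotated]) simp
    then show ?thesis by simp
  next
    case True
    then show ?thesis by (simp only: card.empty zero_le)
  qed
  have "T = (\<Sum>u\<in>TP. card {y. u \<le> y \<and> y \<le> ie u})"
  proof -
    have "card {y. u \<le> y \<and> y \<le> ie u} = sz u" if "u \<in> TP" for u
    proof -
      have "{y. u \<le> y \<and> y \<le> ie u} = {u..ie u}" by auto
      then show ?thesis using nd[OF that] by (simp add: sz_def Suc_diff_le)
    qed
    then show ?thesis using t by (simp add: tops_def)
  qed
  also have "\<dots> = (\<Sum>u\<in>TP. card {y \<in> {..N}. u \<le> y \<and> y \<le> ie u})"
    using nd by (intro sum.cong refl arg_cong[where f = card]) fastforce
  also have "\<dots> = (\<Sum>y\<le>N. card (?A y))"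
    using sum.swap_restrict[OF fin finite_atMost[of N], where g = "\<lambda>u y. 1 :: nat"
      and R = "\<lambda>u y. u \<le> y \<and> y \<le> ie u"] by simp
  also have "\<dots> \<le> (N + 1) * m"
    using sum_bounded_above[of "{..N}" "\<lambda>y. card (?A y)" m] A by simp
  finally show ?thesis .
qed

end

section \<open>The recurrence inside a band\<close>

definition band :: "nat \<Rightarrow> vertex \<Rightarrow> bool" where
  "band H z \<longleftrightarrow> fst z \<le> snd z + H \<and> snd z \<le> fst z + H"

text \<open>Under a false guard the value is arbitrary: it may come from a table address that
  belongs to no subproblem.\<close>

definition relax :: "bool \<Rightarrow> real \<Rightarrow> real \<Rightarrow> real" where
  "relax g v b = (if g \<and> v < b then v else b)"

definition relaxes :: "(bool \<times> real) list \<Rightarrow> real \<Rightarrow> real" where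
  "relaxes xs b = foldl (\<lambda>b (g, v). relax g v b) b xs"

lemma relaxes_simps [simp]:
  "relaxes [] b = b" "relaxes ((g, v) # xs) b = relaxes xs (relax g v b)"
  by (simp_all add: relaxes_def)

lemma relaxes_le_base: "relaxes xs b \<le> b"
proof (induction xs arbitrary: b)
  case (Cons x xs)
  have "relax (fst x) (snd x) b \<le> b" by (simp add: relax_def)
  then show ?case using Cons.IH[of "relax (fst x) (snd x) b"] by (cases x) simp
qed simp

lemma relaxes_le: "(g, v) \<in> set xs \<Longrightarrow> g \<Longrightarrow> relaxes xs b \<le> v"
proof (induction xs arbitrary: b)
  case (Cons x xs)
  show ?case
  proof (cases "(g, v) = x")
    case True
    then show ?thesis
      using relaxes_le_base[of xs "relax g v b"] Cons.prems(2) by (auto simp: relax_def split: if_splits)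
  qed (use Cons in \<open>cases x; auto\<close>)
qed simp

lemma relaxes_ind: "P b \<Longrightarrow> (\<And>g v. (g, v) \<in> set xs \<Longrightarrow> g \<Longrightarrow> P v) \<Longrightarrow> P (relaxes xs b)"
proof (induction xs arbitrary: b)
  case (Cons x xs)
  then show ?case by (cases x) (auto simp: relax_def)
qed simp

lemma seg_ends: "seg w X Y B u v c \<Longrightarrow> B u \<and> B v"
  unfolding seg_def closed_path_def by auto

section \<open>Segments under nonnegative weights\<close>

locale pair =
  fixes w :: "'a weight" and X Y :: "'a paren list"
  assumes X: "balanced X" and Y: "balanced Y"
    and w_nonneg: "p \<in> insert None (Some ` lab ` set X) \<Longrightarrow> q \<in> insert None (Some ` lab ` set Y) \<Longrightarrow> 0 \<le> w p q"
begin

sublocale FX: mates "length X" "mate X" by (rule mates_mate[OF X])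
sublocale GY: mates "length Y" "mate Y" by (rule mates_mate[OF Y])

abbreviation "sg \<equiv> seg w X Y"
abbreviation "ins j \<equiv> w None (Some (lab (Y ! j))) / 2"
abbreviation "del i \<equiv> w (Some (lab (X ! i))) None / 2"
abbreviation "sub i j \<equiv> w (Some (lab (X ! i))) (Some (lab (Y ! j)))"

lemma ins_nonneg: "j < length Y \<Longrightarrow> 0 \<le> ins j"
  using w_nonneg[of None "Some (lab (Y ! j))"] by simp

lemma del_nonneg: "i < length X \<Longrightarrow> 0 \<le> del i"
  using w_nonneg[of "Some (lab (X ! i))" None] by simp

lemma sub_nonneg: "i < length X \<Longrightarrow> j < length Y \<Longrightarrow> 0 \<le> sub i j"
  using w_nonneg[of "Some (lab (X ! i))" "Some (lab (Y ! j))"] by simp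

lemma edge_cost_nonneg:
  assumes "grid_edge u v" "fst v \<le> length X" "snd v \<le> length Y"
  shows "0 \<le> edge_cost w X Y (u, v)"
proof (cases u)
  case (Pair x y)
  then show ?thesis
    using assms ins_nonneg[of y] del_nonneg[of x] sub_nonneg[of x y]
    by (auto simp: paren_weight_def)
qed

lemma cost_nonneg:
  assumes "successively grid_edge Q" "Q \<noteq> []" "fst (last Q) \<le> length X" "snd (last Q) \<le> length Y"
  shows "0 \<le> alignment_cost w X Y Q"
  using assms
proof (induction Q)
  case (Cons u Q)
  show ?case
  proof (cases "Q = []")
    case False
    then have e: "grid_edge u (hd Q)" "successively grid_edge Q" "last (u # Q) = last Q"
      using Cons.prems by (auto simp: successively_Cons)
    then have "fst (hd Q) \<le> length X" "snd (hd Q) \<le> length Y"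
      using path_mono[OF e(2) hd_in_set[OF False]] Cons.prems by auto
    then show ?thesis
      using edge_cost_nonneg[OF e(1)] Cons.IH[OF e(2) False] Cons.prems e(3)
      by (simp add: cost_Cons[OF False])
  qed simp
qed simp

lemma seg_nonneg:
  "sg B u (r, r') c \<Longrightarrow> r \<le> length X \<Longrightarrow> r' \<le> length Y \<Longrightarrow> 0 \<le> c"
  using cost_nonneg unfolding seg_def closed_path_def by fastforce

lemma seg_here: "B u \<Longrightarrow> sg B u u 0"
  by (rule seg_refl[OF X Y])

lemma seg_insL:
  assumes "sg B (l, Suc l') z c" "B (l, l')"
  shows "sg B (l, l') z (c + ins l')"
  using seg_join[OF X Y seg_here[of B "(l, l')", OF assms(2)] assms(1)]
  by (simp add: paren_weight_def add.commute)

lemma seg_insR: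
  assumes "sg B z (r, r') c" "B (r, Suc r')"
  shows "sg B z (r, Suc r') (c + ins r')"
  using seg_join[OF X Y assms(1) seg_here[of B "(r, Suc r')", OF assms(2)]]
  by (simp add: paren_weight_def add.commute)

lemma seg_delL:
  assumes "sg B (Suc l, l') z c" "B (l, l')"
  shows "sg B (l, l') z (c + del l)"
  using seg_join[OF X Y seg_here[of B "(l, l')", OF assms(2)] assms(1)]
  by (simp add: paren_weight_def add.commute)

lemma seg_delR:
  assumes "sg B z (r, r') c" "B (Suc r, r')"
  shows "sg B z (Suc r, r') (c + del r)"
  using seg_join[OF X Y assms(1) seg_here[of B "(Suc r, r')", OF assms(2)]]
  by (simp add: paren_weight_def add.commute)

lemma seg_trivial:
  assumes "l \<le> length X" "l' \<le> length Y"
  shows "sg (\<lambda>_. True) (0, 0) (l, l') ((\<Sum>i<l. del i) + (\<Sum>j<l'. ins j))"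
proof -
  have "sg (\<lambda>_. True) (0, 0) (l, 0) (\<Sum>i<l. del i)"
    by (induction l) (auto intro: seg_here seg_delR)
  moreover have "sg (\<lambda>_. True) (0, 0) (l, l') (c + (\<Sum>j<l'. ins j))"
    if "sg (\<lambda>_. True) (0, 0) (l, 0) c" for c
  proof (induction l')
    case (Suc l')
    then show ?case using seg_insR[OF Suc.IH] by (simp add: add.assoc)
  qed (use that in simp)
  ultimately show ?thesis by blast
qed

text \<open>Within a column only insertions are possible, and the last one can be cut off. This
  handles what follows a matched tree when the interval of \<open>F\<close> is exactly that
  tree.\<close>

lemma seg_column:
  assumes "sg B (r, s) (r, Suc r') c" "s \<le> r'" "r \<le> length X" "Suc r' \<le> length Y"
  shows "\<exists>d. sg B (r, s) (r, r') d \<and> d + ins r' \<le> c"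
  using assms(1,2)
proof (induction "r' - s" arbitrary: s c)
  case 0
  have B: "B (r, s)" using seg_ends[OF 0(2)] by simp
  from 0 show ?case
  proof (cases rule: seg_cases_left[OF X Y 0(2) assms(3,4), case_names empty del ins match])
    case (ins d)
    have "0 \<le> d" using seg_nonneg[OF ins(3)] assms by simp
    then show ?thesis using ins 0 seg_here[of B, OF B]
      by (intro exI[of _ 0]) (simp add: paren_weight_def)
  qed auto
next
  case (Suc k)
  have B: "B (r, s)" using seg_ends[OF Suc(3)] by simp
  from Suc show ?case
  proof (cases rule: seg_cases_left[OF X Y Suc(3) assms(3,4), case_names empty del ins match])
    case (ins d)
    have k: "k = r' - Suc s" "Suc s \<le> r'" using Suc.hyps(2) by simp_all
    obtain e where "sg B (r, Suc s) (r, r') e" "e + ins r' \<le> d"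
      using Suc.hyps(1)[OF k(1) ins(3) k(2)] by blast
    then show ?thesis using ins seg_insL[where B = B, OF _ B]
      by (intro exI[of _ "e + ins s"]) (simp add: paren_weight_def)
  qed auto
qed

end

section \<open>Soundness and completeness of table values\<close>

locale cells = pair +
  fixes M0 :: real and H T :: nat and Lf Rt IN :: "nat \<Rightarrow> nat"
  assumes M0: "0 \<le> M0" and F: "FX.family T Lf Rt IN"
begin

text \<open>\<open>M0\<close> stands in for infinity: a value of at least \<open>M0\<close> remains
  so when nonnegative costs are added.\<close>

definition sound :: "nat \<Rightarrow> nat \<Rightarrow> nat \<Rightarrow> real \<Rightarrow> bool" where
  "sound i l' r' v \<longleftrightarrow> M0 \<le> v \<or> (\<exists>c\<le>v. sg (\<lambda>_. True) (Lf i, l') (Rt i, r') c)"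

definition ok :: "nat \<Rightarrow> nat \<Rightarrow> nat \<Rightarrow> real \<Rightarrow> bool" where
  "ok i l' r' v \<longleftrightarrow> sound i l' r' v \<and> (\<forall>c. sg (band H) (Lf i, l') (Rt i, r') c \<longrightarrow> v \<le> c)"

definition cell :: "nat \<Rightarrow> nat \<Rightarrow> nat \<Rightarrow> bool" where
  "cell i l' r' \<longleftrightarrow> i < T \<and> l' \<le> r' \<and> r' \<le> length Y \<and> band H (Lf i, l') \<and> band H (Rt i, r')"

text \<open>The direction of the chain is read off from whether the next left end moved. The sixth
  candidate is for an interval that is one tree: the empty interval behind it need not be in the
  chain, so the tree \<open>l'\<close> must fill the other interval, and parentheses after it are
  left to the insertion at the right end.\<close>

definition candidates :: "(nat \<Rightarrow> nat \<Rightarrow> nat \<Rightarrow> real) \<Rightarrow> nat \<Rightarrow> nat \<Rightarrow> nat \<Rightarrow> (bool \<times> real) list" where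
  "candidates V i l' r' =
    (let l = Lf i; r = Rt i; p = mate X l; q = mate X (r - 1); p' = mate Y l'; q' = mate Y (r' - 1);
         left = (l < r \<and> Lf (Suc i) \<noteq> l); right = (l < r \<and> Lf (Suc i) = l);
         inner = (left \<and> FX.inL l r \<and> l' < r' \<and> l' \<le> p' \<and> p' < r' \<and> band H (p, p'))
     in [(l = r \<and> l' = r', 0),
         (l' < r' \<and> band H (l, Suc l'), V i (Suc l') r' + ins l'),
         (l' < r' \<and> band H (r, r' - 1), V i l' (r' - 1) + ins (r' - 1)),
         (left \<and> band H (Suc l, l'), V (Suc i) l' r' + del l),
         (right \<and> band H (r - 1, r'), V (Suc i) l' r' + del (r - 1)),
         (inner \<and> p = r - 1 \<and> p' = r' - 1, V (IN (Suc l) - 1) (Suc l') p' + sub l l'),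
         (inner \<and> p \<noteq> r - 1,
          V (IN (Suc l) - 1) (Suc l') p' + V (i + (Suc p - l)) (Suc p') r' + sub l l'),
         (right \<and> FX.inR l r \<and> l' < r' \<and> l' \<le> q' \<and> q' < r' \<and> band H (q, q'),
          V (IN (Suc q) - 1) (Suc q') (r' - 1) + V (i + (r - q)) l' q' + sub q q')])"

definition value_of :: "(nat \<Rightarrow> nat \<Rightarrow> nat \<Rightarrow> real) \<Rightarrow> nat \<Rightarrow> nat \<Rightarrow> nat \<Rightarrow> real" where
  "value_of V i l' r' = relaxes (candidates V i l' r') M0"

lemma sound_nonneg:
  assumes "sound i l' r' v" "i < T" "r' \<le> length Y" shows "0 \<le> v"
  using assms seg_nonneg FX.familyD(5)[OF F, of i] M0 unfolding sound_def by fastforce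

lemma sound_add:
  assumes "sound i l' r' v" "0 \<le> d"
    and "\<And>c. sg (\<lambda>_. True) (Lf i, l') (Rt i, r') c \<Longrightarrow> sg (\<lambda>_. True) (Lf k, m') (Rt k, s') (c + d)"
  shows "sound k m' s' (v + d)"
proof (cases "M0 \<le> v")
  case False
  then obtain c where "c \<le> v" "sg (\<lambda>_. True) (Lf i, l') (Rt i, r') c"
    using assms(1) unfolding sound_def by blast
  then show ?thesis unfolding sound_def using assms(3) by (intro disjI2 exI[of _ "c + d"]) simp
qed (use assms(2) in \<open>simp add: sound_def\<close>)

lemma sound_add2:
  assumes "sound i l' r' v" "sound j m' s' u" "0 \<le> d" "0 \<le> v" "0 \<le> u"
    and "\<And>c e. sg (\<lambda>_. True) (Lf i, l') (Rt i, r') c \<Longrightarrow> sg (\<lambda>_. True) (Lf j, m') (Rt j, s') e \<Longrightarrow>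
      sg (\<lambda>_. True) (Lf k, a') (Rt k, b') (c + e + d)"
  shows "sound k a' b' (v + u + d)"
proof (cases "M0 \<le> v \<or> M0 \<le> u")
  case False
  then obtain c e where "c \<le> v" "sg (\<lambda>_. True) (Lf i, l') (Rt i, r') c"
      "e \<le> u" "sg (\<lambda>_. True) (Lf j, m') (Rt j, s') e"
    using assms(1,2) unfolding sound_def by blast
  then show ?thesis
    unfolding sound_def using assms(6) by (intro disjI2 exI[of _ "c + e + d"]) simp
qed (use assms(3-5) in \<open>auto simp: sound_def\<close>)

context
  fixes i l' r' :: nat
  assumes here: "cell i l' r'"
begin

lemma cell_index: "i < T" and cell_bounds: "l' \<le> r'" "r' \<le> length Y" and cell_band: "band H (Lf i, l')" "band H (Rt i, r')"
  using here by (auto simp: cell_def)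

lemma interval_bounds: "Lf i \<le> Rt i" "Rt i \<le> length X"
  using FX.familyD(4,5)[OF F cell_index] by auto

lemma next_left:
  assumes "Lf i < Rt i"
  shows "Lf (Suc i) \<noteq> Lf i \<longleftrightarrow> FX.goleft (Lf i) (Rt i)" "Suc i < T"
    "FX.goleft (Lf i) (Rt i) \<Longrightarrow> Lf (Suc i) = Suc (Lf i) \<and> Rt (Suc i) = Rt i"
    "\<not> FX.goleft (Lf i) (Rt i) \<Longrightarrow> Lf (Suc i) = Lf i \<and> Rt (Suc i) = Rt i - 1"
  using FX.familyD(6,7)[OF F cell_index assms] by (auto simp: FX.nxt_def split: if_splits)

lemma inner_left:
  assumes "Lf i < Rt i" "FX.goleft (Lf i) (Rt i)" "FX.inL (Lf i) (Rt i)"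
  shows "i < IN (Suc (Lf i)) - 1" "IN (Suc (Lf i)) - 1 < T"
    "Lf (IN (Suc (Lf i)) - 1) = Suc (Lf i)" "Rt (IN (Suc (Lf i)) - 1) = mate X (Lf i)"
  using FX.familyD(8)[OF F cell_index assms(1), of "Suc (Lf i)"] assms
  by (auto simp: FX.peel_def FX.listed_def FX.ie_def)

lemma inner_right:
  assumes "Lf i < Rt i" "\<not> FX.goleft (Lf i) (Rt i)" "FX.inR (Lf i) (Rt i)"
  defines "q \<equiv> mate X (Rt i - 1)"
  shows "i < IN (Suc q) - 1" "IN (Suc q) - 1 < T"
    "Lf (IN (Suc q) - 1) = Suc q" "Rt (IN (Suc q) - 1) = Rt i - 1"
  using FX.familyD(8)[OF F cell_index assms(1), of "Suc q"] assms interval_bounds FX.mt_mt[of "Rt i - 1"]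
  by (auto simp: FX.peel_def FX.listed_def FX.ie_def)

text \<open>A diagonal step stays in the band, so one test at the two mates also covers the vertex
  behind them.\<close>

lemma band_Suc [simp]: "band H (Suc x, Suc y) \<longleftrightarrow> band H (x, y)"
  by (auto simp: band_def)

lemma cell_insL: "l' < r' \<Longrightarrow> band H (Lf i, Suc l') \<Longrightarrow> cell i (Suc l') r'"
  using cell_index cell_bounds cell_band by (auto simp: cell_def)

lemma cell_insR:
  assumes "l' < r'" "band H (Rt i, r' - 1)"
  shows "cell i l' (r' - 1)"
  unfolding cell_def using assms cell_index cell_bounds cell_band by simp linarith

lemma cell_delL:
  assumes "Lf i < Rt i" "FX.goleft (Lf i) (Rt i)" "band H (Suc (Lf i), l')"
  shows "cell (Suc i) l' r'"
  using next_left[OF assms(1)] assms cell_bounds cell_band by (auto simp: cell_def)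

lemma cell_delR:
  assumes "Lf i < Rt i" "\<not> FX.goleft (Lf i) (Rt i)" "band H (Rt i - 1, r')"
  shows "cell (Suc i) l' r'"
  using next_left[OF assms(1)] assms cell_bounds cell_band by (auto simp: cell_def)

lemma cell_inner_left:
  assumes "Lf i < Rt i" "FX.goleft (Lf i) (Rt i)" "FX.inL (Lf i) (Rt i)"
    and "l' < r'" "l' \<le> mate Y l'" "mate Y l' < r'" "band H (mate X (Lf i), mate Y l')"
  shows "cell (IN (Suc (Lf i)) - 1) (Suc l') (mate Y l')"
proof -
  have "mate Y l' \<noteq> l'" using GY.mt_neq[of l'] assms cell_bounds by simp
  then show ?thesis
    using inner_left[OF assms(1-3)] assms cell_bounds cell_band by (auto simp: cell_def)
qed

lemma rest_left:
  assumes "Lf i < Rt i" "FX.goleft (Lf i) (Rt i)" "FX.inL (Lf i) (Rt i)" "mate X (Lf i) \<noteq> Rt i - 1"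
  defines "j \<equiv> i + (Suc (mate X (Lf i)) - Lf i)"
  shows "i < j" "j < T" "Lf j = Suc (mate X (Lf i))" "Rt j = Rt i"
proof -
  have "j < T \<and> Lf j = Suc (mate X (Lf i)) \<and> Rt j = Rt i"
    using FX.family_left_rest[OF F cell_index assms(1-4), of "Suc (mate X (Lf i)) - Lf i"] assms(3)
    by (auto simp: j_def FX.inL_def)
  moreover have "i < j" using assms(3) by (auto simp: j_def FX.inL_def)
  ultimately show "i < j" "j < T" "Lf j = Suc (mate X (Lf i))" "Rt j = Rt i" by auto
qed

lemma cell_rest_left:
  assumes "Lf i < Rt i" "FX.goleft (Lf i) (Rt i)" "FX.inL (Lf i) (Rt i)" "mate X (Lf i) \<noteq> Rt i - 1"
    and "mate Y l' < r'" "band H (mate X (Lf i), mate Y l')"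
  shows "cell (i + (Suc (mate X (Lf i)) - Lf i)) (Suc (mate Y l')) r'"
  using rest_left[OF assms(1-4)] assms cell_bounds cell_band by (auto simp: cell_def)

lemma cell_inner_right:
  assumes "Lf i < Rt i" "\<not> FX.goleft (Lf i) (Rt i)" "FX.inR (Lf i) (Rt i)"
  defines "q \<equiv> mate X (Rt i - 1)" and "q' \<equiv> mate Y (r' - 1)"
  assumes "l' < r'" "q' < r'" "band H (q, q')"
  shows "cell (IN (Suc q) - 1) (Suc q') (r' - 1)"
proof -
  have "q' \<noteq> r' - 1" using GY.mt_neq[of "r' - 1"] assms cell_bounds by simp
  moreover have "band H (Rt i - 1, r' - 1)"
    using cell_band assms band_Suc[of "Rt i - 1" "r' - 1"] by simp
  moreover have "Suc q' \<le> r' - 1" "r' - 1 \<le> length Y"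
    using calculation(1) assms cell_bounds by linarith+
  moreover note inner_right[OF assms(1-3), folded q_def]
  ultimately show ?thesis
    using assms cell_band by (simp add: cell_def)
qed

lemma rest_right:
  assumes "Lf i < Rt i" "\<not> FX.goleft (Lf i) (Rt i)" "FX.inR (Lf i) (Rt i)"
  defines "q \<equiv> mate X (Rt i - 1)"
  defines "j \<equiv> i + (Rt i - q)"
  shows "i < j" "j < T" "Lf j = Lf i" "Rt j = q"
proof -
  have "j < T \<and> Lf j = Lf i \<and> Rt j = q"
    using FX.family_right_rest[OF F cell_index assms(1-3), of "Rt i - q"] assms(3)
    by (auto simp: j_def q_def FX.inR_def)
  moreover have "i < j" using assms(3) by (auto simp: j_def q_def FX.inR_def)
  ultimately show "i < j" "j < T" "Lf j = Lf i" "Rt j = q" by auto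
qed

lemma cell_rest_right:
  assumes "Lf i < Rt i" "\<not> FX.goleft (Lf i) (Rt i)" "FX.inR (Lf i) (Rt i)"
    and "l' \<le> mate Y (r' - 1)" "mate Y (r' - 1) < r'" "band H (mate X (Rt i - 1), mate Y (r' - 1))"
  shows "cell (i + (Rt i - mate X (Rt i - 1))) l' (mate Y (r' - 1))"
  using rest_right[OF assms(1-3)] assms cell_bounds cell_band by (auto simp: cell_def)

context
  fixes V :: "nat \<Rightarrow> nat \<Rightarrow> nat \<Rightarrow> real"
  assumes later: "\<And>j a b. i < j \<Longrightarrow> cell j a b \<Longrightarrow> ok j a b (V j a b)"
    and narrow_left: "\<And>a. l' < a \<Longrightarrow> cell i a r' \<Longrightarrow> ok i a r' (V i a r')"
    and narrow_right: "\<And>b. b < r' \<Longrightarrow> cell i l' b \<Longrightarrow> ok i l' b (V i l' b)"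
begin

lemma ok_insL:
  assumes "l' < r'" "band H (Lf i, Suc l')"
  shows "ok i (Suc l') r' (V i (Suc l') r')"
  using narrow_left[OF _ cell_insL[OF assms]] by simp

lemma ok_insR:
  assumes "l' < r'" "band H (Rt i, r' - 1)"
  shows "ok i l' (r' - 1) (V i l' (r' - 1))"
  using narrow_right[OF _ cell_insR[OF assms]] assms by simp

lemmas ok_delL = later[OF lessI cell_delL]
lemmas ok_delR = later[OF lessI cell_delR]

lemma ok_inner_left:
  assumes "Lf i < Rt i" "FX.goleft (Lf i) (Rt i)" "FX.inL (Lf i) (Rt i)"
    and "l' < r'" "l' \<le> mate Y l'" "mate Y l' < r'" "band H (mate X (Lf i), mate Y l')"
  shows "ok (IN (Suc (Lf i)) - 1) (Suc l') (mate Y l') (V (IN (Suc (Lf i)) - 1) (Suc l') (mate Y l'))"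
  by (rule later[OF inner_left(1)[OF assms(1-3)] cell_inner_left[OF assms]])

lemma ok_rest_left:
  assumes "Lf i < Rt i" "FX.goleft (Lf i) (Rt i)" "FX.inL (Lf i) (Rt i)" "mate X (Lf i) \<noteq> Rt i - 1"
    and "mate Y l' < r'" "band H (mate X (Lf i), mate Y l')"
  defines "j \<equiv> i + (Suc (mate X (Lf i)) - Lf i)"
  shows "ok j (Suc (mate Y l')) r' (V j (Suc (mate Y l')) r')"
    "Lf j = Suc (mate X (Lf i))" "Rt j = Rt i"
  using later[OF rest_left(1)[OF assms(1-4)] cell_rest_left[OF assms(1-6)]] rest_left(3,4)[OF assms(1-4)]
  unfolding j_def by blast+

lemma ok_inner_right:
  assumes "Lf i < Rt i" "\<not> FX.goleft (Lf i) (Rt i)" "FX.inR (Lf i) (Rt i)"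
  defines "q \<equiv> mate X (Rt i - 1)" and "q' \<equiv> mate Y (r' - 1)"
  assumes "l' < r'" "q' < r'" "band H (q, q')"
  shows "ok (IN (Suc q) - 1) (Suc q') (r' - 1) (V (IN (Suc q) - 1) (Suc q') (r' - 1))"
  using later[OF inner_right(1)[OF assms(1-3)] cell_inner_right[OF assms(1-3)]] assms(6-8)
  unfolding q_def q'_def by blast

lemma ok_rest_right:
  assumes "Lf i < Rt i" "\<not> FX.goleft (Lf i) (Rt i)" "FX.inR (Lf i) (Rt i)"
  defines "q \<equiv> mate X (Rt i - 1)" and "q' \<equiv> mate Y (r' - 1)"
  assumes "l' \<le> q'" "q' < r'" "band H (q, q')"
  defines "j \<equiv> i + (Rt i - q)"
  shows "ok j l' q' (V j l' q')" "Lf j = Lf i" "Rt j = q"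
  using later[OF rest_right(1)[OF assms(1-3)] cell_rest_right[OF assms(1-3)]] assms(6-8)
    rest_right(3,4)[OF assms(1-3)]
  unfolding j_def q_def q'_def by blast+

text \<open>\<open>V\<close> is the table at the moment the cell is computed: later intervals, and
  narrower partners of the same interval, are correct. Each candidate with a true guard turns
  alignments for such cells into one for this cell at the added cost. The region is the whole grid,
  so the subsidiary alignments may leave the band.\<close>

lemma sound_value: "sound i l' r' (value_of V i l' r')"
proof -
  have s1: "sound i l' r' M0" by (simp add: sound_def)
  have s2: "sound i l' r' 0" if "Lf i = Rt i \<and> l' = r'"
    using that seg_here[of "\<lambda>_. True"] unfolding sound_def by auto
  have s3: "sound i l' r' (V i (Suc l') r' + ins l')" if a: "l' < r' \<and> band H (Lf i, Suc l')"
    by (rule sound_add[where i = i and l' = "Suc l'" and r' = r'])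
      (use a ok_insL ins_nonneg cell_bounds in \<open>auto simp: ok_def intro: seg_insL\<close>)
  have s4: "sound i l' r' (V i l' (r' - 1) + ins (r' - 1))"
    if a: "l' < r' \<and> band H (Rt i, r' - 1)"
  proof -
    show ?thesis
      by (rule sound_add[where i = i and l' = l' and r' = "r' - 1"])
        (use a ok_insR ins_nonneg[of "r' - 1"] cell_bounds seg_insR[of _ _ _ "r' - 1"] in \<open>auto simp: ok_def\<close>)
  qed
  have s5: "sound i l' r' (V (Suc i) l' r' + del (Lf i))"
    if a: "(Lf i < Rt i \<and> Lf (Suc i) \<noteq> Lf i) \<and> band H (Suc (Lf i), l')"
  proof -
    show ?thesis
      by (rule sound_add[where i = "Suc i" and l' = l' and r' = r'])
        (use a ok_delL next_left del_nonneg interval_bounds in \<open>auto simp: ok_def intro: seg_delL\<close>)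
  qed
  have s6: "sound i l' r' (V (Suc i) l' r' + del (Rt i - 1))"
    if a: "(Lf i < Rt i \<and> Lf (Suc i) = Lf i) \<and> band H (Rt i - 1, r')"
  proof -
    show ?thesis
      by (rule sound_add[where i = "Suc i" and l' = l' and r' = r'])
        (use a ok_delR next_left del_nonneg[of "Rt i - 1"] interval_bounds seg_delR[of _ _ "Rt i - 1"] in \<open>auto simp: ok_def\<close>)
  qed
  have s7: "sound i l' r' (V (IN (Suc (Lf i)) - 1) (Suc l') (mate Y l') + sub (Lf i) l')"
    if a: "((Lf i < Rt i \<and> Lf (Suc i) \<noteq> Lf i) \<and> FX.inL (Lf i) (Rt i) \<and> l' < r' \<and>
      l' \<le> mate Y l' \<and> mate Y l' < r' \<and> band H (mate X (Lf i), mate Y l')) \<and> mate X (Lf i) = Rt i - 1 \<and> mate Y l' = r' - 1"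
  proof -
    from a have g: "Lf i < Rt i" "FX.goleft (Lf i) (Rt i)" "FX.inL (Lf i) (Rt i)" using next_left by auto
    let ?j = "IN (Suc (Lf i)) - 1"
    have le: "Lf i < length X" "l' < length Y" using a interval_bounds cell_bounds by auto
    have lt: "Lf i < mate X (Lf i)" "l' < mate Y l'"
      using g(3) a FX.mt_neq[OF le(1)] GY.mt_neq[OF le(2)] by (auto simp: FX.inL_def)
    show ?thesis
    proof (rule sound_add)
      show "sound ?j (Suc l') (mate Y l') (V ?j (Suc l') (mate Y l'))"
        using ok_inner_left[OF g] a by (auto simp: ok_def)
      show "0 \<le> sub (Lf i) l'" using sub_nonneg le by simp
      fix c assume "sg (\<lambda>_. True) (Lf ?j, Suc l') (Rt ?j, mate Y l') c"
      then have "sg (\<lambda>_. True) (Suc (Lf i), Suc l') (mate X (Lf i), mate Y l') c"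
        using inner_left[OF g] by simp
      from seg_Pair[OF X Y this _ _ le lt] show "sg (\<lambda>_. True) (Lf i, l') (Rt i, r') (c + sub (Lf i) l')"
        using a by simp
    qed
  qed
  have s8: "sound i l' r' (V (IN (Suc (Lf i)) - 1) (Suc l') (mate Y l') + V (i + (Suc (mate X (Lf i)) - Lf i)) (Suc (mate Y l')) r' + sub (Lf i) l')"
    if a: "((Lf i < Rt i \<and> Lf (Suc i) \<noteq> Lf i) \<and> FX.inL (Lf i) (Rt i) \<and> l' < r' \<and>
      l' \<le> mate Y l' \<and> mate Y l' < r' \<and> band H (mate X (Lf i), mate Y l')) \<and> mate X (Lf i) \<noteq> Rt i - 1"
  proof -
    from a have g: "Lf i < Rt i" "FX.goleft (Lf i) (Rt i)" "FX.inL (Lf i) (Rt i)" using next_left by auto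
    let ?j = "IN (Suc (Lf i)) - 1" and ?k = "i + (Suc (mate X (Lf i)) - Lf i)"
    have le: "Lf i < length X" "l' < length Y" using a interval_bounds cell_bounds by auto
    have lt: "Lf i < mate X (Lf i)" "l' < mate Y l'"
      using g(3) a FX.mt_neq[OF le(1)] GY.mt_neq[OF le(2)] by (auto simp: FX.inL_def)
    have rest: "ok ?k (Suc (mate Y l')) r' (V ?k (Suc (mate Y l')) r')"
        "Lf ?k = Suc (mate X (Lf i))" "Rt ?k = Rt i"
      using ok_rest_left[OF g] a by auto
    have kT: "?k < T"
      using FX.family_left_rest[OF F cell_index g, of "Suc (mate X (Lf i)) - Lf i"] a by simp
    have so: "sound ?j (Suc l') (mate Y l') (V ?j (Suc l') (mate Y l'))"
      using ok_inner_left[OF g] a by (auto simp: ok_def)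
    show ?thesis
    proof (rule sound_add2[OF so])
      show so2: "sound ?k (Suc (mate Y l')) r' (V ?k (Suc (mate Y l')) r')"
        using rest by (auto simp: ok_def)
      show "0 \<le> sub (Lf i) l'" using sub_nonneg le by simp
      show "0 \<le> V ?j (Suc l') (mate Y l')"
        using sound_nonneg[OF so inner_left(2)[OF g]] a cell_bounds by simp
      show "0 \<le> V ?k (Suc (mate Y l')) r'"
        using sound_nonneg[OF so2 kT] cell_bounds by simp
      fix c e assume c: "sg (\<lambda>_. True) (Lf ?j, Suc l') (Rt ?j, mate Y l') c"
        and e: "sg (\<lambda>_. True) (Lf ?k, Suc (mate Y l')) (Rt ?k, r') e"
      have "sg (\<lambda>_. True) (Suc (Lf i), Suc l') (mate X (Lf i), mate Y l') c"
        using c inner_left[OF g] by simp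
      from seg_join_direct[OF X Y seg_Pair[OF X Y this _ _ le lt], of _ e]
      show "sg (\<lambda>_. True) (Lf i, l') (Rt i, r') (c + e + sub (Lf i) l')"
        using e rest by (simp add: algebra_simps)
    qed
  qed
  have s9: "sound i l' r' (V (IN (Suc (mate X (Rt i - 1))) - 1) (Suc (mate Y (r' - 1))) (r' - 1) + V (i + (Rt i - (mate X (Rt i - 1)))) l' (mate Y (r' - 1)) + sub (mate X (Rt i - 1)) (mate Y (r' - 1)))"
    if a: "(Lf i < Rt i \<and> Lf (Suc i) = Lf i) \<and> FX.inR (Lf i) (Rt i) \<and> l' < r' \<and>
      l' \<le> mate Y (r' - 1) \<and> mate Y (r' - 1) < r' \<and> band H (mate X (Rt i - 1), mate Y (r' - 1))"
  proof -
    let ?q = "mate X (Rt i - 1)" and ?q' = "mate Y (r' - 1)"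
    from a have g: "Lf i < Rt i" "\<not> FX.goleft (Lf i) (Rt i)" "FX.inR (Lf i) (Rt i)" using next_left by auto
    let ?j = "IN (Suc ?q) - 1" and ?k = "i + (Rt i - ?q)"
    have le: "?q < length X" "?q' < length Y" "Rt i - 1 < length X" "r' - 1 < length Y"
      using a interval_bounds cell_bounds by (auto simp: FX.inR_def)
    have mm: "mate X ?q = Rt i - 1" "mate Y ?q' = r' - 1"
      using FX.mt_mt[OF le(3)] GY.mt_mt[OF le(4)] by auto
    have "?q < Rt i" "?q' < r'" using g(3) a by (auto simp: FX.inR_def)
    then have lt: "?q < mate X ?q" "?q' < mate Y ?q'"
      using FX.mt_neq[OF le(3)] GY.mt_neq[OF le(4)] unfolding mm by linarith+
    have rest: "ok ?k l' ?q' (V ?k l' ?q')" "Lf ?k = Lf i" "Rt ?k = ?q"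
      using ok_rest_right[OF g] a by auto
    have kT: "?k < T"
      using FX.family_right_rest[OF F cell_index g, of "Rt i - ?q"] a by simp
    have so: "sound ?j (Suc ?q') (r' - 1) (V ?j (Suc ?q') (r' - 1))"
      using ok_inner_right[OF g] a by (auto simp: ok_def)
    show ?thesis
    proof (rule sound_add2[OF so])
      show so2: "sound ?k l' ?q' (V ?k l' ?q')"
        using rest by (auto simp: ok_def)
      show "0 \<le> sub ?q ?q'" using sub_nonneg le by simp
      show "0 \<le> V ?j (Suc ?q') (r' - 1)"
        using sound_nonneg[OF so inner_right(2)[OF g]] a cell_bounds by simp
      show "0 \<le> V ?k l' ?q'"
        using sound_nonneg[OF so2 kT] a cell_bounds by simp
      fix c e assume c: "sg (\<lambda>_. True) (Lf ?j, Suc ?q') (Rt ?j, r' - 1) c"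
        and e: "sg (\<lambda>_. True) (Lf ?k, l') (Rt ?k, ?q') e"
      have "sg (\<lambda>_. True) (Suc ?q, Suc ?q') (mate X ?q, mate Y ?q') c"
        using c inner_right[OF g] mm by simp
      from seg_join_direct[OF X Y _ seg_Pair[OF X Y this _ _ le(1,2) lt], of "(Lf i, l')" e]
      show "sg (\<lambda>_. True) (Lf i, l') (Rt i, r') (c + e + sub ?q ?q')"
        using e rest mm a by (simp add: algebra_simps)
    qed
  qed
  show ?thesis
    unfolding value_of_def
  proof (rule relaxes_ind)
    fix g v assume gv: "(g, v) \<in> set (candidates V i l' r')" "g"
    have "list_all (\<lambda>(g, v). g \<longrightarrow> sound i l' r' v) (candidates V i l' r')"
      unfolding candidates_def Let_def list.pred_inject(2) prod.case
      by (intro conjI impI; (erule s2 s3 s4 s5 s6 s7 s8 s9 | simp only: list.pred_inject))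
    then show "sound i l' r' v" using gv by (auto simp: list_all_iff)
  qed (rule s1)
qed

text \<open>A path in the band is taken apart at the end where the chain shrinks: by its first edge
  if the interval is empty or shrinks at the left, by its last edge otherwise. Its pieces stay in
  the band, so the corners pass the guards and the entries bound the costs of the pieces.\<close>

lemma complete_value:
  assumes "sg (band H) (Lf i, l') (Rt i, r') c"
  shows "value_of V i l' r' \<le> c"
proof -
  have le: "value_of V i l' r' \<le> v" if "(g, v) \<in> set (candidates V i l' r')" "g" for g v
    unfolding value_of_def using that by (rule relaxes_le)
  have insL: "value_of V i l' r' \<le> ins l' + d"
    if "l' < r'" "sg (band H) (Lf i, Suc l') (Rt i, r') d" for d
  proof -
    have b: "band H (Lf i, Suc l')" using seg_ends[OF that(2)] by simp
    have "value_of V i l' r' \<le> V i (Suc l') r' + ins l'"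
      by (rule le[where g = "l' < r' \<and> band H (Lf i, Suc l')"])
        (use that b in \<open>simp_all add: candidates_def Let_def\<close>)
    then show ?thesis using ok_insL[OF that(1) b] that(2) unfolding ok_def by force
  qed
  have insR: "value_of V i l' r' \<le> ins (r' - 1) + d"
    if "l' < r'" "sg (band H) (Lf i, l') (Rt i, r' - 1) d" for d
  proof -
    have b: "band H (Rt i, r' - 1)" using seg_ends[OF that(2)] by simp
    have "value_of V i l' r' \<le> V i l' (r' - 1) + ins (r' - 1)"
      by (rule le[where g = "l' < r' \<and> band H (Rt i, r' - 1)"])
        (use that b in \<open>simp_all add: candidates_def Let_def\<close>)
    then show ?thesis using ok_insR[OF that(1) b] that(2) unfolding ok_def by force
  qed
  show ?thesis
  proof (cases "Lf i = Rt i")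
    case True
    show ?thesis
    proof (cases rule: seg_cases_left[OF X Y assms interval_bounds(2) cell_bounds(2), case_names empty del ins match])
      case empty
      have "value_of V i l' r' \<le> 0"
        by (rule le[where g = "Lf i = Rt i \<and> l' = r'"])
          (use empty in \<open>simp_all add: candidates_def Let_def\<close>)
      then show ?thesis using empty by simp
    next
      case (ins d)
      then show ?thesis using insL[of d] by (simp add: paren_weight_def)
    qed (use True in simp_all)
  next
    case False
    then have lt: "Lf i < Rt i" using interval_bounds by simp
    show ?thesis
    proof (cases "FX.goleft (Lf i) (Rt i)")
      case g: True
      note n = next_left(1,3)[OF lt]
      show ?thesis
      proof (cases rule: seg_cases_left[OF X Y assms interval_bounds(2) cell_bounds(2), case_names empty del ins match])
        case (del d)
        have b: "band H (Suc (Lf i), l')" using seg_ends[OF del(3)] by simp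
        have "value_of V i l' r' \<le> V (Suc i) l' r' + del (Lf i)"
          by (rule le[where g = "(Lf i < Rt i \<and> Lf (Suc i) \<noteq> Lf i) \<and> band H (Suc (Lf i), l')"])
            (use lt n g b in \<open>simp_all add: candidates_def Let_def\<close>)
        moreover have "V (Suc i) l' r' \<le> d"
          using ok_delL[OF lt g b] del(3) n(2)[OF g] unfolding ok_def by simp
        ultimately show ?thesis using del(4) by (simp add: paren_weight_def)
      next
        case (ins d)
        then show ?thesis using insL[of d] by (simp add: paren_weight_def)
      next
        case (match d e)
        have b: "band H (mate X (Lf i), mate Y l')" using seg_ends[OF match(5)] by simp
        have iL: "FX.inL (Lf i) (Rt i)" using match by (simp add: FX.inL_def)
        have lt': "l' < r'" "l' \<le> mate Y l'" using match by simp_all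
        let ?j = "IN (Suc (Lf i)) - 1"
        have d: "V ?j (Suc l') (mate Y l') \<le> d"
          using ok_inner_left[OF lt g iL lt' match(4) b] inner_left[OF lt g iL] match(5)
          unfolding ok_def by simp
        show ?thesis
        proof (cases "mate X (Lf i) = Rt i - 1")
          case single: True
          show ?thesis
          proof (cases "mate Y l' = r' - 1")
            case True
            have "value_of V i l' r' \<le> V ?j (Suc l') (mate Y l') + sub (Lf i) l'"
              by (rule le[where g = "((Lf i < Rt i \<and> Lf (Suc i) \<noteq> Lf i) \<and> FX.inL (Lf i) (Rt i) \<and>
                  l' < r' \<and> l' \<le> mate Y l' \<and> mate Y l' < r' \<and> band H (mate X (Lf i), mate Y l')) \<and>
                  mate X (Lf i) = Rt i - 1 \<and> mate Y l' = r' - 1"])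
                (use lt n g b iL lt' match(4) single True in \<open>simp_all add: candidates_def Let_def\<close>)
            moreover have "0 \<le> e" using seg_nonneg[OF match(6)] interval_bounds cell_bounds by simp
            ultimately show ?thesis using d match(7) by simp
          next
            case False
            then have s: "Suc (mate Y l') \<le> r' - 1" "r' = Suc (r' - 1)" "Suc (mate X (Lf i)) = Rt i"
              using match(4) single lt by auto
            \<comment> \<open>The matched tree exhausts the interval of \<open>F\<close>, so the
              path goes on by insertions alone. The final one is split off and left to the candidate
              that inserts at the right end.\<close>
            obtain f where f: "sg (band H) (Rt i, Suc (mate Y l')) (Rt i, r' - 1) f" "f + ins (r' - 1) \<le> e"
              using seg_column[of "band H" "Rt i" "Suc (mate Y l')" "r' - 1" e] match(6) s interval_bounds cell_bounds by auto
            have "sg (band H) (Lf i, l') (Suc (mate X (Lf i)), Suc (mate Y l')) (d + sub (Lf i) l')"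
              using seg_Pair[OF X Y match(5)] match(1,3) cell_band b lt interval_bounds cell_bounds lt' by simp
            from seg_join_direct[OF X Y this, of _ f]
            have "sg (band H) (Lf i, l') (Rt i, r' - 1) (d + sub (Lf i) l' + f)"
              using f(1) s(3) by simp
            from insR[OF lt'(1) this] show ?thesis using f(2) match(7) by simp
          qed
        next
          case multi: False
          let ?k = "i + (Suc (mate X (Lf i)) - Lf i)"
          have "value_of V i l' r' \<le> V ?j (Suc l') (mate Y l') + V ?k (Suc (mate Y l')) r' + sub (Lf i) l'"
            by (rule le[where g = "((Lf i < Rt i \<and> Lf (Suc i) \<noteq> Lf i) \<and> FX.inL (Lf i) (Rt i) \<and>
                l' < r' \<and> l' \<le> mate Y l' \<and> mate Y l' < r' \<and> band H (mate X (Lf i), mate Y l')) \<and>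
                mate X (Lf i) \<noteq> Rt i - 1"])
              (use lt n g b iL lt' match(4) multi in \<open>simp_all add: candidates_def Let_def\<close>)
          moreover have "V ?k (Suc (mate Y l')) r' \<le> e"
            using ok_rest_left[OF lt g iL multi match(4) b] match(6) unfolding ok_def by simp
          ultimately show ?thesis using d match(7) by simp
        qed
      qed (use lt in simp)
    next
      case g: False
      note n = next_left(1,4)[OF lt]
      obtain r where r: "Rt i = Suc r" using lt by (cases "Rt i") auto
      from assms have A: "sg (band H) (Lf i, l') (Suc r, r') c" using r by simp
      show ?thesis
      proof (cases rule: seg_cases_right[OF X Y A interval_bounds(2)[unfolded r] cell_bounds(2), case_names empty del ins match])
        case (del d)
        have b: "band H (Rt i - 1, r')" using seg_ends[OF del(3)] r by simp
        have "value_of V i l' r' \<le> V (Suc i) l' r' + del (Rt i - 1)"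
          by (rule le[where g = "(Lf i < Rt i \<and> Lf (Suc i) = Lf i) \<and> band H (Rt i - 1, r')"])
            (use lt n g b in \<open>simp_all add: candidates_def Let_def\<close>)
        moreover have "V (Suc i) l' r' \<le> d"
          using ok_delR[OF lt g b] del(3) n(2)[OF g] r unfolding ok_def by simp
        ultimately show ?thesis using del(4) r by (simp add: paren_weight_def)
      next
        case (ins d s')
        then show ?thesis using insR[of d] r by (simp add: paren_weight_def)
      next
        case (match d e s')
        let ?q = "mate X (Rt i - 1)" and ?q' = "mate Y (r' - 1)"
        let ?j = "IN (Suc ?q) - 1" and ?k = "i + (Rt i - ?q)"
        have iR: "FX.inR (Lf i) (Rt i)" using match r by (simp add: FX.inR_def)
        have lt': "l' < r'" "l' \<le> ?q'" "?q' < r'" using match by simp_all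
        have b: "band H (?q, ?q')" using seg_ends[OF match(7)] match(1) r by simp
        have "value_of V i l' r' \<le> V ?j (Suc ?q') (r' - 1) + V ?k l' ?q' + sub ?q ?q'"
          by (rule le[where g = "(Lf i < Rt i \<and> Lf (Suc i) = Lf i) \<and> FX.inR (Lf i) (Rt i) \<and>
              l' < r' \<and> l' \<le> ?q' \<and> ?q' < r' \<and> band H (?q, ?q')"])
            (use lt n g b iR lt' in \<open>simp_all add: candidates_def Let_def\<close>)
        moreover have "V ?j (Suc ?q') (r' - 1) \<le> d"
          using ok_inner_right[OF lt g iR lt'(1,3) b] inner_right[OF lt g iR] match(6) match(1) r
          unfolding ok_def by simp
        moreover have "V ?k l' ?q' \<le> e"
          using ok_rest_right[OF lt g iR lt'(2,3) b] match(7) match(1) r unfolding ok_def by simp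
        ultimately show ?thesis using match(8) match(1) r by simp
      qed (use lt r in simp)
    qed
  qed
qed

lemma ok_value: "ok i l' r' (value_of V i l' r')"
  using sound_value complete_value by (simp add: ok_def)

end

end

end

section \<open>Preprocessing\<close>

text \<open>
  A scalar is cell 0 of a word array. Word arrays 5 and 6 hold the mates of \<open>F\<close> and \<open>G\<close>; 7 links each open
  parenthesis to the enclosing one; 11 and 12 hold the end points of the listed intervals; 13 maps a
  node to 1 plus the index of its inner interval, 0 meaning that none is listed yet; scalar 17 counts the
  intervals; 18, 19 and 20 hold the budget \<open>K\<close>, the band \<open>H = 2 * K\<close> and the table width \<open>2 * H + 1\<close>;
  10 is set to 1 once the answer is known. Real array 1 is the table, 2 the current minimum, 3 the cost
  of deleting \<open>F\<close> and inserting \<open>G\<close>, 4 the budget as a real.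
\<close>

abbreviation sc :: "nat \<Rightarrow> word_exp" where "sc v \<equiv> Word v (Const 0)"
abbreviation put :: "nat \<Rightarrow> word_exp \<Rightarrow> com" where "put v e \<equiv> SetWord v (Const 0) e"
abbreviation addE :: "word_exp \<Rightarrow> word_exp \<Rightarrow> word_exp" where "addE \<equiv> WordOp Add"
abbreviation subE :: "word_exp \<Rightarrow> word_exp \<Rightarrow> word_exp" where "subE \<equiv> WordOp Sub"
abbreviation mulE :: "word_exp \<Rightarrow> word_exp \<Rightarrow> word_exp" where "mulE \<equiv> WordOp Mul"
abbreviation oneE :: word_exp where "oneE \<equiv> Const 1"
abbreviation half :: "word_exp option \<Rightarrow> word_exp option \<Rightarrow> real_exp" where
  "half a b \<equiv> RScale (1 / 2) (Oracle a b)"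

declare word_op.simps [simp del]

lemma runs_then:
  assumes "runs W w c T P s" "\<And>s'. P s' \<Longrightarrow> runs W w d U Q s'" "T + U \<le> T'"
  shows "runs W w (Seq c d) T' Q s"
  by (rule runs_mono[OF runs_Seq[OF runs_mono[OF assms(1) order.refl assms(2)]] assms(3)])

lemma runs_flat_Seq:
  assumes "flat c" "runs W w d T Q (run W w c s)" "com_size c + T \<le> T'"
  shows "runs W w (Seq c d) T' Q s"
proof -
  have "runs W w (Seq c d) (com_size c + T) Q s"
    by (rule runs_Seq, rule runs_flat) (use assms in simp_all)
  then show ?thesis by (rule runs_mono) (use assms(3) in simp_all)
qed

definition loop :: "nat \<Rightarrow> word_exp \<Rightarrow> com \<Rightarrow> com" where
  "loop v n c = Seq (put v (Const 0)) (While (Less (sc v) n) (Seq c (put v (addE (sc v) oneE))))"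

lemma set_word_twice [simp]: "set_word v i x (set_word v i y s) = set_word v i x s"
  by (simp add: set_word_def)

text \<open>Each round adds a test and an increment to the body; the final 2 is the initialisation
  and the failing test.\<close>

lemma runs_loop:
  assumes init: "I 0 (set_word v 0 0 s)"
    and len: "\<And>k s. I k s \<Longrightarrow> word_val W s e = n"
    and body: "\<And>k s. k < n \<Longrightarrow> I k s \<Longrightarrow> words s v 0 = k \<Longrightarrow>
      runs W w c T (\<lambda>s'. words s' v 0 = k \<and> I (Suc k) (set_word v 0 (Suc k) s')) s"
    and n: "n < 2 ^ W"
  shows "runs W w (loop v e c) (n * (T + 2) + 2) (\<lambda>s. I n s \<and> words s v 0 = n) s"
proof -
  let ?I = "\<lambda>k (s::state). I k s \<and> words s v 0 = k"
  have o: "take_bit W (Suc 0) = Suc 0" if "0 < n"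
    using n that by (cases W) auto
  have "runs W w (While (Less (sc v) e) (Seq c (put v (addE (sc v) oneE))))
      (n * Suc (T + 1) + 1) (?I n) (set_word v 0 0 s)"
  proof (rule runs_While_const[where I = ?I])
    show "?I 0 (set_word v 0 0 s)" using init by (simp add: state_simps)
    show "\<not> test_val W w s (Less (sc v) e)" if "?I n s" for s
      using that len[of n s] by simp
    fix k s assume k: "k < n" and I: "?I k s"
    have "runs W w (Seq c (put v (addE (sc v) oneE))) (T + 1) (?I (Suc k)) s"
    proof (rule runs_Seq, rule runs_mono[OF body[OF k]])
      fix s' assume s': "words s' v 0 = k \<and> I (Suc k) (set_word v 0 (Suc k) s')"
      have "word_op W Add k (Suc 0) = Suc k"
        using k n by (subst word_add) auto
      then show "runs W w (put v (addE (sc v) oneE)) 1 (?I (Suc k)) s'"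
        using s' o k by (intro runs_flat) (simp_all add: state_simps)
    qed (use I in auto)
    then show "test_val W w s (Less (sc v) e) \<and>
        runs W w (Seq c (put v (addE (sc v) oneE))) (T + 1) (?I (Suc k)) s"
      using I k len[of k s] by simp
  qed
  then show ?thesis
    unfolding loop_def by (intro runs_flat_Seq[where T = "n * Suc (T + 1) + 1"]) simp_all
qed

definition holds_input :: "nat paren list \<Rightarrow> nat paren list \<Rightarrow> state \<Rightarrow> bool" where
  "holds_input X Y s \<longleftrightarrow> words s 0 0 = length X \<and> words s 0 1 = length Y \<and>
     (\<forall>j<length X. words s 1 j = of_bool (is_open (X ! j)) \<and> words s 2 j = lab (X ! j)) \<and>
     (\<forall>j<length Y. words s 3 j = of_bool (is_open (Y ! j)) \<and> words s 4 j = lab (Y ! j))"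

lemma holds_input_cong:
  assumes "\<And>A. A \<le> 4 \<Longrightarrow> words s' A = words s A"
  shows "holds_input X Y s' \<longleftrightarrow> holds_input X Y s"
  using assms by (simp add: holds_input_def)

lemma holds_input_set [simp]:
  "4 < A \<Longrightarrow> holds_input X Y (set_word A i v s) \<longleftrightarrow> holds_input X Y s"
  "holds_input X Y (set_real A' i x s) \<longleftrightarrow> holds_input X Y s"
  by (rule holds_input_cong; simp add: state_simps)+

definition eq_prog :: com where
  "eq_prog = Seq (put 10 oneE) (Seq (Cond (Eq (sc 0) (Word 0 oneE)) Skip (put 10 (Const 0)))
     (loop 8 (sc 0) (Cond (Both (Eq (Word 1 (sc 8)) (Word 3 (sc 8))) (Eq (Word 2 (sc 8)) (Word 4 (sc 8))))
        Skip (put 10 (Const 0)))))"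

text \<open>A stack kept as a linked list: scalar 9 is the top plus one, with 0 for the empty stack,
  and array 7 stores what lay below each pushed position.\<close>

definition mate_prog :: "nat \<Rightarrow> nat \<Rightarrow> nat \<Rightarrow> com" where
  "mate_prog c A R = Seq (put 9 (Const 0)) (loop 8 (Word 0 (Const c))
     (Cond (Eq (Word A (sc 8)) oneE)
        (Seq (SetWord 7 (sc 8) (sc 9)) (put 9 (addE (sc 8) oneE)))
        (Seq (SetWord R (sc 8) (subE (sc 9) oneE))
          (Seq (SetWord R (subE (sc 9) oneE) (sc 8))
               (put 9 (Word 7 (subE (sc 9) oneE)))))))"

definition inf_prog :: com where
  "inf_prog = Seq (SetReal 3 (Const 0) (RConst 0)) (Seq
     (loop 8 (sc 0) (SetReal 3 (Const 0) (RAdd (Real 3 (Const 0)) (half (Some (Word 2 (sc 8))) None))))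
     (loop 8 (Word 0 oneE) (SetReal 3 (Const 0) (RAdd (Real 3 (Const 0)) (half None (Some (Word 4 (sc 8))))))))"

text \<open>Table indices are the largest numbers computed and stay below
  \<open>64 * (N + M + 4) ^ 4\<close>, so the sixth power excludes overflow.\<close>

locale machine = pair w X Y for w :: "nat weight" and X Y +
  fixes W :: nat
  assumes size: "64 * (length X + length Y + 4) ^ 6 \<le> 2 ^ W"
begin

abbreviation "N \<equiv> length X"
abbreviation "M \<equiv> length Y"

lemma fits: "e \<le> 6 \<Longrightarrow> k \<le> 64 * (N + M + 4) ^ e \<Longrightarrow> k \<le> 2 ^ W"
proof -
  assume "e \<le> 6" "k \<le> 64 * (N + M + 4) ^ e"
  moreover have "(N + M + 4) ^ e \<le> (N + M + 4) ^ 6" if "e \<le> 6"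
    using that by (intro power_increasing) auto
  ultimately show "k \<le> 2 ^ W" using size by (meson mult_le_mono2 order_trans)
qed

lemma fits1: "k < 64 * (N + M + 4) \<Longrightarrow> k < 2 ^ W"
  using fits[of 1 "Suc k"] by simp

lemma const [simp]: "c < 64 \<Longrightarrow> take_bit W c = (c::nat)"
  using fits1[of c] by (simp add: take_bit_nat_eq_self)

lemma W_pos [simp]: "0 < W"
  using fits1[of 1] by (cases W) simp_all

lemma const_1 [simp]: "take_bit W (Suc 0) = Suc 0"
  using W_pos by (cases W) simp_all

lemma paren_eq: "p = q \<longleftrightarrow> is_open p = is_open q \<and> lab p = lab q"
  by (cases p; cases q) auto

lemma runs_eq_prog:
  assumes "holds_input X Y s"
  shows "runs W w eq_prog (5 * N + 20) (\<lambda>s. words s 10 0 = of_bool (X = Y)) s"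
proof -
  let ?I = "\<lambda>k (s::state). holds_input X Y s \<and> words s 10 0 =
    of_bool (N = M \<and> (\<forall>j<k. words s 1 j = words s 3 j \<and> words s 2 j = words s 4 j))"
  have "runs W w (loop 8 (sc 0) (Cond (Both (Eq (Word 1 (sc 8)) (Word 3 (sc 8)))
      (Eq (Word 2 (sc 8)) (Word 4 (sc 8)))) Skip (put 10 (Const 0)))) (N * (3 + 2) + 2)
      (\<lambda>s. ?I N s \<and> words s 8 0 = N) s" if "?I 0 (set_word 8 0 0 s)" for s
  proof (rule runs_loop[where I = ?I])
    fix k s assume "k < N" "?I k s" "words s 8 0 = k"
    then show "runs W w (Cond (Both (Eq (Word 1 (sc 8)) (Word 3 (sc 8)))
      (Eq (Word 2 (sc 8)) (Word 4 (sc 8)))) Skip (put 10 (Const 0))) 3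
      (\<lambda>s'. words s' 8 0 = k \<and> ?I (Suc k) (set_word 8 0 (Suc k) s')) s"
      by (intro runs_flat) (auto simp: state_simps less_Suc_eq)
  qed (use that fits1[of N] in \<open>auto simp: holds_input_def\<close>)
  note L = this
  have "runs W w eq_prog (5 * N + 20) (\<lambda>s. ?I N s \<and> words s 8 0 = N) s"
    unfolding eq_prog_def
  proof (rule runs_then[where T = 1])
    show "runs W w (put 10 oneE) 1 (\<lambda>s. holds_input X Y s \<and> words s 10 0 = 1) s"
      using assms by (intro runs_flat) (simp_all add: state_simps)
    fix s assume s: "holds_input X Y s \<and> words s 10 0 = 1"
    show "runs W w (Seq (Cond (Eq (sc 0) (Word 0 oneE)) Skip (put 10 (Const 0)))
        (loop 8 (sc 0) (Cond (Both (Eq (Word 1 (sc 8)) (Word 3 (sc 8)))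
          (Eq (Word 2 (sc 8)) (Word 4 (sc 8)))) Skip (put 10 (Const 0))))) (5 * N + 19)
        (\<lambda>s. ?I N s \<and> words s 8 0 = N) s"
    proof (rule runs_then[where T = 3])
      show "runs W w (Cond (Eq (sc 0) (Word 0 oneE)) Skip (put 10 (Const 0))) 3
          (\<lambda>s. ?I 0 (set_word 8 0 0 s)) s"
        using s by (intro runs_flat) (auto simp: state_simps holds_input_def)
    qed (rule L, simp_all)
  qed simp
  then show ?thesis
  proof (rule runs_mono)
    fix s assume s: "?I N s \<and> words s 8 0 = N"
    have "X = Y \<longleftrightarrow> N = M \<and> (\<forall>j<N. X ! j = Y ! j)"
      by (auto simp: list_eq_iff_nth_eq)
    also have "\<dots> \<longleftrightarrow> N = M \<and> (\<forall>j<N. words s 1 j = words s 3 j \<and> words s 2 j = words s 4 j)"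
      using s by (auto simp: holds_input_def paren_eq)
    finally show "words s 10 0 = of_bool (X = Y)" using s by simp
  qed simp
qed

end

section \<open>Computing mates with a stack\<close>

context mates
begin

text \<open>The top of the stack before position \<open>i\<close> is read: 0 if nothing is open,
  \<open>Suc a\<close> if \<open>a\<close> is the innermost parenthesis still open.\<close>

definition enclosing :: "nat \<Rightarrow> nat \<Rightarrow> bool" where
  "enclosing i t \<longleftrightarrow> (case t of 0 \<Rightarrow> \<forall>b<i. mt b < i
     | Suc a \<Rightarrow> a < i \<and> i \<le> mt a \<and> (\<forall>b. a < b \<and> b < i \<longrightarrow> mt b < i))"

lemma enclosing_open: "i < mt i \<Longrightarrow> enclosing (Suc i) (Suc i)"
  by (auto simp: enclosing_def)

text \<open>Were the top other than the mate, then either an open parenthesis would lie above it or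
  two arcs would cross.\<close>

lemma enclosing_close:
  assumes i: "i < N" "mt i < i" and e: "enclosing i t"
  shows "t = Suc (mt i)"
proof (cases t)
  case 0
  then have "mt (mt i) < i" using e i by (simp add: enclosing_def)
  then show ?thesis using mt_mt[OF i(1)] by simp
next
  case (Suc a)
  have a: "a < i" "i \<le> mt a" "\<And>b. a < b \<Longrightarrow> b < i \<Longrightarrow> mt b < i"
    using e Suc by (auto simp: enclosing_def)
  have "\<not> a < mt i" using a(3)[of "mt i"] mt_mt[OF i(1)] i(2) by auto
  moreover have "\<not> mt i < a"
    using nest[of "mt i" a] mt_mt[OF i(1)] mt_less[OF i(1)] a i by auto
  ultimately show ?thesis using Suc by simp
qed

text \<open>Everything between the mate and \<open>i\<close> is closed by now, so the stack is what
  it was before the mate was pushed.\<close>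

lemma enclosing_pop:
  assumes i: "i < N" "mt i < i" and e: "enclosing (mt i) t"
  shows "enclosing (Suc i) t"
proof -
  note m = mt_mt[OF i(1)] mt_less[OF i(1)]
  have between: "mt b < Suc i" if b: "mt i \<le> b" "b < Suc i" for b
  proof -
    consider "b = mt i" | "b = i" | "mt i < b" "b < i" using b by linarith
    then show ?thesis
      using m i nest[of "mt i" b] by cases auto
  qed
  show ?thesis
  proof (cases t)
    case 0
    have "mt b < Suc i" if "b < Suc i" for b
      using that between[of b] e 0 i by (cases "b < mt i") (auto simp: enclosing_def)
    then show ?thesis using 0 by (simp add: enclosing_def)
  next
    case (Suc c)
    have c: "c < mt i" "mt i \<le> mt c" "\<And>b. c < b \<Longrightarrow> b < mt i \<Longrightarrow> mt b < mt i"
      using e Suc by (auto simp: enclosing_def)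
    have "mt c \<noteq> mt i" using c(1) m i mt_mt[of c] by auto
    then have "i < mt c" using nest[of c "mt i"] c m i by auto
    moreover have "mt b < Suc i" if "c < b" "b < Suc i" for b
      using that between[of b] c(3)[of b] i by (cases "b < mt i") auto
    ultimately show ?thesis using Suc c i by (simp add: enclosing_def)
  qed
qed

text \<open>The last conjunct concerns only parentheses that are still open: their links are the
  ones a future pop will follow.\<close>

definition mate_inv :: "nat \<Rightarrow> (nat \<Rightarrow> nat) \<Rightarrow> (nat \<Rightarrow> nat) \<Rightarrow> nat \<Rightarrow> bool" where
  "mate_inv i R P t \<longleftrightarrow> (\<forall>j<i. mt j < i \<longrightarrow> R j = mt j) \<and> enclosing i t \<and>
     (\<forall>a<i. i \<le> mt a \<longrightarrow> enclosing a (P a))"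

lemma mate_inv_0: "mate_inv 0 R P 0"
  by (simp add: mate_inv_def enclosing_def)

lemma mate_inv_open:
  assumes "mate_inv i R P t" "i < mt i" "i < N"
  shows "mate_inv (Suc i) R (P(i := t)) (Suc i)"
proof -
  have "mt j \<noteq> i" if "j < i" for j using mt_mt[of j] assms that by auto
  then show ?thesis
    using assms enclosing_open[of i] unfolding mate_inv_def
    by (auto simp: less_Suc_eq Suc_le_eq)
qed

lemma mate_inv_close:
  assumes I: "mate_inv i R P t" and i: "mt i < i" "i < N"
  shows "t = Suc (mt i)" "mate_inv (Suc i) (R(i := mt i, mt i := i)) P (P (mt i))"
proof -
  note m = mt_mt[OF i(2)] mt_less[OF i(2)]
  have e: "enclosing i t" using I by (simp add: mate_inv_def)
  show "t = Suc (mt i)" by (rule enclosing_close[OF i(2,1) e])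
  have "enclosing (mt i) (P (mt i))" using I i m by (auto simp: mate_inv_def)
  then have "enclosing (Suc i) (P (mt i))" by (rule enclosing_pop[OF i(2,1)])
  moreover have "(R(i := mt i, mt i := i)) j = mt j" if "j < Suc i" "mt j < Suc i" for j
  proof (cases "j = i \<or> j = mt i")
    case True
    then show ?thesis using m i by auto
  next
    case False
    then have "mt j \<noteq> i" using mt_mt[of j] that i by auto
    then show ?thesis using False that I by (auto simp: mate_inv_def)
  qed
  ultimately show "mate_inv (Suc i) (R(i := mt i, mt i := i)) P (P (mt i))"
    using I i unfolding mate_inv_def by (auto simp: less_Suc_eq Suc_le_eq)
qed

end

lemma runs_put: "Q (set_word v 0 (word_val W s e) s) \<Longrightarrow> 1 \<le> T \<Longrightarrow> runs W w (put v e) T Q s"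
  by (rule runs_flat) simp_all

context machine
begin

lemma word_simps:
  "a + b < 2 ^ W \<Longrightarrow> word_op W Add a b = a + b"
  "b \<le> a \<Longrightarrow> a < 2 ^ W \<Longrightarrow> word_op W Sub a b = a - b"
  by (rule word_add word_sub; assumption)+

lemma runs_mate_prog:
  assumes m: "mates n m" and n: "n \<le> N + M" and c: "c < 64"
    and AR: "A \<notin> {0, 7, 8, 9, R}" "R \<notin> {0, 7, 8, 9}"
    and s: "words s 0 c = n" "\<And>j. j < n \<Longrightarrow> words s A j = of_bool (j < m j)"
  shows "runs W w (mate_prog c A R) (9 * n + 5) (\<lambda>s'. \<forall>j<n. words s' R j = m j) s"
proof -
  interpret mates n m by (rule m)
  let ?b = "Cond (Eq (Word A (sc 8)) oneE)
        (Seq (SetWord 7 (sc 8) (sc 9)) (put 9 (addE (sc 8) oneE)))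
        (Seq (SetWord R (sc 8) (subE (sc 9) oneE))
          (Seq (SetWord R (subE (sc 9) oneE) (sc 8))
               (put 9 (Word 7 (subE (sc 9) oneE)))))"
  let ?I = "\<lambda>k (s::state). words s 0 c = n \<and> (\<forall>j<n. words s A j = of_bool (j < m j)) \<and>
    mate_inv k (words s R) (words s 7) (words s 9 0)"
  have "runs W w (loop 8 (Word 0 (Const c)) ?b) (n * (6 + 2) + 2) (\<lambda>s. ?I n s \<and> words s 8 0 = n) s"
    if "?I 0 (set_word 8 0 0 s)" for s
  proof (rule runs_loop[where I = ?I])
    fix k s assume k: "k < n" and I: "?I k s" and v: "words s 8 0 = k"
    have b: "Suc k < 2 ^ W" "Suc (m k) < 2 ^ W" using k n mt_less[OF k] by (auto intro!: fits1)
    show "runs W w ?b 6 (\<lambda>s'. words s' 8 0 = k \<and> ?I (Suc k) (set_word 8 0 (Suc k) s')) s"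
    proof (cases "k < m k")
      case True
      then show ?thesis
        using I v k AR b mate_inv_open[of k "words s R" "words s 7" "words s 9 0"]
        by (intro runs_flat) (simp_all add: state_simps word_simps)
    next
      case False
      then have lt: "m k < k" using mt_neq[OF k] by simp
      show ?thesis
        using I v k AR b lt mate_inv_close[of k "words s R" "words s 7" "words s 9 0"]
        by (intro runs_flat) (simp_all add: state_simps word_simps)
    qed
  qed (use that c n fits1[of n] in auto)
  note L = this
  have "runs W w (mate_prog c A R) (9 * n + 5) (\<lambda>s. ?I n s \<and> words s 8 0 = n) s"
    unfolding mate_prog_def
  proof (rule runs_then[where T = 1])
    show "runs W w (put 9 (Const 0)) 1 (\<lambda>s. ?I 0 (set_word 8 0 0 s)) s"
      using AR s by (intro runs_flat) (auto simp: state_simps mate_inv_0)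
  qed (rule L, simp_all)
  then show ?thesis
    by (rule runs_mono) (use mt_less in \<open>auto simp: mate_inv_def\<close>)
qed

definition trivial_cost :: real where
  "trivial_cost = (\<Sum>i<N. del i) + (\<Sum>j<M. ins j)"

lemma runs_inf_prog:
  assumes "holds_input X Y s"
  shows "runs W w inf_prog (3 * N + 3 * M + 5) (\<lambda>s. reals s 3 0 = trivial_cost) s"
proof -
  let ?I = "\<lambda>k (s::state). holds_input X Y s \<and> reals s 3 0 = (\<Sum>i<k. del i)"
  let ?J = "\<lambda>k (s::state). holds_input X Y s \<and> reals s 3 0 = (\<Sum>i<N. del i) + (\<Sum>j<k. ins j)"
  let ?b = "SetReal 3 (Const 0) (RAdd (Real 3 (Const 0)) (half (Some (Word 2 (sc 8))) None))"
  let ?c = "SetReal 3 (Const 0) (RAdd (Real 3 (Const 0)) (half None (Some (Word 4 (sc 8)))))"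
  have I: "runs W w (loop 8 (sc 0) ?b) (N * (1 + 2) + 2) (\<lambda>s. ?I N s \<and> words s 8 0 = N) s"
    if "?I 0 (set_word 8 0 0 s)" for s
  proof (rule runs_loop[where I = ?I])
    fix k s assume "k < N" "?I k s" "words s 8 0 = k"
    then show "runs W w ?b 1 (\<lambda>s'. words s' 8 0 = k \<and> ?I (Suc k) (set_word 8 0 (Suc k) s')) s"
      by (intro runs_flat) (simp_all add: state_simps holds_input_def of_rat_divide)
  qed (use that fits1[of N] in \<open>auto simp: holds_input_def\<close>)
  have J: "runs W w (loop 8 (Word 0 oneE) ?c) (M * (1 + 2) + 2) (\<lambda>s. ?J M s \<and> words s 8 0 = M) s"
    if "?J 0 (set_word 8 0 0 s)" for s
  proof (rule runs_loop[where I = ?J])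
    fix k s assume "k < M" "?J k s" "words s 8 0 = k"
    then show "runs W w ?c 1 (\<lambda>s'. words s' 8 0 = k \<and> ?J (Suc k) (set_word 8 0 (Suc k) s')) s"
      by (intro runs_flat) (simp_all add: state_simps holds_input_def of_rat_divide)
  qed (use that fits1[of M] in \<open>auto simp: holds_input_def\<close>)
  show ?thesis
    unfolding inf_prog_def
  proof (rule runs_then[where T = 1 and U = "3 * N + 3 * M + 4"])
    show "runs W w (SetReal 3 (Const 0) (RConst 0)) 1 (\<lambda>s. ?I 0 (set_word 8 0 0 s)) s"
      using assms by (intro runs_flat) (simp_all add: state_simps)
    fix s assume "?I 0 (set_word 8 0 0 s)"
    then show "runs W w (Seq (loop 8 (sc 0) ?b) (loop 8 (Word 0 oneE) ?c)) (3 * N + 3 * M + 4)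
        (\<lambda>s. reals s 3 0 = trivial_cost) s"
    proof (rule runs_then[OF I])
      fix s assume "?I N s \<and> words s 8 0 = N"
      then have "?J 0 (set_word 8 0 0 s)" by simp
      from J[OF this] show "runs W w (loop 8 (Word 0 oneE) ?c) (M * (1 + 2) + 2)
          (\<lambda>s. reals s 3 0 = trivial_cost) s"
        by (rule runs_mono) (simp_all add: trivial_cost_def)
    qed simp
  qed simp
qed

end

section \<open>Listing the intervals\<close>

text \<open>Amortized time: growth of the potential \<open>\<Phi>\<close> pays for steps. With
  \<open>\<Phi>\<close> a multiple of the number of listed intervals, the loop over all nodes is
  charged to the intervals created in total, not to the longest chain once per node.\<close>

definition aruns :: "(state \<Rightarrow> nat) \<Rightarrow> nat \<Rightarrow> nat weight \<Rightarrow> com \<Rightarrow> nat \<Rightarrow> (state \<Rightarrow> bool) \<Rightarrow> state \<Rightarrow> bool" where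
  "aruns \<Phi> W w c T Q s \<longleftrightarrow> (\<exists>t s'. exec W w c s t s' \<and> t + \<Phi> s \<le> T + \<Phi> s' \<and> Q s')"

lemma aruns_runs:
  assumes "aruns \<Phi> W w c T Q s" "\<And>s'. Q s' \<Longrightarrow> T + \<Phi> s' \<le> U + \<Phi> s"
  shows "runs W w c U Q s"
proof -
  obtain t s' where t: "exec W w c s t s'" "t + \<Phi> s \<le> T + \<Phi> s'" "Q s'"
    using assms(1) unfolding aruns_def by blast
  then have "t \<le> U" using assms(2)[OF t(3)] by linarith
  then show ?thesis unfolding runs_def using t by blast
qed

lemma runs_aruns:
  assumes "runs W w c U Q s" "\<And>s'. Q s' \<Longrightarrow> U + \<Phi> s \<le> T + \<Phi> s'"
  shows "aruns \<Phi> W w c T Q s"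
proof -
  obtain t s' where t: "exec W w c s t s'" "t \<le> U" "Q s'"
    using assms(1) unfolding runs_def by blast
  then have "t + \<Phi> s \<le> T + \<Phi> s'" using assms(2)[OF t(3)] by linarith
  then show ?thesis unfolding aruns_def using t by blast
qed

lemma aruns_Seq:
  assumes "aruns \<Phi> W w c T P s" "\<And>s'. P s' \<Longrightarrow> aruns \<Phi> W w d U Q s'"
  shows "aruns \<Phi> W w (Seq c d) (T + U) Q s"
proof -
  obtain t s' where t: "exec W w c s t s'" "t + \<Phi> s \<le> T + \<Phi> s'" "P s'"
    using assms(1) unfolding aruns_def by blast
  obtain u s'' where u: "exec W w d s' u s''" "u + \<Phi> s' \<le> U + \<Phi> s''" "Q s''"
    using assms(2)[OF t(3)] unfolding aruns_def by blast
  show ?thesis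
    unfolding aruns_def using exec.Seq[OF t(1) u(1)] t u
    by (intro exI[of _ "t + u"] exI[of _ s'']) simp
qed

lemma aruns_While:
  assumes "I (0::nat) s"
    and "\<And>i s. i < n \<Longrightarrow> I i s \<Longrightarrow> test_val W w s b \<and> aruns \<Phi> W w c T (I (Suc i)) s"
    and "\<And>s. I n s \<Longrightarrow> \<not> test_val W w s b"
  shows "aruns \<Phi> W w (While b c) (n * Suc T + 1) (I n) s"
proof -
  have "aruns \<Phi> W w (While b c) (m * Suc T + 1) (I n) s" if "m \<le> n" "I (n - m) s" for m s
    using that
  proof (induction m arbitrary: s)
    case 0
    then show ?case
      using exec.WhileFalse[of W w s b c] assms(3)[of s] unfolding aruns_def
      by (intro exI[of _ 1] exI[of _ s]) simp
  next
    case (Suc m)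
    have i: "n - Suc m < n" "Suc (n - Suc m) = n - m" using Suc.prems by auto
    obtain t s1 where t: "exec W w c s t s1" "t + \<Phi> s \<le> T + \<Phi> s1" "I (n - m) s1" "test_val W w s b"
      using assms(2)[OF i(1) Suc.prems(2)] i unfolding aruns_def by auto
    obtain u s2 where u: "exec W w (While b c) s1 u s2" "u + \<Phi> s1 \<le> m * Suc T + 1 + \<Phi> s2" "I n s2"
      using Suc.IH[OF _ t(3)] Suc.prems unfolding aruns_def by auto
    show ?case
      unfolding aruns_def using exec.WhileTrue[OF t(4,1) u(1)] t u
      by (intro exI[of _ "Suc (t + u)"] exI[of _ s2]) simp
  qed
  from this[of n s] show ?thesis using assms(1) by simp
qed

lemma aruns_loop:
  assumes init: "I 0 (set_word v 0 0 s)"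
    and len: "\<And>k s. I k s \<Longrightarrow> word_val W s e = n"
    and body: "\<And>k s. k < n \<Longrightarrow> I k s \<Longrightarrow> words s v 0 = k \<Longrightarrow>
      aruns \<Phi> W w c T (\<lambda>s'. words s' v 0 = k \<and> I (Suc k) (set_word v 0 (Suc k) s')) s"
    and n: "n < 2 ^ W" and \<Phi>: "\<And>x s. \<Phi> (set_word v 0 x s) = \<Phi> s"
  shows "aruns \<Phi> W w (loop v e c) (n * (T + 2) + 2) (\<lambda>s. I n s \<and> words s v 0 = n) s"
proof -
  let ?I = "\<lambda>k (s::state). I k s \<and> words s v 0 = k"
  have o: "take_bit W (Suc 0) = Suc 0" if "0 < n"
    using n that by (cases W) auto
  have while: "aruns \<Phi> W w (While (Less (sc v) e) (Seq c (put v (addE (sc v) oneE))))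
      (n * Suc (T + 1) + 1) (?I n) (set_word v 0 0 s)"
  proof (rule aruns_While[where I = ?I])
    show "?I 0 (set_word v 0 0 s)" using init by (simp add: state_simps)
    show "\<not> test_val W w s (Less (sc v) e)" if "?I n s" for s
      using that len[of n s] by simp
    fix k s assume k: "k < n" and I: "?I k s"
    have "aruns \<Phi> W w (Seq c (put v (addE (sc v) oneE))) (T + 1) (?I (Suc k)) s"
    proof (rule aruns_Seq[OF body[OF k]])
      fix s' assume s': "words s' v 0 = k \<and> I (Suc k) (set_word v 0 (Suc k) s')"
      have "word_op W Add k (Suc 0) = Suc k"
        using k n by (subst word_add) auto
      then have "runs W w (put v (addE (sc v) oneE)) 1 (\<lambda>s''. ?I (Suc k) s'' \<and> \<Phi> s'' = \<Phi> s') s'"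
        using s' o k \<Phi> by (intro runs_flat) (simp_all add: state_simps)
      then have "aruns \<Phi> W w (put v (addE (sc v) oneE)) 1 (\<lambda>s''. ?I (Suc k) s'' \<and> \<Phi> s'' = \<Phi> s') s'"
        by (rule runs_aruns) simp
      then show "aruns \<Phi> W w (put v (addE (sc v) oneE)) 1 (?I (Suc k)) s'"
        unfolding aruns_def by blast
    qed (use I in auto)
    then show "test_val W w s (Less (sc v) e) \<and>
        aruns \<Phi> W w (Seq c (put v (addE (sc v) oneE))) (T + 1) (?I (Suc k)) s"
      using I k len[of k s] by simp
  qed
  have start: "aruns \<Phi> W w (put v (Const 0)) 1 (\<lambda>s'. s' = set_word v 0 0 s) s"
    by (rule runs_aruns[where U = 1], rule runs_put) (simp_all add: \<Phi>)
  have "aruns \<Phi> W w (loop v e c) (1 + (n * Suc (T + 1) + 1)) (?I n) s"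
    unfolding loop_def by (rule aruns_Seq[OF start]) (use while in blast)
  then show ?thesis by simp
qed

definition inR_test :: test where
  "inR_test = Both (Neg (Less (Word 5 (subE (sc 16) oneE)) (sc 15)))
     (Less (Word 5 (subE (sc 16) oneE)) (sc 16))"

definition inL_test :: test where
  "inL_test = Both (Neg (Less (Word 5 (sc 15)) (sc 15))) (Less (Word 5 (sc 15)) (sc 16))"

definition goleft_test :: test where
  "goleft_test = Both inR_test (Neg (Both inL_test
     (Less (subE (subE (sc 16) oneE) (Word 5 (subE (sc 16) oneE))) (subE (Word 5 (sc 15)) (sc 15)))))"

definition move_prog :: com where
  "move_prog = Cond goleft_test
     (Seq (Cond inL_test (SetWord 13 (addE (sc 15) oneE) (Const 0)) Skip) (put 15 (addE (sc 15) oneE)))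
     (Seq (Cond inR_test (SetWord 13 (addE (Word 5 (subE (sc 16) oneE)) oneE) (Const 0)) Skip)
       (put 16 (subE (sc 16) oneE)))"

definition write_prog :: com where
  "write_prog = Seq (SetWord 11 (sc 17) (sc 15)) (Seq (SetWord 12 (sc 17) (sc 16))
     (Cond (Both (Less (Const 0) (sc 15)) (Eq (Word 5 (subE (sc 15) oneE)) (sc 16)))
        (SetWord 13 (sc 15) (addE (sc 17) oneE)) Skip))"

definition bump_prog :: com where
  "bump_prog = put 17 (addE (sc 17) oneE)"

text \<open>The first test recognises a node: position 0, or one preceded by an opening parenthesis.
  At 0 the index \<open>x - 1\<close> wraps around, but the conjunct \<open>0 < x\<close> already
  decides the test.\<close>

definition top_prog :: com where
  "top_prog = Cond (Both (Neg (Both (Less (Const 0) (sc 14)) (Neg (Eq (Word 1 (subE (sc 14) oneE)) oneE))))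
       (Eq (Word 13 (sc 14)) (Const 0)))
     (Seq (Seq (put 15 (sc 14)) (Seq (Cond (Less (Const 0) (sc 14)) (put 16 (Word 5 (subE (sc 14) oneE)))
         (put 16 (sc 0))) write_prog))
       (Seq (While (Less (sc 15) (sc 16)) (Seq move_prog (Seq bump_prog write_prog))) bump_prog))
     Skip"

definition chain_prog :: com where
  "chain_prog = Seq (put 17 (Const 0)) (loop 14 (addE (sc 0) oneE) top_prog)"

context machine
begin

definition ready :: "state \<Rightarrow> bool" where
  "ready s \<longleftrightarrow> holds_input X Y s \<and> (\<forall>j<N. words s 5 j = mate X j)"

lemma ready_set [simp]:
  "5 < A \<Longrightarrow> ready (set_word A i v s) \<longleftrightarrow> ready s"
  by (simp add: ready_def state_simps)

lemma readyD:
  assumes "ready s"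
  shows "words s 0 0 = N" "words s 0 (Suc 0) = M" "j < N \<Longrightarrow> words s 5 j = mate X j"
    "j < N \<Longrightarrow> words s 1 j = of_bool (is_open (X ! j))" "j < N \<Longrightarrow> words s 2 j = lab (X ! j)"
    "j < M \<Longrightarrow> words s 3 j = of_bool (is_open (Y ! j))" "j < M \<Longrightarrow> words s 4 j = lab (Y ! j)"
  using assms by (auto simp: ready_def holds_input_def)

lemma small: "k \<le> N + M + 4 \<Longrightarrow> k < 2 ^ W"
  by (rule fits1) simp

lemma chain_tests:
  assumes s: "ready s" "words s 15 0 = l" "words s 16 0 = r" and lr: "l < r" "r \<le> N"
  shows "test_val W w s inR_test \<longleftrightarrow> FX.inR l r" "test_val W w s inL_test \<longleftrightarrow> FX.inL l r"
    "test_val W w s goleft_test \<longleftrightarrow> FX.goleft l r"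
proof -
  have b: "r < 2 ^ W" "mate X l < 2 ^ W" "l < N" "r - Suc 0 < N" "r - Suc 0 < 2 ^ W"
    using lr FX.mt_less[of l] by (auto intro!: small)
  show R: "test_val W w s inR_test \<longleftrightarrow> FX.inR l r" and L: "test_val W w s inL_test \<longleftrightarrow> FX.inL l r"
    using s lr b readyD(3)[OF s(1)] by (auto simp: inR_test_def inL_test_def FX.inR_def FX.inL_def word_simps)
  show "test_val W w s goleft_test \<longleftrightarrow> FX.goleft l r"
  proof (cases "FX.inR l r \<and> FX.inL l r")
    case True
    then have "mate X (r - Suc 0) \<le> r - Suc 0" "l \<le> mate X l" by (auto simp: FX.inR_def FX.inL_def)
    then show ?thesis
      using True R L s lr b readyD(3)[OF s(1)] by (auto simp: goleft_test_def FX.goleft_def word_simps)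
  qed (use R L in \<open>auto simp: goleft_test_def FX.goleft_def\<close>)
qed

lemma run_move:
  assumes s: "ready s" "words s 15 0 = l" "words s 16 0 = r" and lr: "l < r" "r \<le> N"
  defines "s' \<equiv> run W w move_prog s"
  shows "words s' 13 = FX.clear (words s 13) l r" "(words s' 15 0, words s' 16 0) = FX.nxt l r"
    "\<And>A. A \<notin> {13, 15, 16} \<Longrightarrow> words s' A = words s A" "reals s' = reals s" "ready s'"
proof -
  have rN: "r - Suc 0 < N" using lr by simp
  have b: "r < 2 ^ W" "Suc l < 2 ^ W" "l < N" "Suc (mate X (r - Suc 0)) < 2 ^ W"
    using lr FX.mt_less[OF rN] by (auto intro!: small)
  note t = chain_tests[OF s lr]
  show "words s' 13 = FX.clear (words s 13) l r" "(words s' 15 0, words s' 16 0) = FX.nxt l r"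
    "\<And>A. A \<notin> {13, 15, 16} \<Longrightarrow> words s' A = words s A" "reals s' = reals s" "ready s'"
    using s lr b rN readyD(3)[OF s(1)]
    by (auto simp: s'_def move_prog_def t FX.clear_def FX.nxt_def state_simps word_simps)
qed

lemma run_write:
  assumes s: "ready s" "words s 15 0 = l" "words s 16 0 = r" "words s 17 0 = q"
    and lr: "l \<le> N" and q: "Suc q < 2 ^ W"
  defines "s' \<equiv> run W w write_prog s"
  shows "words s' 11 = (words s 11)(q := l)" "words s' 12 = (words s 12)(q := r)"
    "words s' 13 = FX.mark (words s 13) q l r"
    "\<And>A. A \<notin> {11, 12, 13} \<Longrightarrow> words s' A = words s A" "reals s' = reals s" "ready s'"
proof -
  have b: "l < 2 ^ W" "0 < l \<Longrightarrow> l - Suc 0 < N" using lr by (auto intro!: small)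
  show "words s' 11 = (words s 11)(q := l)" "words s' 12 = (words s 12)(q := r)"
    "words s' 13 = FX.mark (words s 13) q l r"
    "\<And>A. A \<notin> {11, 12, 13} \<Longrightarrow> words s' A = words s A" "reals s' = reals s" "ready s'"
    using s lr b q readyD(3)[OF s(1), of "l - Suc 0"]
    by (auto simp: s'_def write_prog_def FX.mark_def state_simps word_simps)
qed

text \<open>A crude quadratic bound, at most \<open>N + 1\<close> starts of size at most
  \<open>N + 1\<close>; it keeps interval indices within a word while the list is being
  built.\<close>

lemma tops_bound:
  assumes "FX.tops x T TP" shows "T \<le> (N + 1) * (N + 1)"
proof -
  have t: "finite TP" "T = (\<Sum>u\<in>TP. FX.sz u)" "TP \<subseteq> {..N}" "\<And>u. u \<in> TP \<Longrightarrow> FX.node u"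
    using assms by (auto simp: FX.tops_def)
  have "FX.sz u \<le> N + 1" if "u \<in> TP" for u
    using FX.node_ie(2)[OF t(4)[OF that]] t(3) that by (auto simp: FX.sz_def)
  then have "T \<le> card TP * (N + 1)"
    unfolding t(2) using sum_bounded_above[of TP FX.sz "N + 1"] by simp
  also have "\<dots> \<le> (N + 1) * (N + 1)"
    using card_mono[OF _ t(3)] by (intro mult_le_mono) auto
  finally show ?thesis .
qed

lemma id_bound:
  assumes "FX.tops x T TP" "q \<le> T + N + 4" shows "q < 2 ^ W"
proof -
  have "Suc q \<le> (N + 1) * (N + 1) + N + 5" using tops_bound[OF assms(1)] assms(2) by simp
  also have "\<dots> \<le> 64 * (N + M + 4) ^ 2" by (simp add: power2_eq_square algebra_simps)
  finally show ?thesis using fits[of 2 "Suc q"] by simp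
qed

definition at_interval :: "nat \<Rightarrow> nat \<Rightarrow> nat set \<Rightarrow> nat \<Rightarrow> state \<Rightarrow> bool" where
  "at_interval x T TP q s \<longleftrightarrow> ready s \<and> FX.chain_inv x T TP q (words s 11) (words s 12) (words s 13) \<and>
     words s 17 0 = q \<and> words s 15 0 = words s 11 q \<and> words s 16 0 = words s 12 q \<and> words s 14 0 = x"

lemma chain_step:
  assumes I: "at_interval x T TP q s" and lt: "words s 11 q < words s 12 q"
  shows "runs W w (Seq move_prog (Seq bump_prog write_prog)) 20 (at_interval x T TP (Suc q)) s"
proof -
  let ?l = "words s 11 q" and ?r = "words s 12 q"
  have s: "ready s" "words s 15 0 = ?l" "words s 16 0 = ?r" and q: "words s 17 0 = q"
    and C: "FX.chain_inv x T TP q (words s 11) (words s 12) (words s 13)" and x: "words s 14 0 = x"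
    using I by (auto simp: at_interval_def)
  note D = FX.chain_invD[OF C]
  have rN: "?r \<le> N" using D(10) FX.node_ie(2)[OF D(1,2)] by simp
  have qb: "Suc (Suc q) < 2 ^ W"
    using D(11) FX.node_ie(2)[OF D(1,2)] by (intro id_bound[OF D(3)]) simp
  obtain l r where lr: "FX.nxt ?l ?r = (l, r)" by fastforce
  define s1 where "s1 = run W w move_prog s"
  note m = run_move[OF s lt rN, folded s1_def]
  define s2 where "s2 = set_word 17 0 (Suc q) s1"
  have s2: "run W w bump_prog s1 = s2"
    using m(3)[of 17] q qb by (simp add: bump_prog_def s2_def word_simps)
  have l: "l \<le> N" using lr lt rN by (auto simp: FX.nxt_def split: if_splits)
  have a: "ready s2" "words s2 15 0 = l" "words s2 16 0 = r" "words s2 17 0 = Suc q"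
    using m(2,5) lr by (auto simp: s2_def state_simps)
  note w = run_write[OF a l qb]
  have e: "words s2 11 = words s 11" "words s2 12 = words s 12" "words s2 14 = words s 14"
      "words s2 13 = FX.clear (words s 13) ?l ?r"
    using m(1,3) by (simp_all add: s2_def state_simps)
  have "at_interval x T TP (Suc q) (run W w write_prog s2)"
    unfolding at_interval_def
    using w a e x FX.chain_inv_step[OF C lt lr] by simp
  then show ?thesis
    by (intro runs_flat) (simp_all add: s2 s1_def[symmetric],
      simp_all add: move_prog_def bump_prog_def write_prog_def)
qed

definition listed_upto :: "nat \<Rightarrow> state \<Rightarrow> bool" where
  "listed_upto x s \<longleftrightarrow> ready s \<and> (\<exists>TP. FX.out_inv x (words s 17 0) TP (words s 11) (words s 12) (words s 13))"

lemma listed_upto_set [simp]: "listed_upto x (set_word 14 i v s) \<longleftrightarrow> listed_upto x s"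
  by (simp add: listed_upto_def state_simps)

text \<open>A chain of \<open>n + 1\<close> intervals takes at most \<open>21 * n + 20\<close>
  steps, covered by 30 per new interval. A skipped node takes at most 2 steps, covered by the fixed
  allowance of 30.\<close>

lemma runs_top:
  assumes I: "listed_upto x s" and x: "x \<le> N" "words s 14 0 = x"
  shows "aruns (\<lambda>s. 30 * words s 17 0) W w top_prog 30
    (\<lambda>s'. words s' 14 0 = x \<and> listed_upto (Suc x) s') s"
proof -
  obtain TP where O: "FX.out_inv x (words s 17 0) TP (words s 11) (words s 12) (words s 13)"
    and r: "ready s"
    using I by (auto simp: listed_upto_def)
  let ?b = "Both (Neg (Both (Less (Const 0) (sc 14)) (Neg (Eq (Word 1 (subE (sc 14) oneE)) oneE))))
       (Eq (Word 13 (sc 14)) (Const 0))"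
  have xb: "x < 2 ^ W" using x by (auto intro!: small)
  have test: "test_val W w s ?b \<longleftrightarrow> FX.node x \<and> words s 13 x = 0"
  proof (cases "x = 0")
    case False
    then have "x - Suc 0 < N" using x by simp
    then show ?thesis
      using False x xb readyD(4)[OF r, of "x - Suc 0"] is_open_iff_mate[OF X, of "x - Suc 0"]
      by (auto simp: FX.node_def word_simps)
  qed (use x in \<open>auto simp: FX.node_def\<close>)
  let ?T = "words s 17 0"
  show ?thesis
  proof (cases "FX.node x \<and> words s 13 x = 0")
    case False
    have "listed_upto (Suc x) s"
      using FX.out_inv_skip[OF O _ x(1)] False r unfolding listed_upto_def
      by (intro conjI exI[of _ TP]) auto
    then have "runs W w top_prog 2 (\<lambda>s'. s' = s) s"
      unfolding top_prog_def using test False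
      by (intro runs_mono[OF runs_Cond[of _ _ _ _ _ 1]] runs_flat) simp_all
    then have "aruns (\<lambda>s. 30 * words s 17 0) W w top_prog 30 (\<lambda>s'. s' = s) s"
      by (rule runs_aruns) simp
    then show ?thesis using \<open>listed_upto (Suc x) s\<close> x unfolding aruns_def by blast
  next
    case True
    define s1 where "s1 = set_word 16 0 (FX.ie x) (set_word 15 0 x s)"
    have s1: "run W w (Seq (put 15 (sc 14)) (Cond (Less (Const 0) (sc 14)) (put 16 (Word 5 (subE (sc 14) oneE)))
         (put 16 (sc 0)))) s = s1"
      using x xb readyD(1)[OF r] readyD(3)[OF r, of "x - Suc 0"]
      by (simp add: s1_def FX.ie_def state_simps word_simps)
    have a: "ready s1" "words s1 15 0 = x" "words s1 16 0 = FX.ie x" "words s1 17 0 = ?T"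
      using r by (simp_all add: s1_def state_simps)
    have t: "FX.tops x ?T TP" by (rule FX.out_invD(1)[OF O])
    have qb: "Suc ?T < 2 ^ W" by (rule id_bound[OF t]) simp
    note w = run_write[OF a x(1) qb]
    define s2 where "s2 = run W w write_prog s1"
    have e: "words s1 11 = words s 11" "words s1 12 = words s 12" "words s1 14 = words s 14"
        "words s1 13 = words s 13"
      by (simp_all add: s1_def state_simps)
    have 0: "at_interval x ?T TP ?T s2"
      unfolding at_interval_def s2_def
      using w a e x True FX.chain_inv_start[OF O _ _ x(1)] by simp
    let ?n = "FX.ie x - x"
    have W: "runs W w (While (Less (sc 15) (sc 16)) (Seq move_prog (Seq bump_prog write_prog)))
        (?n * Suc 20 + 1) (at_interval x ?T TP (?T + ?n)) s2"
    proof (rule runs_While_const[where I = "\<lambda>k. at_interval x ?T TP (?T + k)"])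
      show "at_interval x ?T TP (?T + 0) s2" using 0 by simp
      fix k s' assume k: "k < ?n" and A: "at_interval x ?T TP (?T + k) s'"
      have "words s' 11 (?T + k) < words s' 12 (?T + k)"
        using A k FX.chain_invD(9,11) unfolding at_interval_def by fastforce
      then show "test_val W w s' (Less (sc 15) (sc 16)) \<and>
          runs W w (Seq move_prog (Seq bump_prog write_prog)) 20 (at_interval x ?T TP (?T + Suc k)) s'"
        using chain_step[OF A] A by (simp add: at_interval_def)
    next
      fix s' assume A: "at_interval x ?T TP (?T + ?n) s'"
      then show "\<not> test_val W w s' (Less (sc 15) (sc 16))"
        using FX.chain_invD(9,11) unfolding at_interval_def by fastforce
    qed
    have "runs W w bump_prog 1 (\<lambda>s''. words s'' 14 0 = x \<and> listed_upto (Suc x) s'' \<and>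
        words s'' 17 0 = Suc (?T + ?n)) s'"
      if A: "at_interval x ?T TP (?T + ?n) s'" for s'
    proof -
      have C: "FX.chain_inv x ?T TP (?T + ?n) (words s' 11) (words s' 12) (words s' 13)"
        using A by (simp add: at_interval_def)
      have eq: "words s' 11 (?T + ?n) = words s' 12 (?T + ?n)"
        using FX.chain_invD(9,11)[OF C] by simp
      have b: "Suc (?T + ?n) < 2 ^ W"
        using FX.node_ie(2)[OF conjunct1[OF True] x(1)] by (intro id_bound[OF t]) simp
      show ?thesis
        unfolding bump_prog_def
        by (rule runs_put) (use A b FX.chain_inv_end[OF C eq] in
          \<open>auto simp: at_interval_def listed_upto_def state_simps word_simps\<close>)
    qed
    note B = this
    have "runs W w top_prog (?n * 21 + 20) (\<lambda>s''. words s'' 14 0 = x \<and> listed_upto (Suc x) s'' \<and>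
        words s'' 17 0 = Suc (?T + ?n)) s"
      unfolding top_prog_def
    proof (rule runs_mono[OF runs_Cond[where T = "?n * 21 + 19"]])
      assume "test_val W w s ?b"
      show "runs W w (Seq (Seq (put 15 (sc 14)) (Seq (Cond (Less (Const 0) (sc 14))
          (put 16 (Word 5 (subE (sc 14) oneE))) (put 16 (sc 0))) write_prog))
          (Seq (While (Less (sc 15) (sc 16)) (Seq move_prog (Seq bump_prog write_prog))) bump_prog))
          (?n * 21 + 19) (\<lambda>s''. words s'' 14 0 = x \<and> listed_upto (Suc x) s'' \<and>
            words s'' 17 0 = Suc (?T + ?n)) s"
      proof (rule runs_then[where T = 10 and P = "\<lambda>s. s = s2"])
        show "runs W w (Seq (put 15 (sc 14)) (Seq (Cond (Less (Const 0) (sc 14))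
          (put 16 (Word 5 (subE (sc 14) oneE))) (put 16 (sc 0))) write_prog)) 10 (\<lambda>s. s = s2) s"
          by (rule runs_flat) (use s1 in \<open>simp_all add: s2_def\<close>, simp_all add: write_prog_def)
        fix s' assume "s' = s2"
        then show "runs W w (Seq (While (Less (sc 15) (sc 16)) (Seq move_prog (Seq bump_prog write_prog)))
            bump_prog) (?n * 21 + 2) (\<lambda>s''. words s'' 14 0 = x \<and> listed_upto (Suc x) s'' \<and>
            words s'' 17 0 = Suc (?T + ?n)) s'"
          by (intro runs_then[OF _ B]) (use W in auto)
      qed simp
    qed (use test True in auto)
    then have "aruns (\<lambda>s. 30 * words s 17 0) W w top_prog 30 (\<lambda>s''. words s'' 14 0 = x \<and>
        listed_upto (Suc x) s'' \<and> words s'' 17 0 = Suc (?T + ?n)) s"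
      by (rule runs_aruns) auto
    then show ?thesis unfolding aruns_def by blast
  qed
qed

text \<open>The count starts at 0, so the final potential, bounded by \<open>tops_log\<close>,
  bounds the time beyond the allowance per node.\<close>

lemma runs_chain_prog:
  assumes s: "ready s" "words s 13 = (\<lambda>_. 0)" and m: "N + 1 < 2 ^ m"
  shows "runs W w chain_prog (32 * (N + 1) + 3 + 30 * ((N + 1) * m))
    (\<lambda>s. ready s \<and> words s 17 0 \<le> (N + 1) * m \<and> words s 17 0 \<le> (N + 1) * (N + 1) \<and>
      FX.family (words s 17 0) (words s 11) (words s 12) (words s 13)) s"
proof -
  let ?\<Phi> = "\<lambda>s :: state. 30 * words s 17 0"
  have L: "aruns ?\<Phi> W w (loop 14 (addE (sc 0) oneE) top_prog) ((N + 1) * (30 + 2) + 2)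
      (\<lambda>s. listed_upto (N + 1) s \<and> words s 14 0 = N + 1) s" if "listed_upto 0 s" for s
  proof (rule aruns_loop)
    have "N + 1 < 2 ^ W" by (rule small) simp
    then show "word_val W s (addE (sc 0) oneE) = N + 1" if "listed_upto k s" for k s
      using that readyD(1)[of s] by (simp add: listed_upto_def word_simps)
    show "N + 1 < 2 ^ W" by fact
    show "?\<Phi> (set_word 14 0 x s) = ?\<Phi> s" for x s by (simp add: state_simps)
    fix k s assume "k < N + 1" "listed_upto k s" "words s 14 0 = k"
    then show "aruns ?\<Phi> W w top_prog 30
        (\<lambda>s'. words s' 14 0 = k \<and> listed_upto (Suc k) (set_word 14 0 (Suc k) s')) s"
      using runs_top[of k s] by simp
  qed (use that in simp)
  have fin: "words s 17 0 \<le> (N + 1) * m \<and> words s 17 0 \<le> (N + 1) * (N + 1) \<and>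
      FX.family (words s 17 0) (words s 11) (words s 12) (words s 13)"
    if "listed_upto (N + 1) s" for s
  proof -
    obtain TP where O: "FX.out_inv (Suc N) (words s 17 0) TP (words s 11) (words s 12) (words s 13)"
      using \<open>listed_upto (N + 1) s\<close> by (auto simp: listed_upto_def)
    show ?thesis
      using FX.tops_log[OF FX.out_invD(1)[OF O] m] tops_bound[OF FX.out_invD(1)[OF O]]
        FX.out_inv_family[OF O] by simp
  qed
  have i: "listed_upto 0 (set_word 17 0 0 s)"
    using s FX.out_inv_init by (auto simp: listed_upto_def state_simps)
  show ?thesis
    unfolding chain_prog_def
  proof (rule runs_then[where T = 1 and P = "\<lambda>s'. s' = set_word 17 0 0 s"])
    fix s' assume s': "s' = set_word 17 0 0 s"
    have "runs W w (loop 14 (addE (sc 0) oneE) top_prog) (32 * (N + 1) + 2 + 30 * ((N + 1) * m))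
        (\<lambda>s. listed_upto (N + 1) s \<and> words s 14 0 = N + 1) s'"
    proof (rule aruns_runs[OF L])
      show "listed_upto 0 s'" using i s' by simp
      fix s'' assume "listed_upto (N + 1) s'' \<and> words s'' 14 0 = N + 1"
      then have "words s'' 17 0 \<le> (N + 1) * m" using fin by blast
      moreover have "(N + 1) * (30 + 2) + 2 + 30 * a \<le> 32 * (N + 1) + 2 + 30 * b + c"
        if "a \<le> b" for a b c :: nat
        using that by simp
      ultimately show "(N + 1) * (30 + 2) + 2 + ?\<Phi> s'' \<le> 32 * (N + 1) + 2 + 30 * ((N + 1) * m) + ?\<Phi> s'"
        by blast
    qed
    then show "runs W w (loop 14 (addE (sc 0) oneE) top_prog) (32 * (N + 1) + 2 + 30 * ((N + 1) * m))
        (\<lambda>s. ready s \<and> words s 17 0 \<le> (N + 1) * m \<and> words s 17 0 \<le> (N + 1) * (N + 1) \<and>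
          FX.family (words s 17 0) (words s 11) (words s 12) (words s 13)) s'"
      by (rule runs_mono) (use fin in \<open>auto simp: listed_upto_def\<close>)
  qed (auto intro: runs_put)
qed

end

section \<open>The banded dynamic program\<close>

text \<open>A number in mixed radix: the interval index followed by two digits below
  \<open>2 * H + 1\<close>, the distances of the ends \<open>a\<close>, \<open>b\<close> from the
  ends of the interval of \<open>F\<close>, shifted by \<open>H\<close> to be nonnegative.\<close>

definition look :: "word_exp \<Rightarrow> word_exp \<Rightarrow> word_exp \<Rightarrow> word_exp" where
  "look i a b = addE (mulE (addE (mulE i (sc 20)) (subE (addE a (sc 19)) (Word 11 i))) (sc 20))
     (subE (addE b (sc 19)) (Word 12 i))"

definition band_test :: "word_exp \<Rightarrow> word_exp \<Rightarrow> test" where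
  "band_test x y = Both (Neg (Less (addE y (sc 19)) x)) (Neg (Less (addE x (sc 19)) y))"

definition relax_prog :: "test \<Rightarrow> real_exp \<Rightarrow> com" where
  "relax_prog g e = Cond (Both g (RLess e (Real 2 (Const 0)))) (SetReal 2 (Const 0) e) Skip"

fun relaxes_prog :: "(test \<times> real_exp) list \<Rightarrow> com" where
  "relaxes_prog [] = Skip"
| "relaxes_prog ((g, e) # xs) = Seq (relax_prog g e) (relaxes_prog xs)"

lemma flat_relaxes_prog: "flat (relaxes_prog xs)"
  by (induction xs rule: relaxes_prog.induct) (auto simp: relax_prog_def)

lemma set_real_twice [simp]: "set_real v i x (set_real v i y s) = set_real v i x s"
  by (simp add: set_real_def)

lemma run_relaxes_prog:
  assumes "\<And>g e v. (g, e) \<in> set xs \<Longrightarrow> test_val W w (set_real 2 0 v s) g = test_val W w s g \<and>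
    real_val W w (set_real 2 0 v s) e = real_val W w s e"
  shows "run W w (relaxes_prog xs) (set_real 2 0 b s) =
    set_real 2 0 (relaxes (map (\<lambda>(g, e). (test_val W w s g, real_val W w s e)) xs) b) s"
  using assms
proof (induction xs arbitrary: b rule: relaxes_prog.induct)
  case (2 g e xs)
  have "run W w (relax_prog g e) (set_real 2 0 b s) =
      set_real 2 0 (relax (test_val W w s g) (real_val W w s e) b) s"
    using 2(2)[of g e] by (auto simp: relax_prog_def relax_def reals_set_real)
  moreover have "run W w (relaxes_prog xs) (set_real 2 0 c s) =
      set_real 2 0 (relaxes (map (\<lambda>(g, e). (test_val W w s g, real_val W w s e)) xs) c) s" for c
    by (rule 2(1), rule 2(2)) simp
  ultimately show ?case by simp
qed simp

lemma relaxes_cong: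
  "list_all2 (\<lambda>(g, v) (h, u). g = h \<and> (h \<longrightarrow> v = u)) xs ys \<Longrightarrow> relaxes xs b = relaxes ys b"
proof (induction arbitrary: b rule: list_all2_induct)
  case (Cons x xs y ys)
  obtain g v h u where e: "x = (g, v)" "y = (h, u)" by fastforce
  with Cons(1) have "relax g v b = relax h u b" by (auto simp: relax_def)
  then show ?case using Cons(3) e by simp
qed simp

definition bothE :: "test list \<Rightarrow> test" where
  "bothE ts = foldr Both ts (Eq (Const 0) (Const 0))"

lemma test_bothE [simp]: "test_val W w s (bothE ts) \<longleftrightarrow> (\<forall>t\<in>set ts. test_val W w s t)"
  by (induction ts) (auto simp: bothE_def)

definition left_test :: test where "left_test = Both (Less (sc 27) (sc 28)) (Neg (Eq (sc 29) (sc 27)))"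
definition right_test :: test where "right_test = Both (Less (sc 27) (sc 28)) (Eq (sc 29) (sc 27))"

definition inner_test :: test where
  "inner_test = bothE [left_test, Neg (Less (sc 30) (sc 27)), Less (sc 30) (sc 28),
     Less (sc 24) (sc 25), Neg (Less (sc 32) (sc 24)), Less (sc 32) (sc 25), band_test (sc 30) (sc 32)]"

abbreviation entry :: "word_exp \<Rightarrow> word_exp \<Rightarrow> word_exp \<Rightarrow> real_exp" where
  "entry i a b \<equiv> Real 1 (look i a b)"

abbreviation "inner_id x \<equiv> subE (Word 13 x) oneE"
abbreviation "next_id \<equiv> addE (sc 26) oneE"
abbreviation "l_next \<equiv> addE (sc 27) oneE"
abbreviation "r_prev \<equiv> subE (sc 28) oneE"
abbreviation "l'_next \<equiv> addE (sc 24) oneE"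
abbreviation "r'_prev \<equiv> subE (sc 25) oneE"

text \<open>One entry for each element of \<open>candidates\<close>, in the same order, so that the
  two lists can be compared elementwise.\<close>

definition cand_progs :: "(test \<times> real_exp) list" where
  "cand_progs =
    [(Both (Eq (sc 27) (sc 28)) (Eq (sc 24) (sc 25)), RConst 0),
     (Both (Less (sc 24) (sc 25)) (band_test (sc 27) l'_next),
      RAdd (entry (sc 26) l'_next (sc 25)) (half None (Some (Word 4 (sc 24))))),
     (Both (Less (sc 24) (sc 25)) (band_test (sc 28) r'_prev),
      RAdd (entry (sc 26) (sc 24) r'_prev) (half None (Some (Word 4 r'_prev)))),
     (Both left_test (band_test l_next (sc 24)),
      RAdd (entry next_id (sc 24) (sc 25)) (half (Some (Word 2 (sc 27))) None)),
     (Both right_test (band_test r_prev (sc 25)),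
      RAdd (entry next_id (sc 24) (sc 25)) (half (Some (Word 2 r_prev)) None)),
     (Both inner_test (Both (Eq (sc 30) r_prev) (Eq (sc 32) r'_prev)),
      RAdd (entry (inner_id l_next) l'_next (sc 32)) (Oracle (Some (Word 2 (sc 27))) (Some (Word 4 (sc 24))))),
     (Both inner_test (Neg (Eq (sc 30) r_prev)),
      RAdd (RAdd (entry (inner_id l_next) l'_next (sc 32))
          (entry (addE (sc 26) (subE (addE (sc 30) oneE) (sc 27))) (addE (sc 32) oneE) (sc 25)))
        (Oracle (Some (Word 2 (sc 27))) (Some (Word 4 (sc 24))))),
     (bothE [right_test, Neg (Less (sc 31) (sc 27)), Less (sc 31) (sc 28), Less (sc 24) (sc 25),
        Neg (Less (sc 33) (sc 24)), Less (sc 33) (sc 25), band_test (sc 31) (sc 33)],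
      RAdd (RAdd (entry (inner_id (addE (sc 31) oneE)) (addE (sc 33) oneE) r'_prev)
          (entry (addE (sc 26) (subE (sc 28) (sc 31))) (sc 24) (sc 33)))
        (Oracle (Some (Word 2 (sc 31))) (Some (Word 4 (sc 33)))))]"

definition cell_prog :: com where
  "cell_prog = Seq (put 32 (Word 6 (sc 24))) (Seq (put 33 (Word 6 r'_prev))
     (Seq (SetReal 2 (Const 0) (Real 3 (Const 0))) (Seq (relaxes_prog cand_progs)
       (SetReal 1 (look (sc 26) (sc 24) (sc 25)) (Real 2 (Const 0))))))"

text \<open>Compares ends still shifted by \<open>H\<close>: only after the first test is
  subtracting \<open>H\<close> free of wraparound.\<close>

definition column_test :: test where
  "column_test = bothE [Neg (Less (sc 35) (sc 19)), Neg (Less (sc 36) (sc 35)),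
     Neg (Less (addE (Word 0 oneE) (sc 19)) (sc 36))]"

definition column_prog :: com where
  "column_prog = Seq (put 35 (addE (sc 27) (sc 34))) (Seq (put 36 (addE (sc 28) (sc 23)))
     (Cond column_test
       (Seq (put 24 (subE (sc 35) (sc 19))) (Seq (put 25 (subE (sc 36) (sc 19))) cell_prog))
       Skip))"

definition row_prog :: com where
  "row_prog = Seq (put 34 (subE (subE (sc 20) oneE) (sc 22))) (loop 23 (sc 20) column_prog)"

text \<open>Round \<open>k\<close> treats interval \<open>T - 1 - k\<close>, the reverse of the
  listing order. Neighbours and mates read for an empty interval are arbitrary, but there the guards
  that use them are false.\<close>

definition load_prog :: com where
  "load_prog = Seq (put 26 (subE (subE (sc 17) oneE) (sc 21))) (Seq (put 27 (Word 11 (sc 26)))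
     (Seq (put 28 (Word 12 (sc 26))) (Seq (put 29 (Word 11 next_id))
       (Seq (put 30 (Word 5 (sc 27))) (put 31 (Word 5 r_prev))))))"

definition table_prog :: com where
  "table_prog = loop 21 (sc 17) (Seq load_prog (loop 22 (sc 20) row_prog))"

section \<open>Layout of the table in memory\<close>

locale tables = machine w X Y W + cells w X Y M0 H T Lf Rt IN
  for w :: "nat weight" and X Y W M0 H T Lf Rt IN +
  assumes H: "H \<le> 4 * (N + M)" and T: "T \<le> (N + 1) * (N + 1)"
begin

definition ix :: "nat \<Rightarrow> nat \<Rightarrow> nat \<Rightarrow> nat" where
  "ix i a b = (i * (2 * H + 1) + (a + H - Lf i)) * (2 * H + 1) + (b + H - Rt i)"

definition static :: "state \<Rightarrow> bool" where
  "static s \<longleftrightarrow> ready s \<and> (\<forall>j<M. words s 6 j = mate Y j) \<and> words s 11 = Lf \<and> words s 12 = Rt \<and>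
     words s 13 = IN \<and> words s 17 0 = T \<and> words s 19 0 = H \<and> words s 20 0 = 2 * H + 1 \<and> reals s 3 0 = M0"

lemma static_set [simp]:
  "20 < A \<Longrightarrow> static (set_word A i v s) \<longleftrightarrow> static s"
  "A' \<noteq> 3 \<Longrightarrow> static (set_real A' i x s) \<longleftrightarrow> static s"
  by (simp_all add: static_def state_simps ready_def)

lemma wide: "k < T + 20 * (N + M + 1) \<Longrightarrow> k < 2 ^ W"
proof -
  assume k: "k < T + 20 * (N + M + 1)"
  have "(N + 1) * (N + 1) + 20 * (N + M + 1) \<le> 64 * (N + M + 4) ^ 2"
    by (simp add: power2_eq_square algebra_simps)
  then show ?thesis using fits[of 2 "Suc k"] k T by simp
qed

lemma digit_pair:
  fixes a b c d B :: nat
  assumes "b < B" "d < B" "a * B + b = c * B + d"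
  shows "a = c \<and> b = d"
proof -
  have "(a * B + b) div B = a" "(c * B + d) div B = c" using assms(1,2) by simp_all
  then have "a = c" using assms(3) by metis
  then show ?thesis using assms(3) by simp
qed

lemma offsets:
  assumes "cell i a b"
  shows "Lf i \<le> a + H" "a + H - Lf i < 2 * H + 1" "Rt i \<le> b + H" "b + H - Rt i < 2 * H + 1"
    "Rt i \<le> N" "Lf i \<le> N" "a \<le> M" "b \<le> M" "i < T"
proof -
  have "i < T" using assms by (simp add: cell_def)
  then show "Rt i \<le> N" "Lf i \<le> N" using FX.familyD(4,5)[OF F, of i] by auto
  show "Lf i \<le> a + H" "a + H - Lf i < 2 * H + 1" "Rt i \<le> b + H" "b + H - Rt i < 2 * H + 1"
    "a \<le> M" "b \<le> M" "i < T"
    using assms by (auto simp: cell_def band_def)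
qed

lemma ix_inj:
  assumes "cell i a b" "cell j c d" "ix i a b = ix j c d"
  shows "i = j \<and> a = c \<and> b = d"
proof -
  note o = offsets[OF assms(1)] offsets[OF assms(2)]
  have 1: "i * (2 * H + 1) + (a + H - Lf i) = j * (2 * H + 1) + (c + H - Lf j) \<and>
      b + H - Rt i = d + H - Rt j"
    by (rule digit_pair[OF o(4) o(13)]) (use assms(3) in \<open>simp add: ix_def\<close>)
  then have "i = j \<and> a + H - Lf i = c + H - Lf j"
    by (intro digit_pair[OF o(2) o(11)]) simp
  with 1 show ?thesis using o(1,3,10,12) by (simp add: eq_diff_iff)
qed

text \<open>With \<open>?n\<close> for \<open>N + M + 4\<close> one has
  \<open>T \<le> ?n ^ 2\<close> and \<open>?B \<le> 8 * ?n\<close>, so the table has at most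
  \<open>64 * ?n ^ 4\<close> entries. Intermediate results of the address computation are no larger
  than the address.\<close>

lemma ix_bounds:
  assumes "cell i a b"
  shows "i * (2 * H + 1) < 2 ^ W" "i * (2 * H + 1) + (a + H - Lf i) < 2 ^ W"
    "(i * (2 * H + 1) + (a + H - Lf i)) * (2 * H + 1) < 2 ^ W" "ix i a b < 2 ^ W"
proof -
  note o = offsets[OF assms]
  let ?B = "2 * H + 1" and ?n = "N + M + 4"
  have B: "?B \<le> 8 * ?n" using H by simp
  have 1: "i * ?B + (a + H - Lf i) < T * ?B"
  proof -
    have "i * ?B + (a + H - Lf i) < Suc i * ?B" using o(2) by simp
    also have "\<dots> \<le> T * ?B" using o(9) by (intro mult_le_mono1) simp
    finally show ?thesis .
  qed
  have 2: "ix i a b < T * ?B * ?B"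
  proof -
    have "ix i a b < Suc (i * ?B + (a + H - Lf i)) * ?B" using o(4) by (simp add: ix_def)
    also have "\<dots> \<le> T * ?B * ?B" using 1 by (intro mult_le_mono1) simp
    finally show ?thesis .
  qed
  have "T \<le> ?n ^ 2"
    using T mult_le_mono[of "N + 1" ?n "N + 1" ?n] by (simp add: power2_eq_square)
  then have "T * ?B * ?B \<le> ?n ^ 2 * (8 * ?n) * (8 * ?n)"
    using B by (intro mult_le_mono) auto
  also have "k ^ 2 * (8 * k) * (8 * k) = 64 * k ^ 4" for k :: nat
    by (simp add: power2_eq_square power4_eq_xxxx)
  finally have "T * ?B * ?B \<le> 2 ^ W" using fits[of 4] by simp
  with 2 show 3: "ix i a b < 2 ^ W" by simp
  show 4: "(i * ?B + (a + H - Lf i)) * ?B < 2 ^ W"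
    by (rule le_less_trans[OF _ 3]) (simp add: ix_def)
  show 5: "i * ?B + (a + H - Lf i) < 2 ^ W"
    by (rule le_less_trans[OF _ 4]) simp
  show "i * ?B < 2 ^ W"
    by (rule le_less_trans[OF _ 5]) simp
qed

lemma look_val:
  assumes "static s" "word_val W s ie = i" "word_val W s ae = a" "word_val W s be = b" "cell i a b"
  shows "word_val W s (look ie ae be) = ix i a b"
proof -
  note o = offsets[OF assms(5)] and x = ix_bounds[OF assms(5)]
  have b: "a + H < 2 ^ W" "b + H < 2 ^ W" using o H by (auto intro!: wide)
  show ?thesis
    using assms(1-4) o x b unfolding static_def look_def
    by (simp add: word_simps word_mul ix_def)
qed

lemma band_val:
  assumes "static s" "word_val W s xe = x" "word_val W s ye = y" "x \<le> N + 1" "y \<le> M + 1"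
  shows "test_val W w s (band_test xe ye) \<longleftrightarrow> band H (x, y)"
proof -
  have b: "x + H < 2 ^ W" "y + H < 2 ^ W" using assms H by (auto intro!: wide)
  show ?thesis
    using assms(1-3) b unfolding static_def band_test_def
    by (auto simp: word_simps band_def not_less)
qed

definition good :: "state \<Rightarrow> nat \<Rightarrow> nat \<Rightarrow> nat \<Rightarrow> bool" where
  "good s i a b \<longleftrightarrow> ok i a b (reals s 1 (ix i a b))"

definition loaded :: "nat \<Rightarrow> state \<Rightarrow> bool" where
  "loaded i s \<longleftrightarrow> static s \<and> i < T \<and> words s 26 0 = i \<and> words s 27 0 = Lf i \<and> words s 28 0 = Rt i \<and>
     (Lf i < Rt i \<longrightarrow> words s 29 0 = Lf (Suc i) \<and> words s 30 0 = mate X (Lf i) \<and>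
        words s 31 0 = mate X (Rt i - 1)) \<and>
     (\<forall>j a b. i < j \<longrightarrow> cell j a b \<longrightarrow> good s j a b)"

text \<open>Guards are compared always, values only under a true guard: otherwise the word
  arithmetic may wrap around and address a foreign entry.\<close>

lemma cands_val:
  assumes c: "cell i a b" and L: "loaded i s" and ab: "words s 24 0 = a" "words s 25 0 = b"
    and p: "a < b \<Longrightarrow> words s 32 0 = mate Y a" "a < b \<Longrightarrow> words s 33 0 = mate Y (b - 1)"
  shows "list_all2 (\<lambda>(g, v) (h, u). g = h \<and> (h \<longrightarrow> v = u))
    (map (\<lambda>(g, e). (test_val W w s g, real_val W w s e)) cand_progs)
    (candidates (\<lambda>i a b. reals s 1 (ix i a b)) i a b)"
proof -
  let ?l = "Lf i" and ?r = "Rt i" and ?V = "\<lambda>i a b. reals s 1 (ix i a b)"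
  let ?p = "mate X ?l" and ?q = "mate X (?r - 1)" and ?p' = "mate Y a" and ?q' = "mate Y (b - 1)"
  note o = offsets[OF c]
  have st: "static s" and rd: "ready s" and ids: "words s 26 0 = i" "words s 27 0 = ?l" "words s 28 0 = ?r"
    "words s 13 = IN"
    and F': "?l < ?r \<Longrightarrow> words s 29 0 = Lf (Suc i)" "?l < ?r \<Longrightarrow> words s 30 0 = ?p"
      "?l < ?r \<Longrightarrow> words s 31 0 = ?q"
    using L by (auto simp: loaded_def static_def)
  have lr: "?l \<le> ?r" "?r \<le> N" using FX.familyD(4,5)[OF F o(9)] by auto
  have ab': "a \<le> b" "b \<le> M" using c by (auto simp: cell_def)
  have sm: "Suc i < 2 ^ W" "Suc ?l < 2 ^ W" "?r < 2 ^ W" "Suc a < 2 ^ W" "b < 2 ^ W"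
    using o by (auto intro!: wide)
  have pl: "?l < ?r \<Longrightarrow> ?p < N" "?l < ?r \<Longrightarrow> ?q < N" "a < b \<Longrightarrow> ?p' < M" "a < b \<Longrightarrow> ?q' < M"
    using FX.mt_less[of ?l] FX.mt_less[of "?r - 1"] GY.mt_less[of a] GY.mt_less[of "b - 1"] lr ab' by auto
  have nx: "word_val W s next_id = Suc i" "word_val W s l_next = Suc ?l" "word_val W s l'_next = Suc a"
    "word_val W s (sc 26) = i" "word_val W s (sc 27) = ?l" "word_val W s (sc 28) = ?r"
    "word_val W s (sc 24) = a" "word_val W s (sc 25) = b"
    using ids ab sm by (simp_all add: word_simps)
  have rp: "?l < ?r \<Longrightarrow> word_val W s r_prev = ?r - 1" "a < b \<Longrightarrow> word_val W s r'_prev = b - 1"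
    using ids ab sm by (simp_all add: word_simps)
  have lt: "test_val W w s left_test \<longleftrightarrow> ?l < ?r \<and> Lf (Suc i) \<noteq> ?l"
    "test_val W w s right_test \<longleftrightarrow> ?l < ?r \<and> Lf (Suc i) = ?l"
    using ids F' by (auto simp: left_test_def right_test_def)
  have gl: "Lf (Suc i) \<noteq> ?l \<longleftrightarrow> FX.goleft ?l ?r" if "?l < ?r" using next_left(1)[OF c that] .
  have it: "test_val W w s inner_test \<longleftrightarrow> (?l < ?r \<and> Lf (Suc i) \<noteq> ?l) \<and> FX.inL ?l ?r \<and> a < b \<and>
      a \<le> ?p' \<and> ?p' < b \<and> band H (?p, ?p')"
  proof (cases "?l < ?r \<and> a < b")
    case True
    then have "test_val W w s (band_test (sc 30) (sc 32)) \<longleftrightarrow> band H (?p, ?p')"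
      using F' p pl by (intro band_val[OF st]) auto
    then show ?thesis
      using True ids ab F' p lt by (auto simp: inner_test_def FX.inL_def)
  qed (use lt ab in \<open>auto simp: inner_test_def\<close>)
  have rt: "test_val W w s (bothE [right_test, Neg (Less (sc 31) (sc 27)), Less (sc 31) (sc 28),
      Less (sc 24) (sc 25), Neg (Less (sc 33) (sc 24)), Less (sc 33) (sc 25), band_test (sc 31) (sc 33)])
      \<longleftrightarrow> (?l < ?r \<and> Lf (Suc i) = ?l) \<and> FX.inR ?l ?r \<and> a < b \<and> a \<le> ?q' \<and> ?q' < b \<and> band H (?q, ?q')"
  proof (cases "?l < ?r \<and> a < b")
    case True
    then have "test_val W w s (band_test (sc 31) (sc 33)) \<longleftrightarrow> band H (?q, ?q')"
      using F' p pl by (intro band_val[OF st]) auto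
    then show ?thesis
      using True ids ab F' p lt by (auto simp: FX.inR_def)
  qed (use lt ab in auto)
  have lookV: "reals s 1 (word_val W s (look ie ae be)) = ?V j x y"
    if "word_val W s ie = j" "word_val W s ae = x" "word_val W s be = y" "cell j x y" for ie ae be j x y
    using look_val[OF st that] by simp
  have g2: "test_val W w s (band_test (sc 27) l'_next) \<longleftrightarrow> band H (?l, Suc a)"
    by (rule band_val[OF st nx(5,3)]) (use o in auto)
  have v2: "real_val W w s (RAdd (entry (sc 26) l'_next (sc 25)) (half None (Some (Word 4 (sc 24))))) =
      ?V i (Suc a) b + ins a" if "a < b" "band H (?l, Suc a)"
    using lookV[OF nx(4,3,8) cell_insL[OF c that]] ab that ab' readyD(7)[OF rd, of a]
    by (simp add: of_rat_divide)
  have g3: "test_val W w s (band_test (sc 28) r'_prev) \<longleftrightarrow> band H (?r, b - 1)" if "a < b"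
    by (rule band_val[OF st nx(6) rp(2)[OF that]]) (use o in auto)
  have v3: "real_val W w s (RAdd (entry (sc 26) (sc 24) r'_prev) (half None (Some (Word 4 r'_prev)))) =
      ?V i a (b - 1) + ins (b - 1)" if "a < b" "band H (?r, b - 1)"
  proof -
    have "word_val W s (Word 4 r'_prev) = lab (Y ! (b - 1))"
      using rp(2)[OF that(1)] readyD(7)[OF rd, of "b - 1"] that ab' by simp
    then show ?thesis
      using lookV[OF nx(4,7) rp(2)[OF that(1)] cell_insR[OF c that]] by (simp add: of_rat_divide)
  qed
  have g4: "test_val W w s (band_test l_next (sc 24)) \<longleftrightarrow> band H (Suc ?l, a)"
    by (rule band_val[OF st nx(2,7)]) (use o in auto)
  have v4: "real_val W w s (RAdd (entry next_id (sc 24) (sc 25)) (half (Some (Word 2 (sc 27))) None)) =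
      ?V (Suc i) a b + del ?l" if "?l < ?r" "Lf (Suc i) \<noteq> ?l" "band H (Suc ?l, a)"
    using lookV[OF nx(1,7,8) cell_delL[OF c that(1) _ that(3)]] gl that lr readyD(5)[OF rd, of ?l] nx(5)
    by (simp add: of_rat_divide)
  have g5: "test_val W w s (band_test r_prev (sc 25)) \<longleftrightarrow> band H (?r - 1, b)" if "?l < ?r"
    by (rule band_val[OF st rp(1)[OF that] nx(8)]) (use o in auto)
  have v5: "real_val W w s (RAdd (entry next_id (sc 24) (sc 25)) (half (Some (Word 2 r_prev)) None)) =
      ?V (Suc i) a b + del (?r - 1)" if "?l < ?r" "Lf (Suc i) = ?l" "band H (?r - 1, b)"
  proof -
    have "word_val W s (Word 2 r_prev) = lab (X ! (?r - 1))"
      using rp(1)[OF that(1)] readyD(5)[OF rd, of "?r - 1"] that lr by simp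
    then show ?thesis
      using lookV[OF nx(1,7,8) cell_delR[OF c that(1) _ that(3)]] gl that by (simp add: of_rat_divide)
  qed
  have left_val: "real_val W w s (entry (inner_id l_next) l'_next (sc 32)) = ?V (IN (Suc ?l) - 1) (Suc a) ?p'"
      "real_val W w s (Oracle (Some (Word 2 (sc 27))) (Some (Word 4 (sc 24)))) = sub ?l a"
    if t: "?l < ?r" "Lf (Suc i) \<noteq> ?l" "FX.inL ?l ?r" "a < b" "a \<le> ?p'" "?p' < b" "band H (?p, ?p')"
  proof -
    have g: "FX.goleft ?l ?r" using gl t by blast
    have "IN (Suc ?l) - 1 < T" "0 < IN (Suc ?l)" using inner_left(1,2)[OF c t(1) g t(3)] by auto
    then have b: "word_val W s (inner_id l_next) = IN (Suc ?l) - 1"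
      using wide[of "IN (Suc ?l)"] nx(2) ids by (simp add: word_simps)
    have "word_val W s (sc 32) = ?p'" using p t by simp
    from lookV[OF b nx(3) this cell_inner_left[OF c t(1) g t(3-7)]]
    show "real_val W w s (entry (inner_id l_next) l'_next (sc 32)) = ?V (IN (Suc ?l) - 1) (Suc a) ?p'" by simp
    show "real_val W w s (Oracle (Some (Word 2 (sc 27))) (Some (Word 4 (sc 24)))) = sub ?l a"
      using readyD(5)[OF rd, of ?l] readyD(7)[OF rd, of a] nx t lr ab' by simp
  qed
  have v7: "real_val W w s (entry (addE (sc 26) (subE (addE (sc 30) oneE) (sc 27))) (addE (sc 32) oneE) (sc 25))
      = ?V (i + (Suc ?p - ?l)) (Suc ?p') b"
    if t: "?l < ?r" "Lf (Suc i) \<noteq> ?l" "FX.inL ?l ?r" "a < b" "a \<le> ?p'" "?p' < b" "band H (?p, ?p')"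
      "?p \<noteq> ?r - 1"
  proof -
    have g: "FX.goleft ?l ?r" using gl t by blast
    have "i + (Suc ?p - ?l) < T" using rest_left(2)[OF c t(1) g t(3,8)] .
    then have b: "i + (Suc ?p - ?l) < 2 ^ W" "Suc ?p < 2 ^ W" "Suc ?p' < 2 ^ W" "?l \<le> Suc ?p"
      using pl t by (auto intro!: wide simp: FX.inL_def)
    have "word_val W s (addE (sc 26) (subE (addE (sc 30) oneE) (sc 27))) = i + (Suc ?p - ?l)"
      using b F'(2)[OF t(1)] nx(4,5) by (simp add: word_simps)
    moreover have "word_val W s (addE (sc 32) oneE) = Suc ?p'" using b p t by (simp add: word_simps)
    ultimately show ?thesis
      using lookV[OF _ _ nx(8) cell_rest_left[OF c t(1) g t(3,8,6,7)]] by simp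
  qed
  have v8: "real_val W w s (RAdd (RAdd (entry (inner_id (addE (sc 31) oneE)) (addE (sc 33) oneE) r'_prev)
          (entry (addE (sc 26) (subE (sc 28) (sc 31))) (sc 24) (sc 33)))
        (Oracle (Some (Word 2 (sc 31))) (Some (Word 4 (sc 33))))) =
      ?V (IN (Suc ?q) - 1) (Suc ?q') (b - 1) + ?V (i + (?r - ?q)) a ?q' + sub ?q ?q'"
    if t: "?l < ?r" "Lf (Suc i) = ?l" "FX.inR ?l ?r" "a < b" "a \<le> ?q'" "?q' < b" "band H (?q, ?q')"
  proof -
    have g: "\<not> FX.goleft ?l ?r" using gl t by blast
    have "IN (Suc ?q) - 1 < T" "0 < IN (Suc ?q)" using inner_right(1,2)[OF c t(1) g t(3)] by auto
    then have "IN (Suc ?q) \<le> T" "0 < IN (Suc ?q)" by linarith+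
    moreover have "i + (?r - ?q) < T" using rest_right(2)[OF c t(1) g t(3)] .
    ultimately have b: "IN (Suc ?q) < 2 ^ W" "0 < IN (Suc ?q)" "i + (?r - ?q) < 2 ^ W"
        "Suc ?q < 2 ^ W" "Suc ?q' < 2 ^ W" "?q \<le> ?r"
      using pl t by (auto intro!: wide simp: FX.inR_def simp del: diff_Suc_1)
    have q: "words s 31 0 = ?q" "words s 33 0 = ?q'" using F'(3)[OF t(1)] p(2)[OF t(4)] by auto
    have 1: "word_val W s (inner_id (addE (sc 31) oneE)) = IN (Suc ?q) - 1"
      using b q ids by (simp add: word_simps)
    have 2: "word_val W s (addE (sc 33) oneE) = Suc ?q'" using b q by (simp add: word_simps)
    have 3: "word_val W s (addE (sc 26) (subE (sc 28) (sc 31))) = i + (?r - ?q)"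
      using b q nx(4,6) sm by (simp add: word_simps)
    have 4: "word_val W s (sc 33) = ?q'" using q by simp
    have 5: "real_val W w s (Oracle (Some (Word 2 (sc 31))) (Some (Word 4 (sc 33)))) = sub ?q ?q'"
      using q readyD(5)[OF rd pl(2)[OF t(1)]] readyD(7)[OF rd pl(4)[OF t(4)]] by simp
    show ?thesis
      using lookV[OF 1 2 rp(2)[OF t(4)] cell_inner_right[OF c t(1) g t(3,4,6,7)]]
        lookV[OF 3 nx(7) 4 cell_rest_right[OF c t(1) g t(3,5,6,7)]] 5
      by simp
  qed
  have e6: "test_val W w s (Both inner_test (Both (Eq (sc 30) r_prev) (Eq (sc 32) r'_prev))) \<longleftrightarrow>
      test_val W w s inner_test \<and> ?p = ?r - 1 \<and> ?p' = b - 1"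
    "test_val W w s (Both inner_test (Neg (Eq (sc 30) r_prev))) \<longleftrightarrow>
      test_val W w s inner_test \<and> ?p \<noteq> ?r - 1"
    using it F'(2) p(1) rp by auto
  have G: "test_val W w s (Both (Eq (sc 27) (sc 28)) (Eq (sc 24) (sc 25))) \<longleftrightarrow> ?l = ?r \<and> a = b"
    "test_val W w s (Both (Less (sc 24) (sc 25)) (band_test (sc 27) l'_next)) \<longleftrightarrow>
       a < b \<and> band H (?l, Suc a)"
    "test_val W w s (Both (Less (sc 24) (sc 25)) (band_test (sc 28) r'_prev)) \<longleftrightarrow>
       a < b \<and> band H (?r, b - 1)"
    "test_val W w s (Both left_test (band_test l_next (sc 24))) \<longleftrightarrow>
       (?l < ?r \<and> Lf (Suc i) \<noteq> ?l) \<and> band H (Suc ?l, a)"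
    "test_val W w s (Both right_test (band_test r_prev (sc 25))) \<longleftrightarrow>
       (?l < ?r \<and> Lf (Suc i) = ?l) \<and> band H (?r - 1, b)"
    using ids ab lt g2 g3 g4 g5 by auto
  have V6: "real_val W w s (RAdd (entry (inner_id l_next) l'_next (sc 32))
      (Oracle (Some (Word 2 (sc 27))) (Some (Word 4 (sc 24))))) = ?V (IN (Suc ?l) - 1) (Suc a) ?p' + sub ?l a"
    if "?l < ?r" "Lf (Suc i) \<noteq> ?l" "FX.inL ?l ?r" "a < b" "a \<le> ?p'" "?p' < b" "band H (?p, ?p')"
    using left_val[OF that] by (simp only: real_val.simps(3))
  have V7: "real_val W w s (RAdd (RAdd (entry (inner_id l_next) l'_next (sc 32))
        (entry (addE (sc 26) (subE (addE (sc 30) oneE) (sc 27))) (addE (sc 32) oneE) (sc 25)))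
      (Oracle (Some (Word 2 (sc 27))) (Some (Word 4 (sc 24))))) =
      ?V (IN (Suc ?l) - 1) (Suc a) ?p' + ?V (i + (Suc ?p - ?l)) (Suc ?p') b + sub ?l a"
    if "?l < ?r" "Lf (Suc i) \<noteq> ?l" "FX.inL ?l ?r" "a < b" "a \<le> ?p'" "?p' < b" "band H (?p, ?p')"
      "?p \<noteq> ?r - 1"
    using left_val[OF that(1-7)] v7[OF that] by (simp only: real_val.simps(3))
  show ?thesis
    unfolding cand_progs_def candidates_def Let_def list.map list.rel_inject prod.case
  proof (intro conjI impI)
    show "real_val W w s (RConst 0) = 0" by simp
  qed (simp (no_asm) only: G it rt e6 | (elim conjE, rule v2 v3 v4 v5 V6 V7 v8; assumption) |
      rule list.rel_intros)+
qed

end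

section \<open>Filling the table\<close>

context tables
begin

lemma loaded_set [simp]:
  "31 < A \<or> A \<in> {21, 22, 23, 24, 25} \<Longrightarrow> loaded i (set_word A j v s) \<longleftrightarrow> loaded i s"
  "A' \<noteq> 1 \<Longrightarrow> A' \<noteq> 3 \<Longrightarrow> loaded i (set_real A' j x s) \<longleftrightarrow> loaded i s"
  by (auto simp: loaded_def good_def state_simps)

lemma good_set [simp]:
  "good (set_word A j v s) i a b \<longleftrightarrow> good s i a b"
  "A' \<noteq> 1 \<Longrightarrow> good (set_real A' j x s) i a b \<longleftrightarrow> good s i a b"
  by (simp_all add: good_def state_simps)

text \<open>Addresses of distinct cells differ, so a store touches one cell only.\<close>

lemma good_store:
  assumes "cell i a b" "cell j c d" "ok i a b v"
  shows "good (set_real 1 (ix i a b) v s) j c d \<longleftrightarrow> (i, a, b) = (j, c, d) \<or> good s j c d"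
proof (cases "(i, a, b) = (j, c, d)")
  case False
  then have "ix i a b \<noteq> ix j c d" using ix_inj[OF assms(1,2)] by auto
  then show ?thesis using False by (auto simp: good_def reals_set_real)
qed (use assms(3) in \<open>auto simp: good_def reals_set_real\<close>)

lemma loaded_store:
  assumes "cell i a b" "loaded i s"
  shows "loaded i (set_real 1 (ix i a b) v s)"
proof -
  have "good (set_real 1 (ix i a b) v s) j c d" if "i < j" "cell j c d" for j c d
  proof -
    have "ix i a b \<noteq> ix j c d" using ix_inj[OF assms(1) that(2)] that(1) by auto
    then show ?thesis using assms(2) that by (auto simp: loaded_def good_def reals_set_real)
  qed
  then show ?thesis using assms(2) by (simp add: loaded_def)
qed

text \<open>The result is given up to the contents of the scratch cells; the table entry is the only
  change that the loop invariants see.\<close>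

lemma run_cell_prog:
  assumes c: "cell i a b" and L: "loaded i s" and ab: "words s 24 0 = a" "words s 25 0 = b"
    and left: "\<And>c. a < c \<Longrightarrow> cell i c b \<Longrightarrow> good s i c b"
    and right: "\<And>d. d < b \<Longrightarrow> cell i a d \<Longrightarrow> good s i a d"
  shows "\<exists>v x y z. ok i a b v \<and>
    run W w cell_prog s = set_real 1 (ix i a b) v (set_real 2 0 x (set_word 33 0 y (set_word 32 0 z s)))"
proof -
  define y where "y = words s 6 (word_val W s r'_prev)"
  define s1 where "s1 = set_word 33 0 y (set_word 32 0 (words s 6 a) s)"
  have st: "static s" using L by (simp add: loaded_def)
  have L1: "loaded i s1" using L by (simp add: s1_def)
  have ab1: "words s1 24 0 = a" "words s1 25 0 = b" using ab by (simp_all add: s1_def state_simps)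
  have bM: "b \<le> M" "a \<le> b" using c by (auto simp: cell_def)
  have p: "words s1 32 0 = mate Y a" "words s1 33 0 = mate Y (b - 1)" if "a < b"
  proof -
    have "b < 2 ^ W" using bM by (intro wide) simp
    then have "word_val W s r'_prev = b - 1" using ab that by (simp add: word_simps)
    then show "words s1 32 0 = mate Y a" "words s1 33 0 = mate Y (b - 1)"
      using st that bM by (auto simp: s1_def y_def static_def state_simps)
  qed
  let ?V = "\<lambda>i a b. reals s1 1 (ix i a b)"
  let ?cs = "map (\<lambda>(g, e). (test_val W w s1 g, real_val W w s1 e)) cand_progs"
  let ?v = "value_of ?V i a b"
  have V: "reals s1 = reals s" by (simp add: s1_def)
  have ok: "ok i a b ?v"
  proof (rule ok_value[OF c])
    show "ok j d e (?V j d e)" if "i < j" "cell j d e" for j d e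
      using L1 that by (simp add: loaded_def good_def)
  qed (use left right in \<open>auto simp: V good_def\<close>)
  have "relaxes ?cs M0 = ?v"
    unfolding value_of_def by (rule relaxes_cong[OF cands_val[OF c L1 ab1 p]])
  moreover have "run W w (relaxes_prog cand_progs) (set_real 2 0 M0 s1) = set_real 2 0 (relaxes ?cs M0) s1"
  proof (rule run_relaxes_prog)
    fix g e v assume "(g, e) \<in> set cand_progs"
    then show "test_val W w (set_real 2 0 v s1) g = test_val W w s1 g \<and>
        real_val W w (set_real 2 0 v s1) e = real_val W w s1 e"
      unfolding cand_progs_def
      by (auto simp: left_test_def right_test_def inner_test_def band_test_def look_def state_simps)
  qed
  moreover have "word_val W (set_real 2 0 ?v s1) (look (sc 26) (sc 24) (sc 25)) = ix i a b"
    by (rule look_val[OF _ _ _ _ c]) (use L1 ab1 in \<open>simp_all add: loaded_def\<close>)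
  moreover have "reals s1 3 0 = M0" using st by (simp add: s1_def static_def)
  ultimately have "run W w cell_prog s = set_real 1 (ix i a b) ?v (set_real 2 0 ?v s1)"
    using ab by (simp add: cell_prog_def s1_def y_def state_simps)
  then show ?thesis using ok unfolding s1_def by blast
qed

text \<open>The current row is \<open>a + H = Lf i + A\<close>; rows are filled by decreasing \<open>a\<close>, each by increasing \<open>b\<close>.\<close>

definition filled :: "nat \<Rightarrow> nat \<Rightarrow> nat \<Rightarrow> state \<Rightarrow> bool" where
  "filled i A e s \<longleftrightarrow> loaded i s \<and> words s 34 0 = A \<and>
     (\<forall>a b. cell i a b \<longrightarrow> Lf i + A < a + H \<or> Lf i + A = a + H \<and> b + H < Rt i + e \<longrightarrow> good s i a b)"

lemma filled_set [simp]:
  "A' \<in> {21, 22, 23, 24, 25, 32, 33, 35, 36} \<Longrightarrow> filled i A e (set_word A' j v s) \<longleftrightarrow> filled i A e s"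
  by (auto simp: filled_def state_simps)

lemma runs_column:
  assumes I: "filled i A e s" "words s 23 0 = e" and A: "A < 2 * H + 1" and e: "e < 2 * H + 1"
  shows "runs W w column_prog 40 (\<lambda>s'. words s' 23 0 = e \<and> filled i A (Suc e) (set_word 23 0 (Suc e) s')) s"
proof (rule runs_flat)
  define la where "la = Lf i + A"
  define rb where "rb = Rt i + e"
  define s1 where "s1 = set_word 36 0 rb (set_word 35 0 la s)"
  have L: "loaded i s" and w34: "words s 34 0 = A" using I by (auto simp: filled_def)
  have st: "static s" and iT: "i < T" and lr: "words s 27 0 = Lf i" "words s 28 0 = Rt i"
    using L by (auto simp: loaded_def)
  have lrN: "Lf i \<le> N" "Rt i \<le> N" using FX.familyD(4,5)[OF F iT] by auto
  have b: "la < 2 ^ W" "rb < 2 ^ W" "M + H < 2 ^ W" "H < 2 ^ W"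
    using lrN A e H by (auto intro!: wide simp: la_def rb_def)
  have s1: "run W w (put 36 (addE (sc 28) (sc 23))) (run W w (put 35 (addE (sc 27) (sc 34))) s) = s1"
    using lr w34 I(2) b by (simp add: s1_def la_def rb_def state_simps word_simps)
  have st1: "words s1 35 0 = la" "words s1 36 0 = rb" "words s1 19 0 = H" "words s1 0 (Suc 0) = M"
    using st readyD(2)[of s] by (auto simp: s1_def static_def state_simps)
  have guard: "test_val W w s1 column_test \<longleftrightarrow> H \<le> la \<and> la \<le> rb \<and> rb \<le> M + H"
    using st1 b by (auto simp: column_test_def word_simps)
  let ?s' = "run W w column_prog s"
  show "words ?s' 23 0 = e \<and> filled i A (Suc e) (set_word 23 0 (Suc e) ?s')"
  proof (cases "H \<le> la \<and> la \<le> rb \<and> rb \<le> M + H")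
    case False
    have "?s' = s1" unfolding column_prog_def run.simps s1[unfolded run.simps]
      using guard False by simp
    moreover have "filled i A (Suc e) s1"
      unfolding filled_def
    proof (intro conjI allI impI)
      show "loaded i s1" using L by (simp add: s1_def)
      show "words s1 34 0 = A" using w34 by (simp add: s1_def state_simps)
      fix a b assume c: "cell i a b" and *: "Lf i + A < a + H \<or> Lf i + A = a + H \<and> b + H < Rt i + Suc e"
      \<comment> \<open>These offsets describe no cell, so advancing the column adds no
        obligation.\<close>
      have "\<not> (la = a + H \<and> rb = b + H)" using False c by (auto simp: cell_def)
      then show "good s1 i a b" using I(1) c * by (auto simp: s1_def filled_def la_def rb_def)
    qed
    ultimately show ?thesis using I(2) by (simp add: s1_def state_simps)
  next
    case True
    define a where "a = la - H"
    define b' where "b' = rb - H"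
    have ab: "la = a + H" "rb = b' + H" using True by (auto simp: a_def b'_def)
    have c: "cell i a b'"
      using True iT A e ab unfolding cell_def band_def la_def rb_def by auto
    define s2 where "s2 = set_word 25 0 b' (set_word 24 0 a s1)"
    have s2: "run W w (put 25 (subE (sc 36) (sc 19))) (run W w (put 24 (subE (sc 35) (sc 19))) s1) = s2"
      using st1 b ab by (simp add: s2_def state_simps word_simps)
    have g2: "good s2 i x y \<longleftrightarrow> good s i x y" for x y by (simp add: s2_def s1_def)
    have "\<exists>v x y z. ok i a b' v \<and> run W w cell_prog s2 =
      set_real 1 (ix i a b') v (set_real 2 0 x (set_word 33 0 y (set_word 32 0 z s2)))"
    proof (rule run_cell_prog[OF c])
      show "loaded i s2" using L by (simp add: s2_def s1_def)
      show "words s2 24 0 = a" "words s2 25 0 = b'" by (simp_all add: s2_def state_simps)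
      show "good s2 i x b'" if "a < x" "cell i x b'" for x
        using I(1) that ab unfolding g2 filled_def la_def by auto
      show "good s2 i a y" if "y < b'" "cell i a y" for y
        using I(1) that ab unfolding g2 filled_def la_def rb_def by auto
    qed
    then obtain v x y z where v: "ok i a b' v" and r: "run W w cell_prog s2 =
        set_real 1 (ix i a b') v (set_real 2 0 x (set_word 33 0 y (set_word 32 0 z s2)))"
      by blast
    define s3 where "s3 = set_real 2 0 x (set_word 33 0 y (set_word 32 0 z s2))"
    have s': "?s' = set_real 1 (ix i a b') v s3"
      unfolding column_prog_def run.simps s1[unfolded run.simps] s3_def r[symmetric]
      using guard True s2 by simp
    have g3: "good s3 i x y \<longleftrightarrow> good s i x y" for x y by (simp add: s3_def g2)
    have "filled i A (Suc e) ?s'"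
      unfolding filled_def
    proof (intro conjI allI impI)
      show "loaded i ?s'"
        unfolding s' by (rule loaded_store[OF c]) (use L in \<open>simp add: s3_def s2_def s1_def\<close>)
      show "words ?s' 34 0 = A" using w34 by (simp add: s' s3_def s2_def s1_def state_simps)
      fix p q assume pq: "cell i p q" and *: "Lf i + A < p + H \<or> Lf i + A = p + H \<and> q + H < Rt i + Suc e"
      show "good ?s' i p q"
        unfolding s' good_store[OF c pq v] g3
        using I(1) pq * ab unfolding filled_def la_def rb_def by (cases "q < b'") auto
    qed
    then show ?thesis using I(2) by (simp add: s' s3_def s2_def s1_def state_simps)
  qed
  show "flat column_prog"
    by (simp add: column_prog_def cell_prog_def flat_relaxes_prog)
  show "com_size column_prog \<le> 40"
    by (simp add: column_prog_def cell_prog_def cand_progs_def relax_prog_def)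
qed

text \<open>Round \<open>e\<close> handles offset \<open>2 * H - e\<close>. The hypothesis on
  \<open>good\<close> says that all larger offsets are complete, which provides the cells with
  larger \<open>a\<close>.\<close>

lemma runs_row:
  assumes L: "loaded i s" and e: "words s 22 0 = e" "e < 2 * H + 1"
    and g: "\<And>a b. cell i a b \<Longrightarrow> Lf i + (2 * H + 1) \<le> a + H + e \<Longrightarrow> good s i a b"
  shows "runs W w row_prog ((2 * H + 1) * 42 + 3) (\<lambda>s'. words s' 22 0 = e \<and> loaded i s' \<and>
    (\<forall>a b. cell i a b \<longrightarrow> Lf i + (2 * H + 1) \<le> a + H + Suc e \<longrightarrow> good s' i a b)) s"
  unfolding row_prog_def
proof (rule runs_then[where P = "\<lambda>s'. filled i (2 * H - e) 0 s' \<and> words s' 22 0 = e"])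
  have "H < 2 ^ W" "2 * H + 1 < 2 ^ W" using H by (auto intro!: wide)
  then have "word_val W s (subE (subE (sc 20) oneE) (sc 22)) = 2 * H - e"
    using L e by (simp add: loaded_def static_def word_simps)
  moreover have "filled i (2 * H - e) 0 (set_word 34 0 (2 * H - e) s)"
    unfolding filled_def
  proof (intro conjI allI impI)
    fix a b assume "cell i a b" "Lf i + (2 * H - e) < a + H \<or> Lf i + (2 * H - e) = a + H \<and> b + H < Rt i + 0"
    then show "good (set_word 34 0 (2 * H - e) s) i a b"
      using g[of a b] e offsets(3)[of i a b] by auto
  qed (use L in \<open>simp_all add: state_simps\<close>)
  ultimately show "runs W w (put 34 (subE (subE (sc 20) oneE) (sc 22))) 1
      (\<lambda>s'. filled i (2 * H - e) 0 s' \<and> words s' 22 0 = e) s"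
    using e by (intro runs_put) (simp_all add: state_simps)
  fix s assume s: "filled i (2 * H - e) 0 s \<and> words s 22 0 = e"
  let ?I = "\<lambda>k (s::state). filled i (2 * H - e) k s"
  have "runs W w (loop 23 (sc 20) column_prog) ((2 * H + 1) * (40 + 2) + 2)
      (\<lambda>s'. ?I (2 * H + 1) s' \<and> words s' 23 0 = 2 * H + 1) s"
  proof (rule runs_loop[where I = ?I])
    show "2 * H + 1 < 2 ^ W" using H by (intro wide) simp
    show "word_val W s (sc 20) = 2 * H + 1" if "?I k s" for k s
      using that by (simp add: filled_def loaded_def static_def)
    fix k s assume "k < 2 * H + 1" "?I k s" "words s 23 0 = k"
    then show "runs W w column_prog 40 (\<lambda>s'. words s' 23 0 = k \<and> ?I (Suc k) (set_word 23 0 (Suc k) s')) s"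
      by (intro runs_column) auto
  qed (use s in simp)
  then show "runs W w (loop 23 (sc 20) column_prog) ((2 * H + 1) * (40 + 2) + 2) (\<lambda>s'. words s' 22 0 = e \<and>
    loaded i s' \<and> (\<forall>a b. cell i a b \<longrightarrow> Lf i + (2 * H + 1) \<le> a + H + Suc e \<longrightarrow> good s' i a b)) s"
  proof (rule runs_same)
    fix s' assume s': "?I (2 * H + 1) s' \<and> words s' 23 0 = 2 * H + 1"
      and "same (modw (loop 23 (sc 20) column_prog)) (modr (loop 23 (sc 20) column_prog)) s s'"
    moreover have "22 \<notin> modw (loop 23 (sc 20) column_prog)"
      by (simp add: loop_def column_prog_def cell_prog_def cand_progs_def relax_prog_def)
    ultimately have "words s' 22 = words s 22" by (auto intro: sameW)
    moreover have "good s' i a b" if "cell i a b" "Lf i + (2 * H + 1) \<le> a + H + Suc e" for a b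
    proof -
      have "Lf i + (2 * H - e) < a + H \<or> Lf i + (2 * H - e) = a + H \<and> b + H < Rt i + (2 * H + 1)"
        using offsets(4)[OF that(1)] that(2) e by linarith
      then show ?thesis using s' that(1) unfolding filled_def by blast
    qed
    ultimately show "words s' 22 0 = e \<and> loaded i s' \<and>
        (\<forall>a b. cell i a b \<longrightarrow> Lf i + (2 * H + 1) \<le> a + H + Suc e \<longrightarrow> good s' i a b)"
      using s s' by (simp add: filled_def)
  qed
qed simp

definition all_good :: "nat \<Rightarrow> state \<Rightarrow> bool" where
  "all_good k s \<longleftrightarrow> static s \<and> (\<forall>j a b. T \<le> j + k \<longrightarrow> cell j a b \<longrightarrow> good s j a b)"

lemma all_good_set [simp]:
  "20 < A \<Longrightarrow> all_good k (set_word A j v s) \<longleftrightarrow> all_good k s"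
  by (simp add: all_good_def)

lemma runs_level:
  assumes I: "all_good k s" "words s 21 0 = k" "k < T"
  shows "runs W w (Seq load_prog (loop 22 (sc 20) row_prog)) ((2 * H + 1) * ((2 * H + 1) * 42 + 5) + 8)
    (\<lambda>s'. words s' 21 0 = k \<and> all_good (Suc k) s') s"
proof -
  define i where "i = T - Suc k"
  have i: "i < T" using I(3) by (simp add: i_def)
  have st: "static s" using I by (simp add: all_good_def)
  have lr: "Lf i \<le> Rt i" "Rt i \<le> N" using FX.familyD(4,5)[OF F i] by auto
  have b: "T < 2 ^ W" "Suc i < 2 ^ W" "Rt i < 2 ^ W" using i lr by (auto intro!: wide)
  define s1 where "s1 = run W w load_prog s"
  have s1: "words s1 26 0 = i" "words s1 27 0 = Lf i" "words s1 28 0 = Rt i" "words s1 29 0 = Lf (Suc i)"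
      "words s1 30 0 = words s 5 (Lf i)" "Lf i < Rt i \<Longrightarrow> words s1 31 0 = words s 5 (Rt i - 1)"
      "static s1" "reals s1 = reals s" "words s1 21 = words s 21"
  proof -
    have f: "words s 17 0 = T" "words s 11 = Lf" "words s 12 = Rt" "words s 21 0 = k"
      using st I(2) by (simp_all add: static_def)
    have op: "word_op W Sub T (Suc 0) = T - Suc 0" "word_op W Sub (T - Suc 0) k = i"
        "word_op W Add i (Suc 0) = Suc i"
      using b I(3) by (simp_all add: word_simps i_def)
    have op': "word_op W Sub (Rt i) (Suc 0) = Rt i - Suc 0" if "Lf i < Rt i"
      using b that by (simp add: word_simps)
    show "words s1 26 0 = i" "words s1 27 0 = Lf i" "words s1 28 0 = Rt i" "words s1 29 0 = Lf (Suc i)"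
      "words s1 30 0 = words s 5 (Lf i)" "Lf i < Rt i \<Longrightarrow> words s1 31 0 = words s 5 (Rt i - 1)"
      "static s1" "reals s1 = reals s" "words s1 21 = words s 21"
      using st by (simp_all add: s1_def load_prog_def f op op' state_simps)
  qed
  have m: "words s 5 (Lf i) = mate X (Lf i)" "words s 5 (Rt i - 1) = mate X (Rt i - 1)" if "Lf i < Rt i"
    using st lr that readyD(3)[of s] by (auto simp: static_def)
  have gd: "good s1 j a b" if "i < j" "cell j a b" for j a b
    using I(1) that s1(8) by (simp add: all_good_def good_def i_def)
  have L: "loaded i s1"
    unfolding loaded_def using s1 m gd i by auto
  let ?B = "2 * H + 1"
  let ?I = "\<lambda>e (s::state). loaded i s \<and> (\<forall>a b. cell i a b \<longrightarrow> Lf i + ?B \<le> a + H + e \<longrightarrow> good s i a b)"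
  have loop: "runs W w (loop 22 (sc 20) row_prog) (?B * (?B * 42 + 3 + 2) + 2)
      (\<lambda>s'. ?I ?B s' \<and> words s' 22 0 = ?B) s1"
  proof (rule runs_loop[where I = ?I])
    show "?B < 2 ^ W" using H by (intro wide) simp
    show "word_val W s (sc 20) = ?B" if "?I k s" for k s
      using that by (simp add: loaded_def static_def)
    have "\<not> Lf i + ?B \<le> a + H + 0" if "cell i a b" for a b
      using offsets(2)[OF that] by simp
    then show "?I 0 (set_word 22 0 0 s1)" using L by auto
    fix e s assume "e < ?B" "?I e s" "words s 22 0 = e"
    then have "runs W w row_prog (?B * 42 + 3) (\<lambda>s'. words s' 22 0 = e \<and> loaded i s' \<and>
      (\<forall>a b. cell i a b \<longrightarrow> Lf i + ?B \<le> a + H + Suc e \<longrightarrow> good s' i a b)) s"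
      by (intro runs_row) auto
    then show "runs W w row_prog (?B * 42 + 3) (\<lambda>s'. words s' 22 0 = e \<and> ?I (Suc e) (set_word 22 0 (Suc e) s')) s"
      by (rule runs_mono) auto
  qed
  have "21 \<notin> modw (loop 22 (sc 20) row_prog)"
    by (simp add: loop_def row_prog_def column_prog_def cell_prog_def cand_progs_def relax_prog_def)
  with loop have loop': "runs W w (loop 22 (sc 20) row_prog) (?B * (?B * 42 + 3 + 2) + 2)
      (\<lambda>s'. ?I ?B s' \<and> words s' 21 = words s1 21) s1"
    by (elim runs_same) (auto intro: sameW)
  show ?thesis
  proof (rule runs_then[where P = "\<lambda>s'. s' = s1"])
    show "runs W w load_prog 6 (\<lambda>s'. s' = s1) s"
      by (rule runs_flat) (simp_all add: s1_def, simp_all add: load_prog_def)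
    fix s' assume "s' = s1"
    show "runs W w (loop 22 (sc 20) row_prog) (?B * (?B * 42 + 3 + 2) + 2)
        (\<lambda>s'. words s' 21 0 = k \<and> all_good (Suc k) s') s'"
    proof (rule runs_mono[OF loop'[folded \<open>s' = s1\<close>] order.refl])
      fix s2 assume s2: "?I ?B s2 \<and> words s2 21 = words s' 21"
      have "good s2 j a b" if "T \<le> j + Suc k" "cell j a b" for j a b
      proof (cases "j = i")
        case True
        then show ?thesis using s2 that offsets(1)[OF that(2)] by auto
      next
        case False
        then have "i < j" using that by (simp add: i_def)
        then show ?thesis using s2 that(2) by (simp add: loaded_def)
      qed
      then show "words s2 21 0 = k \<and> all_good (Suc k) s2"
        using s2 I(2) s1(9) \<open>s' = s1\<close> by (simp add: all_good_def loaded_def)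
    qed
  qed simp
qed

text \<open>\<open>all_good 0\<close> holds vacuously, so entries left over from a smaller budget
  need no erasing: every cell is overwritten before it is read.\<close>

lemma runs_table:
  assumes "static s"
  shows "runs W w table_prog (T * ((2 * H + 1) * ((2 * H + 1) * 42 + 5) + 10) + 2)
    (\<lambda>s. static s \<and> (\<forall>i a b. cell i a b \<longrightarrow> good s i a b)) s"
proof -
  have "runs W w table_prog (T * ((2 * H + 1) * ((2 * H + 1) * 42 + 5) + 8 + 2) + 2)
    (\<lambda>s. all_good T s \<and> words s 21 0 = T) s"
    unfolding table_prog_def
  proof (rule runs_loop[where I = all_good])
    show "T < 2 ^ W" by (rule wide) simp
    show "word_val W s (sc 17) = T" if "all_good k s" for k s
      using that by (simp add: all_good_def static_def)
    show "all_good 0 (set_word 21 0 0 s)"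
      using assms by (auto simp: all_good_def cell_def)
    fix k s assume "k < T" "all_good k s" "words s 21 0 = k"
    then have "runs W w (Seq load_prog (loop 22 (sc 20) row_prog)) ((2 * H + 1) * ((2 * H + 1) * 42 + 5) + 8)
      (\<lambda>s'. words s' 21 0 = k \<and> all_good (Suc k) s') s"
      by (intro runs_level)
    then show "runs W w (Seq load_prog (loop 22 (sc 20) row_prog)) ((2 * H + 1) * ((2 * H + 1) * 42 + 5) + 8)
      (\<lambda>s'. words s' 21 0 = k \<and> all_good (Suc k) (set_word 21 0 (Suc k) s')) s"
      by (rule runs_mono) auto
  qed
  then show ?thesis
    by (rule runs_mono) (auto simp: all_good_def)
qed

end

section \<open>Doubling the band\<close>

lemma length_euler: "length (euler F) = 2 * forest_nodes F"
proof -
  have "length (euler_tree t) = 2 * tree_nodes t" for t :: "'a tree"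
  proof (induction t)
    case (Node a ts)
    then have "map (length \<circ> euler_tree) ts = map (\<lambda>t. 2 * tree_nodes t) ts" by simp
    then have "sum_list (map (length \<circ> euler_tree) ts) = 2 * sum_list (map tree_nodes ts)"
      by (simp only: sum_list_const_mult)
    then show ?case by (simp add: length_concat)
  qed
  then show ?thesis
    by (simp add: euler_def forest_nodes_def length_concat comp_def sum_list_const_mult)
qed

lemma lab_euler: "lab ` set (euler F) \<subseteq> forest_labels F"
proof -
  have "lab ` set (euler_tree t) \<subseteq> labels t" for t :: "'a tree"
    by (induction t) fastforce
  then show ?thesis by (fastforce simp: euler_def forest_labels_def)
qed

text \<open>A path is monotone and so stays between its end points, which yields the bounds on
  vertices in \<open>alignment\<close>.\<close>

lemma forest_alignment_iff:
  "forest_alignment F G P \<longleftrightarrow> closed_path (euler F) (euler G) P \<and> hd P = (0, 0) \<and>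
     last P = (length (euler F), length (euler G))"
proof -
  have "set P \<subseteq> {0..x} \<times> {0..y}" if "successively grid_edge P" "last P = (x, y)" for x y
    using path_mono[OF that(1)] that(2) by fastforce
  then show ?thesis
    unfolding forest_alignment_def alignment_def closed_path_def by blast
qed

text \<open>The band test precedes the value test because the whole problem may have no cell. In
  that case its end vertex is outside the band and the budget is too small.\<close>

definition iter_prog :: com where
  "iter_prog = Seq (put 19 (addE (sc 18) (sc 18))) (Seq (put 20 (addE (addE (sc 19) (sc 19)) oneE))
     (Seq table_prog
       (Cond (bothE [band_test (sc 0) (Word 0 oneE),
           Neg (Both (RLess (Real 4 (Const 0)) (entry (Const 0) (Const 0) (Word 0 oneE)))
             (Less (sc 18) (addE (sc 0) (Word 0 oneE))))])
          (Seq (SetReal 0 (Const 0) (entry (Const 0) (Const 0) (Word 0 oneE))) (put 10 oneE))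
          (Seq (put 18 (addE (sc 18) (sc 18)))
             (SetReal 4 (Const 0) (RAdd (Real 4 (Const 0)) (Real 4 (Const 0))))))))"

definition ted_prog :: com where
  "ted_prog = Seq eq_prog (Cond (Eq (sc 10) oneE) Skip
     (Seq (mate_prog 0 1 5) (Seq (mate_prog 1 3 6) (Seq inf_prog (Seq chain_prog
       (Seq (Seq (put 18 oneE) (SetReal 4 (Const 0) (RConst 1)))
          (While (Eq (sc 10) (Const 0)) iter_prog)))))))"

section \<open>The distance, the band, and equality of forests\<close>

locale problem =
  fixes \<Sigma> :: "nat set" and w :: "nat weight" and F G :: "nat forest" and W :: nat
  assumes norm: "normalized \<Sigma> w" and labs: "forest_labels F \<subseteq> \<Sigma>" "forest_labels G \<subseteq> \<Sigma>"
    and size': "64 * (length (euler F) + length (euler G) + 4) ^ 6 \<le> 2 ^ W"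
begin

lemma w_props:
  assumes "p \<in> insert None (Some ` \<Sigma>)" "q \<in> insert None (Some ` \<Sigma>)"
  shows "0 \<le> w p q" "p = q \<Longrightarrow> w p q = 0" "p \<noteq> q \<Longrightarrow> 1 \<le> w p q"
  using norm assms unfolding normalized_def Let_def by blast+

lemma label_mem:
  "i < length (euler F) \<Longrightarrow> lab (euler F ! i) \<in> \<Sigma>" "j < length (euler G) \<Longrightarrow> lab (euler G ! j) \<in> \<Sigma>"
  using subset_trans[OF lab_euler labs(1)] subset_trans[OF lab_euler labs(2)]
  by (meson image_subset_iff nth_mem)+

sublocale machine w "euler F" "euler G" W
proof
  fix p q
  assume p: "p \<in> insert None (Some ` lab ` set (euler F))"
    and q: "q \<in> insert None (Some ` lab ` set (euler G))"
  have sub: "insert None (Some ` lab ` set (euler F)) \<subseteq> insert None (Some ` \<Sigma>)"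
    "insert None (Some ` lab ` set (euler G)) \<subseteq> insert None (Some ` \<Sigma>)"
    by (intro insert_mono image_mono subset_trans[OF lab_euler] labs)+
  show "0 \<le> w p q" by (rule w_props(1)[OF subsetD[OF sub(1) p] subsetD[OF sub(2) q]])
qed (use balanced_euler size' in auto)

abbreviation "k \<equiv> ted w F G"

lemma ted_le:
  assumes "sg (\<lambda>_. True) (0, 0) (N, M) c"
  shows "k \<le> c"
proof -
  obtain P where "forest_alignment F G P" "alignment_cost w (euler F) (euler G) P = c"
    using assms unfolding seg_def forest_alignment_iff by blast
  then show ?thesis
    unfolding ted_def using finite_forest_alignments[of F G] by (intro Min_le) auto
qed

lemma ted_attained:
  "\<exists>P. forest_alignment F G P \<and> alignment_cost w (euler F) (euler G) P = k"
proof -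
  let ?A = "alignment_cost w (euler F) (euler G) ` {P. forest_alignment F G P}"
  have "k \<in> ?A"
    unfolding ted_def
    using finite_forest_alignments[of F G] forest_alignment_exists[of F G] by (intro Min_in) auto
  then show ?thesis by auto
qed

lemma k_le_trivial: "k \<le> trivial_cost"
  using ted_le[OF seg_trivial[of N M]] by (simp add: trivial_cost_def)

lemma k_nonneg: "0 \<le> k"
proof -
  obtain P where P: "forest_alignment F G P" "alignment_cost w (euler F) (euler G) P = k"
    using ted_attained by blast
  then show ?thesis
    using cost_nonneg[of P] by (auto simp: forest_alignment_iff closed_path_def)
qed

lemma trivial_nonneg: "0 \<le> trivial_cost"
  using k_nonneg k_le_trivial by linarith

lemma indel: "i < N \<Longrightarrow> 1 / 2 \<le> del i" "j < M \<Longrightarrow> 1 / 2 \<le> ins j"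
  using w_props(3)[of "Some (lab (euler F ! i))" None] w_props(3)[of None "Some (lab (euler G ! j))"]
    label_mem by auto

abbreviation diag :: "vertex \<Rightarrow> real" where "diag z \<equiv> real (fst z) - real (snd z)"

text \<open>Only insertions and deletions change the diagonal; each moves it by one and costs at
  least 1/2 by normalization.\<close>

lemma diag_cost:
  assumes "successively grid_edge Q" "Q \<noteq> []" "fst (last Q) \<le> N" "snd (last Q) \<le> M" "z \<in> set Q"
  shows "\<bar>diag z - diag (hd Q)\<bar> \<le> 2 * alignment_cost w (euler F) (euler G) Q"
  using assms
proof (induction Q)
  case (Cons u Q)
  show ?case
  proof (cases "Q = []")
    case False
    then have e: "grid_edge u (hd Q)" "successively grid_edge Q" "last (u # Q) = last Q"
      using Cons.prems by (auto simp: successively_Cons)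
    obtain x y where u: "u = (x, y)" by fastforce
    have hd: "fst (hd Q) \<le> N" "snd (hd Q) \<le> M"
      using path_mono[OF e(2) hd_in_set[OF False]] Cons.prems(3,4) unfolding e(3) by linarith+
    have edge: "\<bar>diag (hd Q) - diag u\<bar> \<le> 2 * edge_cost w (euler F) (euler G) (u, hd Q)"
      using e(1) hd indel(1)[of x] indel(2)[of y] sub_nonneg[of x y]
      unfolding u by (auto simp: paren_weight_def)
    have "0 \<le> alignment_cost w (euler F) (euler G) Q"
      using cost_nonneg[OF e(2) False] Cons.prems e(3) by simp
    moreover have "\<bar>diag z - diag (hd Q)\<bar> \<le> 2 * alignment_cost w (euler F) (euler G) Q" if "z \<in> set Q"
      using Cons.IH[OF e(2) False] Cons.prems e(3) that by simp
    ultimately show ?thesis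
      using edge Cons.prems(5) by (auto simp: cost_Cons[OF False])
  qed (use Cons.prems in simp)
qed simp

text \<open>Explains the width \<open>2 * K\<close>: a path of cost at most \<open>K\<close> stays
  that close to the main diagonal. For \<open>K \<ge> N + M\<close> the band covers the whole
  grid.\<close>

lemma seg_band:
  assumes "k \<le> real K \<or> N + M \<le> K"
  shows "sg (band (2 * K)) (0, 0) (N, M) k"
proof -
  obtain P where P: "forest_alignment F G P" "alignment_cost w (euler F) (euler G) P = k"
    using ted_attained by blast
  then have c: "closed_path (euler F) (euler G) P" "hd P = (0, 0)" "last P = (N, M)"
    by (auto simp: forest_alignment_iff)
  then have s: "successively grid_edge P" "P \<noteq> []" by (auto simp: closed_path_def)
  have "band (2 * K) z" if z: "z \<in> set P" for z
  proof (cases "k \<le> real K")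
    case True
    have "\<bar>diag z\<bar> \<le> 2 * real K"
      using diag_cost[OF s _ _ z] c P(2) True by simp
    then show ?thesis by (auto simp: band_def)
  next
    case False
    then show ?thesis using assms path_mono[OF s(1) z] c by (auto simp: band_def)
  qed
  then show ?thesis unfolding seg_def using c P(2) by blast
qed

lemma k_same:
  assumes "euler F = euler G" shows "k = 0"
proof -
  let ?P = "map (\<lambda>i. (i, i)) [0..<Suc N] :: vertex list"
  have nth: "?P ! i = (i, i)" if "i \<le> N" for i using that by (simp del: upt_Suc)
  have len: "length ?P = Suc N" by simp
  have s: "successively grid_edge ?P"
    unfolding successively_conv_nth by (auto simp: nth simp del: upt_Suc)
  have pe: "path_edges ?P = map (\<lambda>i. ((i, i), (Suc i, Suc i))) [0..<N]"
    by (rule nth_equalityI) (auto simp: path_edges_def nth nth_tl simp del: upt_Suc)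
  have al: "aligns ?P f g \<longleftrightarrow> f = g \<and> f < N" for f g
    unfolding aligns_def pe by auto
  have "closed_path (euler F) (euler G) ?P"
    unfolding closed_path_def using s al assms FX.mt_less by (auto simp del: upt_Suc)
  moreover have "alignment_cost w (euler F) (euler G) ?P = (\<Sum>i\<leftarrow>[0..<N]. 0)"
    unfolding alignment_cost_def pe map_map
    by (intro arg_cong[where f = sum_list] map_cong refl)
      (use w_props(2) label_mem in \<open>auto simp: paren_weight_def assms[symmetric]\<close>)
  moreover have "hd ?P = (0, 0)" "last ?P = (N, M)"
    using assms by (simp_all add: hd_map last_map del: upt_Suc)
  ultimately have "sg (\<lambda>_. True) (0, 0) (N, M) 0"
    unfolding seg_def by (intro exI[of _ ?P]) (simp add: sum_list_triv)
  from ted_le[OF this] k_nonneg show ?thesis by simp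
qed

text \<open>Below 1/2 there is no room for a single insertion, deletion or relabeling, so the path
  follows the diagonal between equal labels.\<close>

lemma cheap_path:
  assumes "successively grid_edge Q" "Q \<noteq> []" "hd Q = (x, x)" "last Q = (N, M)"
    and "alignment_cost w (euler F) (euler G) Q < 1 / 2"
  shows "N = M \<and> (\<forall>i. x \<le> i \<and> i < N \<longrightarrow> aligns Q i i \<and> lab (euler F ! i) = lab (euler G ! i))"
  using assms
proof (induction Q arbitrary: x)
  case (Cons u Q)
  show ?case
  proof (cases "Q = []")
    case True
    then show ?thesis using Cons.prems by auto
  next
    case False
    then have e: "grid_edge (x, x) (hd Q)" "successively grid_edge Q" "last Q = (N, M)" "u = (x, x)"
      using Cons.prems by (auto simp: successively_Cons)
    have hd: "fst (hd Q) \<le> N" "snd (hd Q) \<le> M"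
      using path_mono[OF e(2) hd_in_set[OF False]] e(3) by auto
    have c: "edge_cost w (euler F) (euler G) ((x, x), hd Q) + alignment_cost w (euler F) (euler G) Q < 1 / 2"
      using Cons.prems(5) e(4) by (simp add: cost_Cons[OF False])
    have nn: "0 \<le> alignment_cost w (euler F) (euler G) Q"
      using cost_nonneg[OF e(2) False] e(3) by simp
    have "hd Q \<noteq> (Suc x, x)" "hd Q \<noteq> (x, Suc x)"
      using c nn indel(1)[of x] indel(2)[of x] hd by (auto simp: paren_weight_def)
    then have h: "hd Q = (Suc x, Suc x)" using e(1) by auto
    have x: "x < N" "x < M" using h hd by auto
    have "lab (euler F ! x) = lab (euler G ! x)"
    proof (rule ccontr)
      assume "lab (euler F ! x) \<noteq> lab (euler G ! x)"
      then have "1 / 2 \<le> edge_cost w (euler F) (euler G) ((x, x), hd Q)"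
        using w_props(3)[of "Some (lab (euler F ! x))" "Some (lab (euler G ! x))"] label_mem x h
        by (simp add: paren_weight_def)
      then show False using c nn by simp
    qed
    moreover have "0 \<le> edge_cost w (euler F) (euler G) ((x, x), hd Q)"
      using edge_cost_nonneg[OF e(1)] hd by simp
    then have "N = M \<and> (\<forall>i. Suc x \<le> i \<and> i < N \<longrightarrow> aligns Q i i \<and> lab (euler F ! i) = lab (euler G ! i))"
      using Cons.IH[OF e(2) False h e(3)] c by simp
    moreover have "aligns (u # Q) i i \<longleftrightarrow> i = x \<or> aligns Q i i" for i
      using h e(4) False by (auto simp: aligns_def path_edges_Cons)
    ultimately show ?thesis
      by (metis Suc_leI le_neq_implies_less)
  qed
qed simp

text \<open>A cheap path shows equal labels along the diagonal, but labels do not reveal directions.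
  These follow from the forest condition: the path also aligns the two mates of \<open>i\<close>, on
  the diagonal again, so the mates coincide, and a parenthesis opens exactly when its mate comes
  later.\<close>

lemma k_differ:
  assumes "euler F \<noteq> euler G" shows "1 / 2 \<le> k"
proof (rule ccontr)
  assume k: "\<not> 1 / 2 \<le> k"
  obtain P where P: "forest_alignment F G P" "alignment_cost w (euler F) (euler G) P = k"
    using ted_attained by blast
  then have c: "closed_path (euler F) (euler G) P" "hd P = (0, 0)" "last P = (N, M)"
    by (auto simp: forest_alignment_iff)
  then have s: "successively grid_edge P" "P \<noteq> []" by (auto simp: closed_path_def)
  have *: "N = M" "\<And>i. i < N \<Longrightarrow> aligns P i i" "\<And>i. i < N \<Longrightarrow> lab (euler F ! i) = lab (euler G ! i)"
    using cheap_path[OF s c(2,3)] P(2) k by auto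
  have diag: "f = g" if "aligns P f g" for f g
  proof -
    have "(f, g) \<in> set P"
      using that unfolding aligns_def path_edges_def by (auto dest: set_zip_leftD)
    have "\<bar>diag (f, g) - diag (hd P)\<bar> \<le> 2 * k"
      using diag_cost[OF s _ _ \<open>(f, g) \<in> set P\<close>] c P(2) by simp
    then have "\<bar>real f - real g\<bar> < 1" using c(2) k by simp
    then show ?thesis by linarith
  qed
  have "euler F ! i = euler G ! i" if i: "i < N" for i
  proof -
    have "aligns P (mate (euler F) i) (mate (euler G) i)"
      using c(1) *(2)[OF i] by (auto simp: closed_path_def)
    then have "mate (euler F) i = mate (euler G) i" by (rule diag)
    then have "is_open (euler F ! i) = is_open (euler G ! i)"
      using is_open_iff_mate[OF X] is_open_iff_mate[OF Y] i *(1) by metis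
    then show ?thesis using *(3)[OF i] by (simp add: paren_eq)
  qed
  then show False using assms *(1) by (metis nth_equalityI)
qed

end

section \<open>Correctness and running time of the doubling search\<close>

context problem
begin

definition listing :: "nat \<Rightarrow> (nat \<Rightarrow> nat) \<Rightarrow> (nat \<Rightarrow> nat) \<Rightarrow> (nat \<Rightarrow> nat) \<Rightarrow> state \<Rightarrow> bool" where
  "listing T Lf Rt IN s \<longleftrightarrow> ready s \<and> (\<forall>j<M. words s 6 j = mate (euler G) j) \<and> words s 11 = Lf \<and>
     words s 12 = Rt \<and> words s 13 = IN \<and> words s 17 0 = T \<and> reals s 3 0 = trivial_cost"

lemma mod_table_prog: "A \<le> 20 \<Longrightarrow> A \<notin> modw table_prog" "A \<noteq> 1 \<Longrightarrow> A \<noteq> 2 \<Longrightarrow> A \<notin> modr table_prog"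
  by (simp_all add: table_prog_def load_prog_def row_prog_def column_prog_def cell_prog_def loop_def
      cand_progs_def relax_prog_def)

text \<open>By soundness the computed value is never below \<open>k\<close>, and by completeness it
  equals \<open>k\<close> once the band contains an optimal path. Hence the acceptance test, which
  knows only the value, decides the condition on \<open>k\<close> in the conclusion.\<close>

lemma runs_iter:
  assumes fam: "FX.family T Lf Rt IN" and T: "T \<le> (N + 1) * (N + 1)"
    and L: "listing T Lf Rt IN s" and s: "words s 18 0 = K" "reals s 4 0 = real K" "words s 10 0 = 0"
    and K: "1 \<le> K" "K \<le> 2 * (N + M)"
  shows "runs W w iter_prog (1500 * T * K ^ 2) (\<lambda>s'. if k \<le> real K \<or> N + M \<le> K
    then words s' 10 0 = 1 \<and> reals s' 0 0 = k
    else listing T Lf Rt IN s' \<and> words s' 18 0 = 2 * K \<and> reals s' 4 0 = real (2 * K) \<and> words s' 10 0 = 0) s"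
    (is "runs W w iter_prog _ ?Q s")
proof -
  let ?H = "2 * K"
  interpret tables w "euler F" "euler G" W trivial_cost ?H T Lf Rt IN
    by unfold_locales (use trivial_nonneg fam T K in auto)
  have b: "2 * K < 2 ^ W" "4 * K + 1 < 2 ^ W" "N + M < 2 ^ W"
    using K by (auto intro!: wide)
  have kk: "word_op W Add K K = 2 * K" "word_op W Add (2 * K) (2 * K) = 4 * K"
    "word_op W Add (4 * K) (Suc 0) = 4 * K + 1"
    by (subst word_add; use b in simp)+
  define s1 where "s1 = set_word 20 0 (2 * ?H + 1) (set_word 19 0 ?H s)"
  have s1: "run W w (put 20 (addE (addE (sc 19) (sc 19)) oneE)) (run W w (put 19 (addE (sc 18) (sc 18))) s) = s1"
    using s kk by (simp add: s1_def state_simps)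
  have st: "static s1"
    using L unfolding listing_def static_def s1_def by (simp add: state_simps)
  have T0: "0 < T" using FX.familyD(1)[OF fam] .
  let ?v = "\<lambda>s :: state. reals s 1 (ix 0 0 M)"
  have c0: "cell 0 0 M \<longleftrightarrow> band ?H (N, M)"
    using T0 FX.familyD(2,3)[OF fam] by (simp add: cell_def band_def)
  let ?stop = "k \<le> real K \<or> N + M \<le> K"
  let ?check = "bothE [band_test (sc 0) (Word 0 oneE),
           Neg (Both (RLess (Real 4 (Const 0)) (entry (Const 0) (Const 0) (Word 0 oneE)))
             (Less (sc 18) (addE (sc 0) (Word 0 oneE))))]"
  let ?last = "Cond ?check
          (Seq (SetReal 0 (Const 0) (entry (Const 0) (Const 0) (Word 0 oneE))) (put 10 oneE))
          (Seq (put 18 (addE (sc 18) (sc 18)))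
             (SetReal 4 (Const 0) (RAdd (Real 4 (Const 0)) (Real 4 (Const 0)))))"
  have last: "runs W w ?last 5 ?Q s2"
    if s2: "static s2" "\<And>i a b. cell i a b \<Longrightarrow> good s2 i a b" "same (modw table_prog) (modr table_prog) s1 s2" for s2
  proof (rule runs_flat)
    have w: "words s2 A = words s1 A" if "A \<le> 20" for A
      using s2(3) mod_table_prog(1)[OF that] by (rule sameW)
    have r: "reals s2 A = reals s1 A" if "A \<noteq> 1" "A \<noteq> 2" for A
      using s2(3) mod_table_prog(2)[OF that] by (rule sameR)
    have f: "words s2 18 0 = K" "words s2 10 0 = 0" "reals s2 4 0 = real K"
      using w[of 18] w[of 10] r[of 4] s by (simp_all add: s1_def state_simps)
    have rd: "words s2 0 0 = N" "words s2 0 (Suc 0) = M"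
      using s2(1) readyD(1,2)[of s2] by (auto simp: static_def)
    have bt: "test_val W w s2 (band_test (sc 0) (Word 0 oneE)) \<longleftrightarrow> band ?H (N, M)"
      by (rule band_val[OF s2(1)]) (use rd in auto)
    have look: "word_val W s2 (look (Const 0) (Const 0) (Word 0 oneE)) = ix 0 0 M" if "band ?H (N, M)"
      by (rule look_val[OF s2(1)]) (use that c0 rd in auto)
    have ok: "ok 0 0 M (?v s2)" if "band ?H (N, M)"
      using s2(2) that c0 by (simp add: good_def)
    have kv: "k \<le> ?v s2" if "band ?H (N, M)"
      using ok[OF that] FX.familyD(2,3)[OF fam] k_le_trivial ted_le
      unfolding ok_def sound_def by fastforce
    have vk: "?v s2 \<le> k" "band ?H (N, M)" if ?stop
    proof -
      have sb: "sg (band ?H) (0, 0) (N, M) k" by (rule seg_band[OF that])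
      then show b: "band ?H (N, M)" using seg_ends by blast
      show "?v s2 \<le> k" using ok[OF b] sb FX.familyD(2,3)[OF fam] unfolding ok_def by simp
    qed
    \<comment> \<open>A value of at most \<open>K\<close> forces \<open>k \<le> K\<close> by
      soundness; conversely \<open>?stop\<close> makes the value equal to \<open>k\<close>.\<close>
    have chk: "test_val W w s2 ?check \<longleftrightarrow> ?stop"
    proof (cases "band ?H (N, M)")
      case True
      then have "test_val W w s2 ?check \<longleftrightarrow> \<not> (real K < ?v s2 \<and> K < N + M)"
        using bt look rd f b by (simp add: word_simps)
      then show ?thesis using kv[OF True] vk(1) by linarith
    next
      case False
      then show ?thesis using bt vk(2) by auto
    qed
    have ls: "listing T Lf Rt IN s2"
      using s2(1) by (simp add: static_def listing_def)
    have branch: "run W w ?last s2 = (if ?stop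
        then run W w (Seq (SetReal 0 (Const 0) (entry (Const 0) (Const 0) (Word 0 oneE))) (put 10 oneE)) s2
        else run W w (Seq (put 18 (addE (sc 18) (sc 18)))
          (SetReal 4 (Const 0) (RAdd (Real 4 (Const 0)) (Real 4 (Const 0))))) s2)"
      by (simp only: run.simps chk)
    show "?Q (run W w ?last s2)"
      unfolding branch
    proof (cases ?stop)
      case True
      have "?v s2 = k" using vk[OF True] kv by (intro antisym) auto
      then show "?Q (if ?stop
        then run W w (Seq (SetReal 0 (Const 0) (entry (Const 0) (Const 0) (Word 0 oneE))) (put 10 oneE)) s2
        else run W w (Seq (put 18 (addE (sc 18) (sc 18)))
          (SetReal 4 (Const 0) (RAdd (Real 4 (Const 0)) (Real 4 (Const 0))))) s2)"
        unfolding if_P[OF True] using look[OF vk(2)[OF True]] by (simp add: state_simps)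
    next
      case False
      then show "?Q (if ?stop
        then run W w (Seq (SetReal 0 (Const 0) (entry (Const 0) (Const 0) (Word 0 oneE))) (put 10 oneE)) s2
        else run W w (Seq (put 18 (addE (sc 18) (sc 18)))
          (SetReal 4 (Const 0) (RAdd (Real 4 (Const 0)) (Real 4 (Const 0))))) s2)"
        unfolding if_not_P[OF False] using f ls kk
        by (simp add: state_simps listing_def ready_def)
    qed
  qed simp_all
  define B where "B = 2 * ?H + 1"
  have "runs W w iter_prog (2 + (T * (B * (B * 42 + 5) + 10) + 2 + 5)) ?Q s"
    unfolding iter_prog_def
  proof (rule runs_then[where T = 1 and P = "\<lambda>s'. s' = run W w (put 19 (addE (sc 18) (sc 18))) s"])
    fix s' assume s': "s' = run W w (put 19 (addE (sc 18) (sc 18))) s"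
    show "runs W w (Seq (put 20 (addE (addE (sc 19) (sc 19)) oneE)) (Seq table_prog ?last))
        (1 + (T * (B * (B * 42 + 5) + 10) + 2 + 5)) ?Q s'"
    proof (rule runs_then[where T = 1 and P = "\<lambda>s'. s' = s1"])
      show "runs W w (put 20 (addE (addE (sc 19) (sc 19)) oneE)) 1 (\<lambda>s'. s' = s1) s'"
        unfolding s' s1[symmetric] by (rule runs_flat) simp_all
      fix s'' assume s'': "s'' = s1"
      show "runs W w (Seq table_prog ?last) (T * (B * (B * 42 + 5) + 10) + 2 + 5) ?Q s''"
        unfolding s''
      proof (rule runs_then[OF runs_same[OF runs_table[OF st]]])
        fix s2 assume "static s2 \<and> (\<forall>i a b. cell i a b \<longrightarrow> good s2 i a b)"
          "same (modw table_prog) (modr table_prog) s1 s2"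
        then show "static s2 \<and> (\<forall>i a b. cell i a b \<longrightarrow> good s2 i a b) \<and>
            same (modw table_prog) (modr table_prog) s1 s2" by simp
      next
        fix s2 assume "static s2 \<and> (\<forall>i a b. cell i a b \<longrightarrow> good s2 i a b) \<and>
            same (modw table_prog) (modr table_prog) s1 s2"
        then show "runs W w ?last 5 ?Q s2" by (intro last) auto
      qed (simp add: B_def)
    qed simp
  qed (auto intro: runs_flat)
  \<comment> \<open>From \<open>B \<le> 5 * K\<close> an interval costs at most
    \<open>57 * 25 = 1425\<close> times \<open>K * K\<close> steps; the other 75 absorb the fixed 9
    steps.\<close>
  moreover have "2 + (T * (B * (B * 42 + 5) + 10) + 2 + 5) \<le> 1500 * T * K ^ 2"
  proof -
    have B: "1 \<le> B" "B \<le> 5 * K" using K by (auto simp: B_def)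
    have "B \<le> B * B" using B(1) by simp
    moreover have "B * (B * 42 + 5) + 10 = 42 * (B * B) + 5 * B + 10" by (simp add: algebra_simps)
    ultimately have "B * (B * 42 + 5) + 10 \<le> 57 * (B * B)" using B(1) by linarith
    also have "\<dots> \<le> 57 * ((5 * K) * (5 * K))" using B(2) by (intro mult_le_mono2 mult_le_mono)
    finally have "T * (B * (B * 42 + 5) + 10) \<le> T * (1425 * (K * K))"
      by (intro mult_le_mono2) (simp add: algebra_simps)
    moreover have "9 \<le> T * (75 * (K * K))"
    proof -
      have "1 * (75 * (1 * 1)) \<le> T * (75 * (K * K))" using T0 K by (intro mult_le_mono) auto
      then show ?thesis by linarith
    qed
    ultimately have "2 + (T * (B * (B * 42 + 5) + 10) + 2 + 5) \<le> T * (1425 * (K * K)) + T * (75 * (K * K))"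
      by linarith
    also have "\<dots> = 1500 * T * K ^ 2" by (simp add: power2_eq_square algebra_simps)
    finally show ?thesis .
  qed
  ultimately show ?thesis by (rule runs_mono)
qed

definition stop :: "nat \<Rightarrow> bool" where
  "stop e \<longleftrightarrow> k \<le> 2 ^ e \<or> N + M \<le> 2 ^ e"

lemma ex_stop: "\<exists>e. stop e"
proof -
  have "N + M \<le> 2 ^ (N + M)" by (rule less_imp_le) (rule less_exp)
  then show ?thesis unfolding stop_def by blast
qed

definition rounds :: nat where "rounds = (LEAST e. stop e)"

lemma rounds: "stop rounds" "e < rounds \<Longrightarrow> \<not> stop e"
  using LeastI_ex[OF ex_stop] not_less_Least unfolding rounds_def by auto

text \<open>The series sums to less than \<open>2000 * T * 4 ^ n\<close>; the excess in the constant
  pays for the loop tests.\<close>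

lemma geometric_cost:
  assumes "1 \<le> (T::nat)"
  shows "(\<Sum>e<Suc n. Suc (1500 * T * 4 ^ e)) + 1 \<le> 3000 * T * 4 ^ n"
proof (induction n)
  case (Suc n)
  have "1 * 1 \<le> T * 4 ^ n" using assms by (intro mult_le_mono) auto
  then show ?case using Suc by simp
qed (use assms in simp)

lemma runs_doubling:
  assumes fam: "FX.family T Lf Rt IN" and T: "T \<le> (N + 1) * (N + 1)"
    and L: "listing T Lf Rt IN s" and s: "words s 18 0 = 1" "reals s 4 0 = 1" "words s 10 0 = 0"
    and pos: "1 \<le> N + M"
  shows "runs W w (While (Eq (sc 10) (Const 0)) iter_prog) (3000 * T * 4 ^ rounds) (\<lambda>s. reals s 0 0 = k) s"
proof -
  let ?I = "\<lambda>e s. if e \<le> rounds then listing T Lf Rt IN s \<and> words s 18 0 = 2 ^ e \<and> reals s 4 0 = 2 ^ e \<and>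
    words s 10 0 = 0 else words s 10 0 = 1 \<and> reals s 0 0 = k"
  have "runs W w (While (Eq (sc 10) (Const 0)) iter_prog)
      ((\<Sum>e<Suc rounds. Suc (1500 * T * 4 ^ e)) + 1) (?I (Suc rounds)) s"
  proof (rule runs_While_count[where I = ?I])
    show "?I 0 s" using L s by simp
    show "\<not> test_val W w s (Eq (sc 10) (Const 0))" if "?I (Suc rounds) s" for s using that by simp
    fix e s assume e: "e < Suc rounds" and I: "?I e s"
    \<comment> \<open>The preceding budget was rejected and hence is below \<open>N + M\<close>.
      This bounds the width of the table, so that its indices fit into words.\<close>
    have K: "(2::nat) ^ e \<le> 2 * (N + M)"
    proof (cases e)
      case 0
      then show ?thesis using pos by simp
    next
      case (Suc d)
      then have "\<not> stop d" using rounds(2) e by simp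
      then show ?thesis using Suc by (simp add: stop_def)
    qed
    have sq: "(2 ^ e) ^ 2 = (4 :: nat) ^ e" by (simp add: power2_eq_square power_mult_distrib[symmetric])
    have "runs W w iter_prog (1500 * T * (2 ^ e) ^ 2) (\<lambda>s'. if k \<le> real (2 ^ e) \<or> N + M \<le> 2 ^ e
      then words s' 10 0 = 1 \<and> reals s' 0 0 = k
      else listing T Lf Rt IN s' \<and> words s' 18 0 = 2 * 2 ^ e \<and> reals s' 4 0 = real (2 * 2 ^ e) \<and>
        words s' 10 0 = 0) s"
      by (rule runs_iter[OF fam T]) (use I e K in simp_all)
    then have "runs W w iter_prog (1500 * T * 4 ^ e) (?I (Suc e)) s"
      unfolding sq
    proof (rule runs_mono)
      fix s' assume s': "if k \<le> real (2 ^ e) \<or> N + M \<le> 2 ^ e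
        then words s' 10 0 = 1 \<and> reals s' 0 0 = k
        else listing T Lf Rt IN s' \<and> words s' 18 0 = 2 * 2 ^ e \<and> reals s' 4 0 = real (2 * 2 ^ e) \<and>
          words s' 10 0 = 0"
      have "e = rounds \<longleftrightarrow> k \<le> real (2 ^ e) \<or> N + M \<le> 2 ^ e"
        using rounds e by (auto simp: stop_def less_Suc_eq)
      then show "?I (Suc e) s'" using s' e by (cases "e = rounds") auto
    qed simp
    then show "test_val W w s (Eq (sc 10) (Const 0)) \<and> runs W w iter_prog (1500 * T * 4 ^ e) (?I (Suc e)) s"
      using I e by simp
  qed
  moreover have "1 \<le> T" using FX.familyD(1)[OF fam] by simp
  ultimately show ?thesis
    by (elim runs_mono) (use geometric_cost in auto)
qed

lemma modw_progs:
  "modw eq_prog = {8, 10}" "modw (mate_prog c A R) = {7, 8, 9, R}" "modw inf_prog = {8}"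
  "modw chain_prog = {11, 12, 13, 14, 15, 16, 17}"
  "modr eq_prog = {}" "modr (mate_prog c A R) = {}" "modr inf_prog = {3}" "modr chain_prog = {}"
  by (auto simp: eq_prog_def mate_prog_def inf_prog_def chain_prog_def top_prog_def write_prog_def
      move_prog_def bump_prog_def loop_def)

lemma input: "holds_input (euler F) (euler G) (input_state F G)" "words (input_state F G) 13 = (\<lambda>_. 0)"
  "reals (input_state F G) 0 0 = 0"
  by (auto simp: holds_input_def input_state_def Let_def array_of_def)

lemma runs_ted_prog:
  assumes m: "N + 1 < 2 ^ m"
  shows "runs W w ted_prog (200 * (N + M + 1) +
    (if euler F = euler G then 0 else 3030 * ((N + 1) * m) * 4 ^ rounds)) (\<lambda>s. reals s 0 0 = k) (input_state F G)"
proof -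
  let ?s = "input_state F G" and ?in = "holds_input (euler F) (euler G)"
  let ?E = "if euler F = euler G then 0 else 3030 * ((N + 1) * m) * 4 ^ rounds"
  let ?R = "Seq (mate_prog 0 1 5) (Seq (mate_prog 1 3 6) (Seq inf_prog (Seq chain_prog
       (Seq (Seq (put 18 oneE) (SetReal 4 (Const 0) (RConst 1)))
          (While (Eq (sc 10) (Const 0)) iter_prog)))))"
  let ?P1 = "\<lambda>s :: state. ?in s \<and> words s 13 = (\<lambda>_. 0) \<and> words s 10 0 = of_bool (euler F = euler G) \<and>
    reals s 0 0 = 0"
  let ?P2 = "\<lambda>s :: state. ?in s \<and> words s 13 = (\<lambda>_. 0) \<and> words s 10 0 = 0"
  let ?FM = "\<lambda>s :: state. \<forall>j<N. words s 5 j = mate (euler F) j"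
  let ?GM = "\<lambda>s :: state. \<forall>j<M. words s 6 j = mate (euler G) j"
  have inp: "?in s'" if "?in s" "same Ws Rs s s'" "{0, 1, 2, 3, 4} \<inter> Ws = {}" for s s' Ws Rs
  proof -
    have "words s' A = words s A" if "A \<le> 4" for A
    proof -
      have "A = 0 \<or> A = 1 \<or> A = 2 \<or> A = 3 \<or> A = 4" using that by linarith
      then have "A \<notin> Ws" using \<open>{0, 1, 2, 3, 4} \<inter> Ws = {}\<close> by auto
      then show ?thesis using \<open>same Ws Rs s s'\<close> by (rule sameW[rotated])
    qed
    from holds_input_cong[of s' s, OF this] show ?thesis using that(1) by simp
  qed
  have 1: "runs W w eq_prog (5 * N + 20) ?P1 ?s"
    by (rule runs_same[OF runs_eq_prog[OF input(1)]])
      (use input inp in \<open>auto simp: modw_progs dest: sameW[where A = 13] sameR[where A = 0]\<close>)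
  have 2: "runs W w (mate_prog 0 1 5) (9 * N + 5) (\<lambda>s. ?P2 s \<and> ?FM s) s" if s: "?P2 s" for s
  proof (rule runs_same[OF runs_mate_prog[OF FX.mates_axioms]])
    show "words s 1 j = of_bool (j < mate (euler F) j)" if "j < N" for j
      using s that is_open_iff_mate[OF X that] by (simp add: holds_input_def)
    fix s' assume "?FM s'" "same (modw (mate_prog 0 1 5)) (modr (mate_prog 0 1 5)) s s'"
    then show "?P2 s' \<and> ?FM s'"
      using s inp by (auto simp: modw_progs dest: sameW[where A = 13] sameW[where A = 10])
  qed (use s in \<open>auto simp: holds_input_def\<close>)
  have 3: "runs W w (mate_prog 1 3 6) (9 * M + 5) (\<lambda>s. ?P2 s \<and> ?FM s \<and> ?GM s) s" if s: "?P2 s \<and> ?FM s" for s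
  proof (rule runs_same[OF runs_mate_prog[OF GY.mates_axioms]])
    show "words s 3 j = of_bool (j < mate (euler G) j)" if "j < M" for j
      using s that is_open_iff_mate[OF Y that] by (simp add: holds_input_def)
    fix s' assume "?GM s'" "same (modw (mate_prog 1 3 6)) (modr (mate_prog 1 3 6)) s s'"
    then show "?P2 s' \<and> ?FM s' \<and> ?GM s'"
      using s inp by (auto simp: modw_progs dest: sameW[where A = 13] sameW[where A = 10] sameW[where A = 5])
  qed (use s in \<open>auto simp: holds_input_def\<close>)
  have 4: "runs W w inf_prog (3 * N + 3 * M + 5) (\<lambda>s. ?P2 s \<and> ?FM s \<and> ?GM s \<and> reals s 3 0 = trivial_cost) s"
    if s: "?P2 s \<and> ?FM s \<and> ?GM s" for s
  proof (rule runs_same[OF runs_inf_prog])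
    fix s' assume "reals s' 3 0 = trivial_cost" "same (modw inf_prog) (modr inf_prog) s s'"
    then show "?P2 s' \<and> ?FM s' \<and> ?GM s' \<and> reals s' 3 0 = trivial_cost"
      using s inp by (auto simp: modw_progs dest: sameW[where A = 13] sameW[where A = 10]
        sameW[where A = 5] sameW[where A = 6])
  qed (use s in simp)
  let ?P5 = "\<lambda>s. \<exists>T Lf Rt IN. FX.family T Lf Rt IN \<and> T \<le> (N + 1) * (N + 1) \<and> T \<le> (N + 1) * m \<and>
    listing T Lf Rt IN s \<and> words s 10 0 = 0"
  have 5: "runs W w chain_prog (32 * (N + 1) + 3 + 30 * ((N + 1) * m)) ?P5 s"
    if s: "?P2 s \<and> ?FM s \<and> ?GM s \<and> reals s 3 0 = trivial_cost" for s
  proof (rule runs_same[OF runs_chain_prog[OF _ _ m]])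
    show "ready s" using s by (simp add: ready_def)
    show "words s 13 = (\<lambda>_. 0)" using s by simp
    fix s' assume s': "ready s' \<and> words s' 17 0 \<le> (N + 1) * m \<and> words s' 17 0 \<le> (N + 1) * (N + 1) \<and>
        FX.family (words s' 17 0) (words s' 11) (words s' 12) (words s' 13)"
      and sm: "same (modw chain_prog) (modr chain_prog) s s'"
    have "words s' 6 = words s 6" "words s' 10 = words s 10" "reals s' 3 = reals s 3"
      by (rule sameW[OF sm] sameR[OF sm], simp add: modw_progs)+
    then show "?P5 s'"
      using s s' by (intro exI[of _ "words s' 17 0"] exI[of _ "words s' 11"] exI[of _ "words s' 12"]
        exI[of _ "words s' 13"]) (auto simp: listing_def)
  qed
  let ?init = "Seq (put 18 oneE) (SetReal 4 (Const 0) (RConst 1))"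
  let ?P6 = "\<lambda>s. ?P5 s \<and> words s 18 0 = 1 \<and> reals s 4 0 = 1"
  have 6: "runs W w ?init 2 ?P6 s" if s: "?P5 s" for s
  proof (rule runs_flat)
    have "listing T Lf Rt IN (run W w ?init s) \<longleftrightarrow> listing T Lf Rt IN s" for T Lf Rt IN
      by (simp add: listing_def ready_def state_simps)
    then show "?P6 (run W w ?init s)" using s by (simp add: state_simps)
  qed simp_all
  have 7: "runs W w (While (Eq (sc 10) (Const 0)) iter_prog) (3000 * ((N + 1) * m) * 4 ^ rounds)
      (\<lambda>s. reals s 0 0 = k) s" if s: "?P6 s" and ne: "euler F \<noteq> euler G" for s
  proof -
    obtain T Lf Rt IN where *: "FX.family T Lf Rt IN" "T \<le> (N + 1) * (N + 1)" "T \<le> (N + 1) * m"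
      "listing T Lf Rt IN s" "words s 10 0 = 0" using s by blast
    have "1 \<le> N + M" using ne by (cases "euler F"; cases "euler G") auto
    then have "runs W w (While (Eq (sc 10) (Const 0)) iter_prog) (3000 * T * 4 ^ rounds)
      (\<lambda>s. reals s 0 0 = k) s"
      using s * by (intro runs_doubling[OF *(1,2,4)]) auto
    then show ?thesis
      by (rule runs_mono) (use *(3) in \<open>auto intro!: mult_le_mono\<close>)
  qed
  have rest: "runs W w ?R (9 * N + 5 + (9 * M + 5 + (3 * N + 3 * M + 5 + (32 * (N + 1) + 3 + 30 * ((N + 1) * m) +
      (2 + 3000 * ((N + 1) * m) * 4 ^ rounds))))) (\<lambda>s. reals s 0 0 = k) s"
    if s: "?P1 s" and ne: "euler F \<noteq> euler G" for s
    by (rule runs_then[OF 2 runs_then[OF 3 runs_then[OF 4 runs_then[OF 5 runs_then[OF 6 7[OF _ ne]]]]]])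
      (use s ne in auto)
  have bound: "30 * ((N + 1) * m) + 3000 * ((N + 1) * m) * 4 ^ rounds \<le> 3030 * ((N + 1) * m) * 4 ^ rounds"
  proof -
    have "30 * x + 3000 * x * y \<le> 3030 * x * y" if "1 \<le> y" for x y :: nat
      using that by (cases y) simp_all
    from this[of "4 ^ rounds" "(N + 1) * m"] show ?thesis by (simp only: one_le_power one_le_numeral)
  qed
  show ?thesis
    unfolding ted_prog_def
  proof (rule runs_then[OF 1])
    fix s assume s: "?P1 s"
    show "runs W w (Cond (Eq (sc 10) oneE) Skip ?R) (Suc (48 * (N + M) + 60 + ?E)) (\<lambda>s. reals s 0 0 = k) s"
    proof (rule runs_Cond)
      assume "test_val W w s (Eq (sc 10) oneE)"
      then have "euler F = euler G" using s by (cases "euler F = euler G") simp_all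
      then show "runs W w Skip (48 * (N + M) + 60 + ?E) (\<lambda>s. reals s 0 0 = k) s"
        using s k_same by (intro runs_flat) auto
    next
      assume "\<not> test_val W w s (Eq (sc 10) oneE)"
      then have ne: "euler F \<noteq> euler G" using s by auto
      show "runs W w ?R (48 * (N + M) + 60 + ?E) (\<lambda>s. reals s 0 0 = k) s"
        by (rule runs_mono[OF rest[OF s ne]]) (use ne bound in simp_all)
    qed
  qed simp
qed

text \<open>The last rejected budget is below both \<open>k\<close> and \<open>N + M\<close>, and
  the accepted one is twice as large. If the first budget 1 is accepted, the bound by
  \<open>k\<close> comes from \<open>k_differ\<close>.\<close>

lemma rounds_bound:
  assumes "euler F \<noteq> euler G"
  shows "4 ^ rounds \<le> 4 * k\<^sup>2" "4 ^ rounds \<le> 4 * (N + M) ^ 2"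
proof -
  have pos: "1 \<le> N + M" using assms by (cases "euler F"; cases "euler G") auto
  have k: "1 / 2 \<le> k" by (rule k_differ[OF assms])
  have "2 ^ rounds \<le> 2 * k \<and> 2 ^ rounds \<le> 2 * (N + M)"
  proof (cases rounds)
    case 0
    then show ?thesis using k pos by simp
  next
    case (Suc e)
    then have "\<not> stop e" using rounds(2) by simp
    then show ?thesis using Suc by (simp add: stop_def)
  qed
  then have 1: "2 ^ rounds \<le> 2 * k" "2 ^ rounds \<le> 2 * (N + M)" by auto
  have sq: "4 ^ rounds = (2 ^ rounds :: 'c :: comm_semiring_1) ^ 2"
    by (simp add: power2_eq_square power_mult_distrib[symmetric])
  show "4 ^ rounds \<le> 4 * k\<^sup>2"
    using power_mono[OF 1(1), of 2] unfolding sq by (simp add: power_mult_distrib)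
  show "4 ^ rounds \<le> 4 * (N + M) ^ 2"
  proof -
    have "(2 * (N + M)) ^ 2 = 4 * (N + M) ^ 2" by (simp only: power_mult_distrib) simp
    then show ?thesis using power_mono[OF 1(2), of 2] unfolding sq by linarith
  qed
qed

lemma time_bound:
  assumes n: "n = forest_nodes F + forest_nodes G"
  shows "\<exists>t s. exec W w ted_prog (input_state F G) t s \<and> result s = k \<and>
    real t \<le> 1000000 * (1 + real n + real n * k\<^sup>2 * ln (real n))"
proof -
  have NM: "N + M = 2 * n" using n by (simp add: length_euler)
  define m where "m = (LEAST m. N + 1 < 2 ^ m)"
  have ex: "N + 1 < 2 ^ (N + 1)" by (rule less_exp)
  have m: "N + 1 < 2 ^ m" unfolding m_def by (rule LeastI[of "\<lambda>m. N + 1 < 2 ^ m", OF ex])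
  have m0: "m \<noteq> 0" using m by (intro notI) simp
  have m': "2 ^ (m - 1) \<le> N + 1"
    using not_less_Least[of "m - 1" "\<lambda>m. N + 1 < 2 ^ m"] m0 unfolding m_def[symmetric] by simp
  let ?E = "if euler F = euler G then 0 else 3030 * ((N + 1) * m) * 4 ^ rounds"
  obtain t s where t: "exec W w ted_prog (input_state F G) t s" "t \<le> 200 * (N + M + 1) + ?E" "reals s 0 0 = k"
    using runs_ted_prog[OF m] unfolding runs_def by blast
  have lin: "200 * (real N + real M + 1) \<le> 400 * (1 + real n)"
    using NM by (simp add: of_nat_add[symmetric] del: of_nat_add)
  have ln0: "0 \<le> ln (real n)" by (cases "n = 0") auto
  have E: "real ?E \<le> 999600 * (1 + real n + real n * k\<^sup>2 * ln (real n))"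
  proof (cases "euler F = euler G")
    case True
    then show ?thesis using ln0 by simp
  next
    case False
    then have "1 \<le> n" using NM by (cases "euler F"; cases "euler G") auto
    then consider "n = 1" | "2 \<le> n" by linarith
    then show ?thesis
    proof cases
      \<comment> \<open>Here \<open>ln 1 = 0\<close> removes the main term, so the time must be
        bounded by a constant.\<close>
      case 1
      have "(2::nat) ^ (m - 1) < 2 ^ 2" using m' NM 1 by simp
      then have "m - 1 < 2" by (rule power_less_imp_less_exp[rotated]) simp
      then have "m \<le> 2" by simp
      moreover have "N + 1 \<le> 3" "N + M = 2" using NM 1 by simp_all
      moreover have "(4::nat) ^ rounds \<le> 16" using rounds_bound(2)[OF False] calculation(3) by simp
      ultimately have "3030 * ((N + 1) * m) * 4 ^ rounds \<le> (3030 * (3 * 2) * 16 :: nat)"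
        by (intro mult_le_mono) auto
      then have "real (3030 * ((N + 1) * m) * 4 ^ rounds) \<le> real (3030 * (3 * 2) * 16)"
        by (rule of_nat_mono)
      then show ?thesis using False 1 by simp
    next
      case 2
      have l2: "1 / 2 \<le> ln (2 :: real)" using exp_half_le2 by (subst ln_ge_iff) auto
      have ln2n: "ln 2 \<le> ln (real n)" using 2 by simp
      \<comment> \<open>The exponent 3 is a convenient choice: it turns
        \<open>2 ^ (m - 1) \<le> N + 1\<close> into \<open>m \<le> 8 * ln n\<close>.\<close>
      have nn: "N + 1 \<le> n ^ 3"
      proof -
        have "2 * 2 * n \<le> n * n * n" using 2 by (intro mult_le_mono) auto
        then show ?thesis unfolding power3_eq_cube using NM 2 by linarith
      qed
      have "(real m - 1) * ln 2 = ln (2 ^ (m - 1))"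
        using m0 by (simp add: ln_realpow of_nat_diff)
      also have "\<dots> \<le> ln (real (n ^ 3))"
      proof (rule ln_mono)
        have "2 ^ (m - 1) \<le> n ^ 3" using m' nn by linarith
        then show "(2 :: real) ^ (m - 1) \<le> real (n ^ 3)"
          by (metis of_nat_le_iff of_nat_numeral of_nat_power)
      qed (use 2 in auto)
      also have "\<dots> = 3 * ln (real n)" using 2 by (simp add: ln_realpow)
      finally have "real m * ln 2 \<le> 4 * ln (real n)" using ln2n by (simp add: algebra_simps)
      moreover have "real m * (1 / 2) \<le> real m * ln 2" by (rule mult_left_mono[OF l2]) simp
      ultimately have rm: "real m \<le> 8 * ln (real n)" by simp
      have rN: "real (N + 1) \<le> 3 * real n" using NM 2 by linarith
      have "real ?E = 3030 * (real (N + 1) * real m) * 4 ^ rounds"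
        using False by (simp add: algebra_simps)
      \<comment> \<open>The factors are \<open>N + 1 \<le> 3 * n\<close>,
        \<open>m \<le> 8 * ln n\<close> and \<open>4 ^ rounds \<le> 4 * k\<^sup>2\<close>; their
        constants multiply to 290880.\<close>
      also have "\<dots> \<le> 3030 * ((3 * real n) * (8 * ln (real n))) * (4 * k\<^sup>2)"
        using rm rN rounds_bound(1)[OF False] ln0 by (intro mult_mono mult_nonneg_nonneg) auto
      also have "\<dots> = 290880 * (real n * k\<^sup>2 * ln (real n))" by simp
      also have "\<dots> \<le> 999600 * (1 + real n + real n * k\<^sup>2 * ln (real n))"
        using ln0 by (simp add: distrib_left add_increasing)
      finally show ?thesis .
    qed
  qed
  have "real t \<le> 200 * (real N + real M + 1) + real ?E"
    using of_nat_mono[OF t(2), where 'a = real] by simp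
  also have "\<dots> \<le> 400 * (1 + real n) + 999600 * (1 + real n + real n * k\<^sup>2 * ln (real n))"
    using lin E by linarith
  also have "\<dots> \<le> 1000000 * (1 + real n + real n * k\<^sup>2 * ln (real n))"
    using ln0 by simp
  finally show ?thesis using t(1,3) unfolding result_def by blast
qed

end

text \<open>The constant 18: the left side is \<open>2 ^ 12 * (n + 2) ^ 6\<close>, and
  \<open>2 \<le> n + 2\<close> bounds it by \<open>(n + 2) ^ 18\<close>.\<close>

lemma word_size:
  assumes W: "18 * log 2 (real n + 2) \<le> real W"
  shows "64 * (2 * n + 4) ^ 6 \<le> 2 ^ W"
proof -
  have "(64 :: nat) * (2 * n + 4) ^ 6 = 2 ^ 12 * (n + 2) ^ 6"
  proof -
    have "2 * n + 4 = 2 * (n + 2)" by simp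
    then show ?thesis by (simp only: power_mult_distrib) simp
  qed
  also have "\<dots> \<le> (n + 2) ^ 12 * (n + 2) ^ 6"
    by (intro mult_le_mono1 power_mono) auto
  also have "\<dots> = (n + 2) ^ 18" by (simp add: power_add[symmetric])
  finally have "64 * (2 * n + 4) ^ 6 \<le> (n + 2) ^ 18" .
  moreover have "real ((n + 2) ^ 18) \<le> real (2 ^ W)"
  proof -
    have "real ((n + 2) ^ 18) = 2 powr (18 * log 2 (real n + 2))"
      by (simp add: powr_powr[symmetric] mult.commute[of 18] powr_numeral add.commute)
    also have "\<dots> \<le> 2 powr real W" using W by (intro powr_mono) auto
    also have "\<dots> = real (2 ^ W)" by (simp add: powr_realpow)
    finally show ?thesis .
  qed
  ultimately show ?thesis by (meson of_nat_le_iff order_trans)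
qed

text \<open>The summand \<open>1 + n\<close> accounts for reading the input, as the product vanishes
  for \<open>k = 0\<close> and for \<open>n \<le> 1\<close>.\<close>

theorem theorem2:
  shows "\<exists>(prog :: com) (c :: real) (C :: real).
    \<forall>(\<Sigma> :: nat set) (w :: nat weight) (F :: nat forest) (G :: nat forest) (W :: nat) (n :: nat) (k :: real).
      normalized \<Sigma> w \<longrightarrow>
      forest_labels F \<subseteq> \<Sigma> \<longrightarrow> forest_labels G \<subseteq> \<Sigma> \<longrightarrow>
      n = forest_nodes F + forest_nodes G \<longrightarrow>
      k = ted w F G \<longrightarrow>
      real W \<ge> c * log 2 (real n + 2) \<longrightarrow>
      forest_labels F \<union> forest_labels G \<subseteq> {..<2 ^ W} \<longrightarrow>
      (\<exists>t s. exec W w prog (input_state F G) t s \<and> result s = k \<and>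
             real t \<le> C * (1 + real n + real n * k\<^sup>2 * ln (real n)))"
proof (rule exI[of _ ted_prog], rule exI[of _ 18], rule exI[of _ 1000000], intro allI impI)
  fix \<Sigma> :: "nat set" and w :: "nat weight" and F G :: "nat forest" and W n :: nat and k :: real
  assume *: "normalized \<Sigma> w" "forest_labels F \<subseteq> \<Sigma>" "forest_labels G \<subseteq> \<Sigma>"
    and n: "n = forest_nodes F + forest_nodes G" and k: "k = ted w F G"
    and W: "real W \<ge> 18 * log 2 (real n + 2)"
  have "length (euler F) + length (euler G) = 2 * n" by (simp add: n length_euler)
  then interpret problem \<Sigma> w F G W
    by unfold_locales (use * word_size[OF W] in simp_all)
  show "\<exists>t s. exec W w ted_prog (input_state F G) t s \<and> result s = k \<and>
      real t \<le> 1000000 * (1 + real n + real n * k\<^sup>2 * ln (real n))"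
    unfolding k by (rule time_bound[OF n])
qed

end
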